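(* Let $(M,g)$ be a closed Riemannian manifold of dimension $n$, $q$ a symmetric $(0,2)$-tensor field, $X$ a vector field, and $\varphi$ a function on $M$ such that $$\tfrac12\mathcal{L}_Xg=\tfrac12q+\varphi g .$$ Let $\mathring q=q-\frac{\mathrm{tr}(q)}{n}g$ be the trace-free part of $q$, and let $\mathring{\mathcal{L}_Xg}$ be the trace-free part of $\mathcal{L}_Xg$. Then $$\int_M\Big(\varphi\,\mathrm{tr}(q)+\frac{(\mathrm{tr}(q))^2}{2n}+(\mathrm{div}\,q)(X)\Big)dvol_g=-\frac12\int_M\|\mathring q\|^2dvol_g\le0,\qquad(\mathrm{a})$$ $$\int_M(\mathrm{div}\,\mathring q)(X)\,dvol_g=-\frac12\int_M\|\mathring{\mathcal{L}_Xg}\|^2dvol_g\le0.\qquad(\mathrm{b})$$ In particular, the integral on the left-hand side of either (a) or (b) is equal to $0$ if and only if $X$ is a conformal field and $q=2\big(\frac{\mathrm{div}X}{n}-\varphi\big)g$.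
   Context: All tensors and functions are smooth; closed means compact without boundary; $\mathcal{L}$ is the Lie derivative. $\mathrm{tr}$ is the trace with respect to $g$, $(\mathrm{div}\,T)_j=\nabla^iT_{ij}$ for a symmetric $2$-tensor $T$, and $\mathrm{div}X=\nabla_iX^i$. Norms of $2$-tensors are the ones induced by $g$, $\|T\|^2=T_{ij}T^{ij}$. $X$ is a conformal field if $\mathcal{L}_Xg=2\sigma g$ for some function $\sigma$. *)

theory Defs
  imports "HOL-Analysis.Analysis"
begin

text \<open>
  A closed \<open>n\<close>-manifold is a compact Hausdorff space (the type \<open>'m\<close>) with a smooth atlas modelled
  on \<open>real ^ 'n\<close>, \<open>n = CARD('n)\<close>.  Vector fields and (0,2)-tensor fields are given by their
  components: one component function for every chart of the atlas, transforming in the usual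
  way under changes of charts.  Component functions are functions of the point \<open>p\<close> (not of its
  coordinates), and only their values at points of the domain of the chart matter.
\<close>

section \<open>Smooth maps between normed spaces\<close>

primrec C_k_on ::
  "nat \<Rightarrow> 'a::real_normed_vector set \<Rightarrow> ('a \<Rightarrow> 'b::real_normed_vector) \<Rightarrow> bool" where
  "C_k_on 0 S f \<longleftrightarrow> continuous_on S f"
| "C_k_on (Suc k) S f \<longleftrightarrow>
     (\<forall>x\<in>S. f differentiable (at x)) \<and>
     (\<forall>v. C_k_on k S (\<lambda>x. frechet_derivative f (at x) v))"

text \<open>Meant for open \<open>S\<close> in a finite-dimensional space.\<close>

definition smooth_on ::
  "'a::real_normed_vector set \<Rightarrow> ('a \<Rightarrow> 'b::real_normed_vector) \<Rightarrow> bool" where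
  "smooth_on S f \<longleftrightarrow> (\<forall>k. C_k_on k S f)"

section \<open>Smooth manifolds\<close>

datatype ('m, 'n::finite) chart = Chart (chart_dom: "'m set") (chart_map: "'m \<Rightarrow> real ^ 'n")

definition chart_img :: "('m, 'n::finite) chart \<Rightarrow> (real ^ 'n) set" where
  "chart_img c = chart_map c ` chart_dom c"

definition chart_inv :: "('m, 'n::finite) chart \<Rightarrow> real ^ 'n \<Rightarrow> 'm" where
  "chart_inv c = inv_into (chart_dom c) (chart_map c)"

definition is_chart :: "('m::topological_space, 'n::finite) chart \<Rightarrow> bool" where
  "is_chart c \<longleftrightarrow> open (chart_dom c) \<and> open (chart_img c) \<and>
     homeomorphism (chart_dom c) (chart_img c) (chart_map c) (chart_inv c)"

definition transition ::
  "('m, 'n::finite) chart \<Rightarrow> ('m, 'n) chart \<Rightarrow> real ^ 'n \<Rightarrow> real ^ 'n" where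
  "transition c d = chart_map d \<circ> chart_inv c"

definition smooth_atlas :: "('m::topological_space, 'n::finite) chart set \<Rightarrow> bool" where
  "smooth_atlas A \<longleftrightarrow>
     (\<forall>c\<in>A. is_chart c) \<and>
     (\<Union>c\<in>A. chart_dom c) = UNIV \<and>
     (\<forall>c\<in>A. \<forall>d\<in>A. smooth_on (chart_map c ` (chart_dom c \<inter> chart_dom d)) (transition c d))"

text \<open>Second countability follows from compactness, so it is not required separately.\<close>

definition closed_manifold :: "('m::t2_space, 'n::finite) chart set \<Rightarrow> bool" where
  "closed_manifold A \<longleftrightarrow> smooth_atlas A \<and> compact (UNIV :: 'm set)"

definition smooth_in_chart ::
  "('m, 'n::finite) chart \<Rightarrow> ('m \<Rightarrow> 'b::real_normed_vector) \<Rightarrow> bool" where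
  "smooth_in_chart c f \<longleftrightarrow> smooth_on (chart_img c) (f \<circ> chart_inv c)"

definition smooth_function ::
  "('m, 'n::finite) chart set \<Rightarrow> ('m \<Rightarrow> real) \<Rightarrow> bool" where
  "smooth_function A f \<longleftrightarrow> (\<forall>c\<in>A. smooth_in_chart c f)"

section \<open>Vector fields and (0,2)-tensor fields\<close>

type_synonym ('m, 'n) vfield = "('m, 'n) chart \<Rightarrow> 'm \<Rightarrow> real ^ 'n"
type_synonym ('m, 'n) tensor2 = "('m, 'n) chart \<Rightarrow> 'm \<Rightarrow> real ^ 'n ^ 'n"

text \<open>The matrix of partial derivatives of the \<open>d\<close>-coordinates by the \<open>c\<close>-coordinates.\<close>

definition coord_jacobian ::
  "('m, 'n::finite) chart \<Rightarrow> ('m, 'n) chart \<Rightarrow> 'm \<Rightarrow> real ^ 'n ^ 'n" where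
  "coord_jacobian c d p = jacobian (transition c d) (at (chart_map c p))"

definition vector_field ::
  "('m, 'n::finite) chart set \<Rightarrow> ('m, 'n) vfield \<Rightarrow> bool" where
  "vector_field A X \<longleftrightarrow>
     (\<forall>c\<in>A. smooth_in_chart c (X c)) \<and>
     (\<forall>c\<in>A. \<forall>d\<in>A. \<forall>p \<in> chart_dom c \<inter> chart_dom d.
        X d p = coord_jacobian c d p *v X c p)"

definition tensor_field ::
  "('m, 'n::finite) chart set \<Rightarrow> ('m, 'n) tensor2 \<Rightarrow> bool" where
  "tensor_field A T \<longleftrightarrow>
     (\<forall>c\<in>A. smooth_in_chart c (T c)) \<and>
     (\<forall>c\<in>A. \<forall>d\<in>A. \<forall>p \<in> chart_dom c \<inter> chart_dom d.
        T c p = transpose (coord_jacobian c d p) ** T d p ** coord_jacobian c d p)"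

definition symmetric_tensor_field ::
  "('m, 'n::finite) chart set \<Rightarrow> ('m, 'n) tensor2 \<Rightarrow> bool" where
  "symmetric_tensor_field A T \<longleftrightarrow> tensor_field A T \<and>
     (\<forall>c\<in>A. \<forall>p\<in>chart_dom c. transpose (T c p) = T c p)"

definition tensor_eq ::
  "('m, 'n::finite) chart set \<Rightarrow> ('m, 'n) tensor2 \<Rightarrow> ('m, 'n) tensor2 \<Rightarrow> bool" where
  "tensor_eq A S T \<longleftrightarrow> (\<forall>c\<in>A. \<forall>p\<in>chart_dom c. S c p = T c p)"

definition riemannian_metric ::
  "('m, 'n::finite) chart set \<Rightarrow> ('m, 'n) tensor2 \<Rightarrow> bool" where
  "riemannian_metric A g \<longleftrightarrow> symmetric_tensor_field A g \<and>
     (\<forall>c\<in>A. \<forall>p\<in>chart_dom c. \<forall>v. v \<noteq> 0 \<longrightarrow> v \<bullet> (g c p *v v) > 0)"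

section \<open>Differential operators in local coordinates\<close>

definition partial ::
  "('m, 'n::finite) chart \<Rightarrow> 'n \<Rightarrow> ('m \<Rightarrow> real) \<Rightarrow> 'm \<Rightarrow> real" where
  "partial c i f p = frechet_derivative (f \<circ> chart_inv c) (at (chart_map c p)) (axis i 1)"

definition lie_derivative ::
  "('m, 'n::finite) vfield \<Rightarrow> ('m, 'n) tensor2 \<Rightarrow> ('m, 'n) tensor2" where
  "lie_derivative X T c p = (\<chi> i j. \<Sum>k\<in>UNIV.
       X c p $ k * partial c k (\<lambda>y. T c y $ i $ j) p
     + T c p $ k $ j * partial c i (\<lambda>y. X c y $ k) p
     + T c p $ i $ k * partial c j (\<lambda>y. X c y $ k) p)"

definition metric_inv :: "('m, 'n::finite) tensor2 \<Rightarrow> ('m, 'n) tensor2" where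
  "metric_inv g c p = matrix_inv (g c p)"

text \<open>\<open>christoffel g c k i j p\<close> is the Christoffel symbol with upper index \<open>k\<close> and lower
  indices \<open>i\<close>, \<open>j\<close>.\<close>

definition christoffel ::
  "('m, 'n::finite) tensor2 \<Rightarrow> ('m, 'n) chart \<Rightarrow> 'n \<Rightarrow> 'n \<Rightarrow> 'n \<Rightarrow> 'm \<Rightarrow> real" where
  "christoffel g c k i j p = (\<Sum>l\<in>UNIV. 1/2 * metric_inv g c p $ k $ l *
     (partial c i (\<lambda>y. g c y $ j $ l) p
      + partial c j (\<lambda>y. g c y $ i $ l) p
      - partial c l (\<lambda>y. g c y $ i $ j) p))"

text \<open>The component of the covariant derivative of the vector field \<open>X\<close> in direction \<open>i\<close>,
  upper index \<open>j\<close>, and that of the tensor field \<open>T\<close> in direction \<open>k\<close>, lower indices \<open>i\<close>, \<open>j\<close>.\<close>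

definition nabla_vector ::
  "('m, 'n::finite) tensor2 \<Rightarrow> ('m, 'n) vfield \<Rightarrow> ('m, 'n) chart \<Rightarrow> 'n \<Rightarrow> 'n \<Rightarrow> 'm \<Rightarrow> real" where
  "nabla_vector g X c i j p =
     partial c i (\<lambda>y. X c y $ j) p + (\<Sum>k\<in>UNIV. christoffel g c j i k p * X c p $ k)"

definition nabla_tensor ::
  "('m, 'n::finite) tensor2 \<Rightarrow> ('m, 'n) tensor2 \<Rightarrow> ('m, 'n) chart
     \<Rightarrow> 'n \<Rightarrow> 'n \<Rightarrow> 'n \<Rightarrow> 'm \<Rightarrow> real" where
  "nabla_tensor g T c k i j p =
     partial c k (\<lambda>y. T c y $ i $ j) p
     - (\<Sum>l\<in>UNIV. christoffel g c l k i p * T c p $ l $ j)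
     - (\<Sum>l\<in>UNIV. christoffel g c l k j p * T c p $ i $ l)"

definition div_tensor ::
  "('m, 'n::finite) tensor2 \<Rightarrow> ('m, 'n) tensor2 \<Rightarrow> ('m, 'n) chart \<Rightarrow> 'm \<Rightarrow> real ^ 'n" where
  "div_tensor g T c p = (\<chi> j. \<Sum>i\<in>UNIV. \<Sum>k\<in>UNIV.
     metric_inv g c p $ i $ k * nabla_tensor g T c k i j p)"

section \<open>Scalar functions on the manifold\<close>

text \<open>The scalars below are given by expressions in local coordinates that do not depend on
  the chart; they are evaluated at each point in an arbitrarily chosen chart around it.\<close>

definition chart_at :: "('m, 'n::finite) chart set \<Rightarrow> 'm \<Rightarrow> ('m, 'n) chart" where
  "chart_at A p = (SOME c. c \<in> A \<and> p \<in> chart_dom c)"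

definition tr ::
  "('m, 'n::finite) chart set \<Rightarrow> ('m, 'n) tensor2 \<Rightarrow> ('m, 'n) tensor2 \<Rightarrow> 'm \<Rightarrow> real" where
  "tr A g T p = (let c = chart_at A p in
     \<Sum>i\<in>UNIV. \<Sum>j\<in>UNIV. metric_inv g c p $ i $ j * T c p $ i $ j)"

definition norm_sq ::
  "('m, 'n::finite) chart set \<Rightarrow> ('m, 'n) tensor2 \<Rightarrow> ('m, 'n) tensor2 \<Rightarrow> 'm \<Rightarrow> real" where
  "norm_sq A g T p = (let c = chart_at A p in
     \<Sum>i\<in>UNIV. \<Sum>j\<in>UNIV. \<Sum>k\<in>UNIV. \<Sum>l\<in>UNIV.
       metric_inv g c p $ i $ k * metric_inv g c p $ j $ l * T c p $ i $ j * T c p $ k $ l)"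

definition div_vector ::
  "('m, 'n::finite) chart set \<Rightarrow> ('m, 'n) tensor2 \<Rightarrow> ('m, 'n) vfield \<Rightarrow> 'm \<Rightarrow> real" where
  "div_vector A g X p = (\<Sum>i\<in>UNIV. nabla_vector g X (chart_at A p) i i p)"

definition div_tensor_app ::
  "('m, 'n::finite) chart set \<Rightarrow> ('m, 'n) tensor2 \<Rightarrow> ('m, 'n) tensor2 \<Rightarrow> ('m, 'n) vfield
     \<Rightarrow> 'm \<Rightarrow> real" where
  "div_tensor_app A g T X p = (let c = chart_at A p in
     \<Sum>j\<in>UNIV. div_tensor g T c p $ j * X c p $ j)"

definition trace_free ::
  "('m, 'n::finite) chart set \<Rightarrow> ('m, 'n) tensor2 \<Rightarrow> ('m, 'n) tensor2 \<Rightarrow> ('m, 'n) tensor2" where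
  "trace_free A g T c p = T c p - (tr A g T p / real CARD('n)) *\<^sub>R g c p"

definition conformal_field ::
  "('m, 'n::finite) chart set \<Rightarrow> ('m, 'n) tensor2 \<Rightarrow> ('m, 'n) vfield \<Rightarrow> bool" where
  "conformal_field A g X \<longleftrightarrow>
     (\<exists>\<sigma>. smooth_function A \<sigma> \<and> tensor_eq A (lie_derivative X g) (\<lambda>c p. (2 * \<sigma> p) *\<^sub>R g c p))"

section \<open>The Riemannian volume measure\<close>

text \<open>The Borel measure with density \<open>sqrt (det g)\<close> in every chart; on a closed Riemannian
  manifold it exists and is unique.  No orientation is needed.\<close>

definition is_riemannian_volume ::
  "('m::topological_space, 'n::finite) chart set \<Rightarrow> ('m, 'n) tensor2 \<Rightarrow> 'm measure \<Rightarrow> bool" where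
  "is_riemannian_volume A g \<mu> \<longleftrightarrow> sets \<mu> = sets borel \<and>
     (\<forall>c\<in>A. \<forall>B\<in>sets borel. B \<subseteq> chart_dom c \<longrightarrow>
        emeasure \<mu> B =
          (\<integral>\<^sup>+x\<in>chart_map c ` B. ennreal (sqrt (det (g c (chart_inv c x)))) \<partial>lborel))"

definition dvol ::
  "('m::topological_space, 'n::finite) chart set \<Rightarrow> ('m, 'n) tensor2 \<Rightarrow> 'm measure" where
  "dvol A g = (THE \<mu>. is_riemannian_volume A g \<mu>)"

end

theory Submission
  imports Defs
begin

text \<open>
  Let \<open>Y\<close> be the vector field \<open>g\<^sup>i\<^sup>j q\<^sub>j\<^sub>k X\<^sup>k\<close>.  By the product rule its divergence is
  \<open>(div q) X + \<langle>q, \<nabla>X\<rangle>\<close>, and since \<open>q\<close> is symmetric the last term equals \<open>1/2 \<langle>q, L_X g\<rangle>\<close>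
  (\<open>chart_div_contraction\<close>).  Inserting the hypothesis \<open>L_X g = q + 2 \<phi> g\<close> turns it into
  \<open>1/2 \<parallel>q\<parallel>\<^sup>2 + \<phi> tr q\<close>, where \<open>\<parallel>q\<parallel>\<^sup>2\<close> is the square norm of the trace-free part \<open>q0\<close> plus
  \<open>(tr q)\<^sup>2 / n\<close>.  The integral of a divergence is 0 (\<open>divergence_theorem\<close>), and the first formula follows.  For the
  second, replace \<open>q\<close> by \<open>q0\<close>: it is orthogonal to \<open>g\<close>, so \<open>\<langle>q0, L_X g\<rangle> = \<parallel>q0\<parallel>\<^sup>2\<close>, and \<open>q0\<close> is the trace-free
  part of \<open>L_X g\<close> as well.  Both right-hand sides are \<open>-1/2\<close> times the integral of \<open>\<parallel>q0\<parallel>\<^sup>2\<close>.  It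
  vanishes if and only if \<open>q0 = 0\<close>, because open sets have positive volume
  (\<open>integral_norm_sq_eq_0_iff\<close>); then \<open>q\<close> and \<open>L_X g\<close> are multiples of \<open>g\<close>, and taking traces
  identifies the factor of \<open>q\<close> (\<open>trace_free_eq_0_iff\<close>).

  The analytic input is the divergence theorem, together with the existence and uniqueness of the
  Riemannian volume measure (\<open>is_riemannian_volume_unique_exists\<close>).  The measure is glued from the
  measures with density \<open>sqrt (det g)\<close> in finitely many charts by a partition of unity; the pieces fit
  by the change of variables formula.  In a single chart, integration by parts is the statement that a
  compactly supported function on a Euclidean space has derivatives with integral 0
  (\<open>integration_by_parts_chart\<close>), and a partition of unity globalises it.

  The divergence of a vector field is given by a formula in coordinates.  That its value does not depend
  on the chart is not computed but read off from integration by parts against bump functions, where the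
  other term is visibly invariant (\<open>chart_div_change\<close>).  The same then holds for \<open>(div q) X\<close>, which
  is the difference of a divergence and an inner product.
\<close>

section \<open>Calculus of \<open>k\<close> times continuously differentiable maps\<close>

(* Used for rewriting, the successor case would send implications between consecutive degrees of
   smoothness into a loop. *)
declare C_k_on.simps(2) [simp del]

lemma C_k_on_has_derivative:
  assumes "C_k_on (Suc k) S f" "x \<in> S"
  shows "(f has_derivative frechet_derivative f (at x)) (at x)"
  using assms frechet_derivative_works unfolding C_k_on.simps by blast

lemma C_k_on_frechet_derivative:
  "C_k_on (Suc k) S f \<Longrightarrow> C_k_on k S (\<lambda>x. frechet_derivative f (at x) v)"
  unfolding C_k_on.simps by blast

lemma C_k_on_cong:
  assumes "open S" "C_k_on k S f" "\<And>x. x \<in> S \<Longrightarrow> f x = g x"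
  shows "C_k_on k S g"
  using assms(2,3)
proof (induction k arbitrary: f g)
  case 0
  have "continuous_on S f = continuous_on S g"
    by (rule continuous_on_cong[OF refl]) (rule 0)
  then show ?case using 0(1) by simp
next
  case (Suc k)
  have D: "(g has_derivative frechet_derivative f (at x)) (at x)" if x: "x \<in> S" for x
    using C_k_on_has_derivative[OF Suc.prems(1) x] \<open>open S\<close> x Suc.prems(2)
    by (rule has_derivative_transform_within_open)
  then have eq: "frechet_derivative f (at x) = frechet_derivative g (at x)" if "x \<in> S" for x
    using that by (intro frechet_derivative_at)
  have f: "C_k_on k S (\<lambda>x. frechet_derivative f (at x) v)" for v
    using Suc.prems(1) unfolding C_k_on.simps by blast
  have "C_k_on k S (\<lambda>x. frechet_derivative g (at x) v)" for v
    by (rule Suc.IH[OF f]) (simp only: eq)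
  moreover have "g differentiable (at x)" if "x \<in> S" for x
    using D[OF that] by (rule differentiableI)
  ultimately show ?case unfolding C_k_on.simps by blast
qed

lemma C_k_onI:
  assumes "open S" and D: "\<And>x. x \<in> S \<Longrightarrow> (f has_derivative D x) (at x)"
    and "\<And>v. C_k_on k S (\<lambda>x. D x v)"
  shows "C_k_on (Suc k) S f"
proof -
  have eq: "D x = frechet_derivative f (at x)" if "x \<in> S" for x
    using D[OF that] by (rule frechet_derivative_at)
  have "C_k_on k S (\<lambda>x. frechet_derivative f (at x) v)" for v
    by (rule C_k_on_cong[OF assms(1) assms(3)]) (simp only: eq)
  moreover have "f differentiable (at x)" if "x \<in> S" for x
    using D[OF that] by (rule differentiableI)
  ultimately show ?thesis unfolding C_k_on.simps by blast
qed

lemma C_k_on_continuous: "C_k_on k S f \<Longrightarrow> continuous_on S f"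
proof (cases k)
  case (Suc j)
  assume f: "C_k_on k S f"
  have "continuous (at x) f" if "x \<in> S" for x
    using C_k_on_has_derivative[OF f[unfolded Suc] that] has_derivative_continuous by blast
  then show ?thesis by (simp add: continuous_at_imp_continuous_on)
qed simp

lemma C_k_on_Suc: "C_k_on (Suc k) S f \<Longrightarrow> C_k_on k S f"
proof (induction k arbitrary: f)
  case 0
  show ?case unfolding C_k_on.simps(1) by (rule C_k_on_continuous[OF 0])
next
  case (Suc k)
  then show ?case unfolding C_k_on.simps(2)[of "Suc k"] C_k_on.simps(2)[of k S f] by blast
qed

lemma C_k_on_const [simp]: "C_k_on k S (\<lambda>x. c)"
  by (induction k arbitrary: c) (simp_all add: C_k_on.simps(2))

lemma C_k_on_bounded_linear:
  assumes "open S" "bounded_linear L"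
  shows "C_k_on k S f \<Longrightarrow> C_k_on k S (\<lambda>x. L (f x))"
proof (induction k arbitrary: f)
  case 0
  then show ?case
    using linear_continuous_on[OF assms(2), of UNIV]
    by (auto intro: continuous_on_compose2[of UNIV L])
next
  case (Suc k)
  show ?case
  proof (rule C_k_onI[OF \<open>open S\<close>])
    show "((\<lambda>x. L (f x)) has_derivative (\<lambda>v. L (frechet_derivative f (at x) v))) (at x)"
      if "x \<in> S" for x
      using C_k_on_has_derivative[OF Suc.prems that] by (rule bounded_linear.has_derivative[OF assms(2)])
    show "C_k_on k S (\<lambda>x. L (frechet_derivative f (at x) v))" for v
      by (rule Suc.IH; rule C_k_on_frechet_derivative; rule Suc.prems)
  qed
qed

lemma C_k_on_add:
  assumes "open S"
  shows "C_k_on k S f \<Longrightarrow> C_k_on k S g \<Longrightarrow> C_k_on k S (\<lambda>x. f x + g x)"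
proof (induction k arbitrary: f g)
  case 0
  then show ?case by (simp add: continuous_on_add)
next
  case (Suc k)
  show ?case
  proof (rule C_k_onI[OF \<open>open S\<close>])
    show "((\<lambda>x. f x + g x) has_derivative
        (\<lambda>v. frechet_derivative f (at x) v + frechet_derivative g (at x) v)) (at x)" if "x \<in> S" for x
      using Suc.prems[THEN C_k_on_has_derivative, OF that] by (rule has_derivative_add)
    show "C_k_on k S (\<lambda>x. frechet_derivative f (at x) v + frechet_derivative g (at x) v)" for v
      by (rule Suc.IH; rule C_k_on_frechet_derivative; rule Suc.prems)
  qed
qed

lemma C_k_on_bilinear:
  assumes "open S" "bounded_bilinear pr"
  shows "C_k_on k S f \<Longrightarrow> C_k_on k S g \<Longrightarrow> C_k_on k S (\<lambda>x. pr (f x) (g x))"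
proof (induction k arbitrary: f g)
  case 0
  then show ?case by (simp add: bounded_bilinear.continuous_on[OF assms(2)])
next
  case (Suc k)
  have fg: "C_k_on k S f" "C_k_on k S g" using Suc.prems C_k_on_Suc by blast+
  have D: "C_k_on k S (\<lambda>x. frechet_derivative f (at x) v)"
    "C_k_on k S (\<lambda>x. frechet_derivative g (at x) v)" for v
    using Suc.prems C_k_on_frechet_derivative by blast+
  show ?case
  proof (rule C_k_onI[OF \<open>open S\<close>])
    show "((\<lambda>x. pr (f x) (g x)) has_derivative
        (\<lambda>v. pr (f x) (frechet_derivative g (at x) v) + pr (frechet_derivative f (at x) v) (g x))) (at x)"
      if "x \<in> S" for x
      using Suc.prems[THEN C_k_on_has_derivative, OF that] by (rule bounded_bilinear.FDERIV[OF assms(2)])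
    show "C_k_on k S (\<lambda>x. pr (f x) (frechet_derivative g (at x) v) +
        pr (frechet_derivative f (at x) v) (g x))" for v
      by (rule C_k_on_add[OF assms(1) Suc.IH[OF fg(1) D(2)] Suc.IH[OF D(1) fg(2)]])
  qed
qed

lemma C_k_on_mult:
  fixes f g :: "'a::real_normed_vector \<Rightarrow> real"
  assumes "open S" "C_k_on k S f" "C_k_on k S g"
  shows "C_k_on k S (\<lambda>x. f x * g x)"
  by (rule C_k_on_bilinear[OF assms(1) bounded_bilinear_mult assms(2,3)])

lemma C_k_on_scaleR:
  assumes "open S" "C_k_on k S f" "C_k_on k S g"
  shows "C_k_on k S (\<lambda>x. f x *\<^sub>R g x)"
  by (rule C_k_on_bilinear[OF assms(1) bounded_bilinear_scaleR assms(2,3)])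

lemma C_k_on_minus:
  assumes "open S" "C_k_on k S f"
  shows "C_k_on k S (\<lambda>x. - f x)"
  by (rule C_k_on_bounded_linear[OF assms(1) bounded_linear_minus[OF bounded_linear_ident] assms(2)])

lemma C_k_on_sum:
  assumes "open S" "\<And>i. i \<in> I \<Longrightarrow> C_k_on k S (f i)"
  shows "C_k_on k S (\<lambda>x. \<Sum>i\<in>I. f i x)"
  using assms(2)
  by (induction I rule: infinite_finite_induct) (simp_all add: C_k_on_add[OF assms(1)])

lemma C_k_on_prod:
  fixes f :: "'i \<Rightarrow> 'a::real_normed_vector \<Rightarrow> real"
  assumes "open S" "\<And>i. i \<in> I \<Longrightarrow> C_k_on k S (f i)"
  shows "C_k_on k S (\<lambda>x. \<Prod>i\<in>I. f i x)"
  using assms(2)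
  by (induction I rule: infinite_finite_induct) (simp_all add: C_k_on_mult[OF assms(1)])

lemma C_k_on_inverse:
  fixes f :: "'a::real_normed_vector \<Rightarrow> real"
  assumes "open S" and nz: "\<And>x. x \<in> S \<Longrightarrow> f x \<noteq> 0"
  shows "C_k_on k S f \<Longrightarrow> C_k_on k S (\<lambda>x. inverse (f x))"
proof (induction k)
  case 0
  then show ?case using nz by (simp add: continuous_on_inverse)
next
  case (Suc k)
  have f: "C_k_on k S (\<lambda>x. inverse (f x))" using Suc C_k_on_Suc by blast
  show ?case
  proof (rule C_k_onI[OF \<open>open S\<close>])
    show "((\<lambda>x. inverse (f x)) has_derivative
        (\<lambda>v. - (inverse (f x) * frechet_derivative f (at x) v * inverse (f x)))) (at x)" if "x \<in> S" for x
      by (rule Deriv.has_derivative_inverse) (use that nz Suc.prems C_k_on_has_derivative in auto)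
    show "C_k_on k S (\<lambda>x. - (inverse (f x) * frechet_derivative f (at x) v * inverse (f x)))" for v
      by (intro C_k_on_minus C_k_on_mult \<open>open S\<close> f C_k_on_frechet_derivative Suc.prems)
  qed
qed

lemma C_k_on_nth:
  fixes f :: "'a::real_normed_vector \<Rightarrow> 'b::real_normed_vector ^ 'n"
  assumes "open S" "C_k_on k S f"
  shows "C_k_on k S (\<lambda>x. f x $ i)"
  by (rule C_k_on_bounded_linear[OF assms(1) bounded_linear_vec_nth assms(2)])

lemma C_k_on_vec:
  fixes f :: "'n::finite \<Rightarrow> 'a::real_normed_vector \<Rightarrow> real"
  assumes "open S" "\<And>i. C_k_on k S (f i)"
  shows "C_k_on k S (\<lambda>x. \<chi> i. f i x)"
proof -
  have "C_k_on k S (\<lambda>x. \<Sum>i\<in>UNIV. f i x *\<^sub>R axis i (1::real))"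
    using assms by (intro C_k_on_sum C_k_on_scaleR) auto
  moreover have "(\<Sum>i\<in>UNIV. f i x *\<^sub>R axis i (1::real)) = (\<chi> i. f i x)" for x
    by (simp add: vec_eq_iff axis_def if_distrib sum.delta cong: if_cong)
  ultimately show ?thesis by simp
qed

lemma C_k_on_Un:
  assumes "open S" "open T" "C_k_on k S f" "C_k_on k T f"
  shows "C_k_on k (S \<union> T) f"
  using assms(3,4)
proof (induction k arbitrary: f)
  case 0
  then show ?case using continuous_on_open_Un[OF assms(1,2)] by simp
next
  case (Suc k)
  then show ?case unfolding C_k_on.simps(2) by blast
qed

text \<open>Only the first derivatives of a change of coordinates enter the argument, so the chain rule
  is only required to first order.\<close>

lemma C_1_on_compose:
  fixes f :: "real^'n \<Rightarrow> real" and T :: "'a::real_normed_vector \<Rightarrow> real^'n"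
  assumes "open S" "open U" "T ` U \<subseteq> S" and f: "C_k_on (Suc 0) S f" and T: "C_k_on (Suc 0) U T"
  shows "C_k_on (Suc 0) U (\<lambda>x. f (T x))"
proof (rule C_k_onI[OF \<open>open U\<close>])
  fix x assume x: "x \<in> U"
  have Tx: "T x \<in> S" using x assms(3) by auto
  show "((\<lambda>x. f (T x)) has_derivative
      (\<lambda>v. frechet_derivative f (at (T x)) (frechet_derivative T (at x) v))) (at x)"
    using has_derivative_compose[OF C_k_on_has_derivative[OF T x] C_k_on_has_derivative[OF f Tx]] .
next
  fix v
  have lin: "frechet_derivative f (at (T x)) w =
      (\<Sum>i\<in>UNIV. (w $ i) * frechet_derivative f (at (T x)) (axis i 1))" if "x \<in> U" for x w
  proof -
    have "linear (frechet_derivative f (at (T x)))"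
      using C_k_on_has_derivative[OF f] that assms(3) has_derivative_linear by blast
    then have "frechet_derivative f (at (T x)) (\<Sum>i\<in>UNIV. (w $ i) *\<^sub>R axis i 1) =
       (\<Sum>i\<in>UNIV. (w $ i) * frechet_derivative f (at (T x)) (axis i 1))"
      by (simp add: linear_sum linear_scale)
    moreover have "(\<Sum>i\<in>UNIV. (w $ i) *\<^sub>R axis i 1) = w"
      by (simp add: vec_eq_iff axis_def if_distrib sum.delta cong: if_cong)
    ultimately show ?thesis by simp
  qed
  have cT: "continuous_on U T" using C_k_on_continuous[OF T] .
  have "continuous_on U (\<lambda>x. \<Sum>i\<in>UNIV. (frechet_derivative T (at x) v $ i) * frechet_derivative f (at (T x)) (axis i 1))"
  proof (intro continuous_on_sum continuous_on_mult)
    fix i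
    show "continuous_on U (\<lambda>x. frechet_derivative T (at x) v $ i)"
      using C_k_on_frechet_derivative[OF T] by (simp add: bounded_linear.continuous_on[OF bounded_linear_vec_nth])
    have "continuous_on S (\<lambda>y. frechet_derivative f (at y) (axis i 1))"
      using C_k_on_frechet_derivative[OF f] by simp
    from continuous_on_compose2[OF this cT assms(3)]
    show "continuous_on U (\<lambda>x. frechet_derivative f (at (T x)) (axis i 1))" .
  qed
  then show "C_k_on 0 U (\<lambda>x. frechet_derivative f (at (T x)) (frechet_derivative T (at x) v))"
    using lin by (simp cong: continuous_on_cong)
qed

section \<open>Matrices: inverses, determinants and definiteness\<close>

lemma matrix_inv_mult:
  fixes A :: "real^'n^'n"
  assumes "det A \<noteq> 0"
  shows "A ** matrix_inv A = mat 1" "matrix_inv A ** A = mat 1"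
proof -
  have "\<exists>B. A ** B = mat 1 \<and> B ** A = mat 1"
    using assms unfolding invertible_det_nz[symmetric] invertible_def .
  from someI_ex[OF this] show "A ** matrix_inv A = mat 1" "matrix_inv A ** A = mat 1"
    unfolding matrix_inv_def by auto
qed

lemma matrix_inv_unique:
  fixes A B :: "real^'n^'n"
  assumes "B ** A = mat 1"
  shows "matrix_inv A = B"
proof -
  have "det B * det A = 1" using assms by (metis det_I det_mul)
  then have "A ** matrix_inv A = mat 1" by (intro matrix_inv_mult) auto
  then have "B = B ** (A ** matrix_inv A)" by simp
  also have "\<dots> = matrix_inv A" by (simp add: matrix_mul_assoc assms)
  finally show ?thesis ..
qed

lemma matrix_inv_symmetric:
  fixes A :: "real^'n^'n"
  assumes "det A \<noteq> 0" "transpose A = A"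
  shows "transpose (matrix_inv A) = matrix_inv A"
proof -
  have "transpose (matrix_inv A) ** A = mat 1"
    using arg_cong[OF matrix_inv_mult(1)[OF assms(1)], of transpose]
    by (simp only: matrix_transpose_mul transpose_mat assms(2))
  then show ?thesis by (rule matrix_inv_unique[symmetric])
qed

lemma matrix_inv_nth_cramer:
  fixes A :: "real^'n^'n"
  assumes "det A \<noteq> 0"
  shows "matrix_inv A $ k $ j = det (\<chi> i l. if l = k then axis j 1 $ i else A $ i $ l) / det A"
proof -
  have "A *v (matrix_inv A *v axis j 1) = axis j 1"
    by (simp add: matrix_vector_mul_assoc matrix_inv_mult[OF assms])
  then have "matrix_inv A *v axis j 1 = (\<chi> k. det (\<chi> i l. if l = k then axis j 1 $ i else A $ i $ l) / det A)"
    by (rule iffD1[OF cramer[OF assms]])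
  moreover have "(matrix_inv A *v axis j 1) $ k = matrix_inv A $ k $ j"
    by (simp add: matrix_vector_mult_basis column_def)
  ultimately show ?thesis by simp
qed

lemma symmetric_matrix_nth: "transpose A = A \<Longrightarrow> A $ i $ j = A $ j $ i"
proof -
  assume "transpose A = A"
  then have "A $ i $ j = transpose A $ i $ j" by (simp only:)
  then show ?thesis by (simp only: transpose_def vec_lambda_beta)
qed

lemma C_k_on_det:
  fixes G :: "'a::real_normed_vector \<Rightarrow> real^'n^'n"
  assumes "open S" "\<And>i j. C_k_on k S (\<lambda>x. G x $ i $ j)"
  shows "C_k_on k S (\<lambda>x. det (G x))"
  unfolding det_def using assms
  by (intro C_k_on_sum C_k_on_mult C_k_on_prod) auto

text \<open>By Cramer's rule the entries of the inverse are polynomials in the entries of the matrix, divided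
  by its determinant.\<close>

lemma C_k_on_matrix_inv:
  fixes G :: "'a::real_normed_vector \<Rightarrow> real^'n^'n"
  assumes "open S" "\<And>i j. C_k_on k S (\<lambda>x. G x $ i $ j)" "\<And>x. x \<in> S \<Longrightarrow> det (G x) \<noteq> 0"
  shows "C_k_on k S (\<lambda>x. matrix_inv (G x) $ p $ q)"
proof (rule C_k_on_cong[OF assms(1)])
  show "C_k_on k S (\<lambda>x. det (\<chi> i l. if l = p then axis q 1 $ i else G x $ i $ l) * inverse (det (G x)))"
  proof (intro C_k_on_mult C_k_on_inverse C_k_on_det assms)
    fix i j
    show "C_k_on k S (\<lambda>x. (\<chi> i l. if l = p then axis q 1 $ i else G x $ i $ l) $ i $ j)"
      using assms(2) by (cases "j = p") auto
  qed
qed (simp add: matrix_inv_nth_cramer assms(3) divide_inverse)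

text \<open>Jacobi's formula.  Differentiating the Leibniz formula replaces one row at a time by its derivative; expanding
  the new row in the rows of the matrix itself, only its own coefficient survives.\<close>

lemma has_derivative_det:
  fixes G :: "'a::real_normed_vector \<Rightarrow> real^'n^'n"
  assumes G: "\<And>i j. ((\<lambda>x. G x $ i $ j) has_derivative (\<lambda>v. G' v $ i $ j)) (at x)"
    and nz: "det (G x) \<noteq> 0"
  shows "((\<lambda>x. det (G x)) has_derivative (\<lambda>v. det (G x) * trace (matrix_inv (G x) ** G' v))) (at x)"
proof -
  let ?P = "{p. p permutes (UNIV :: 'n set)}"
  let ?R = "\<lambda>v i. \<chi> r. if r = i then G' v $ r else G x $ r"
  have "((\<lambda>x. det (G x)) has_derivative (\<lambda>v. \<Sum>p\<in>?P. of_int (sign p) *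
      (\<Sum>i\<in>UNIV. G' v $ i $ p i * (\<Prod>j\<in>UNIV - {i}. G x $ j $ p j)))) (at x)"
    unfolding det_def
    by (rule has_derivative_sum, rule has_derivative_mult_right, rule has_derivative_prod, rule G)
  moreover have "(\<Sum>p\<in>?P. of_int (sign p) * (\<Sum>i\<in>UNIV. G' v $ i $ p i * (\<Prod>j\<in>UNIV - {i}. G x $ j $ p j)))
      = det (G x) * trace (matrix_inv (G x) ** G' v)" for v
  proof -
    have "(\<Sum>p\<in>?P. of_int (sign p) * (\<Sum>i\<in>UNIV. G' v $ i $ p i * (\<Prod>j\<in>UNIV - {i}. G x $ j $ p j)))
        = (\<Sum>i\<in>UNIV. \<Sum>p\<in>?P. of_int (sign p) * (G' v $ i $ p i * (\<Prod>j\<in>UNIV - {i}. G x $ j $ p j)))"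
      unfolding sum_distrib_left by (rule sum.swap)
    also have "\<dots> = (\<Sum>i\<in>UNIV. det (?R v i))"
      unfolding det_def
    proof (intro sum.cong refl arg_cong2[where f="(*)"])
      fix i p
      have "(\<Prod>r\<in>UNIV. ?R v i $ r $ p r) = ?R v i $ i $ p i * (\<Prod>r\<in>UNIV - {i}. ?R v i $ r $ p r)"
        by (rule prod.remove) auto
      also have "(\<Prod>r\<in>UNIV - {i}. ?R v i $ r $ p r) = (\<Prod>r\<in>UNIV - {i}. G x $ r $ p r)"
        by (rule prod.cong) auto
      finally show "G' v $ i $ p i * (\<Prod>j\<in>UNIV - {i}. G x $ j $ p j) = (\<Prod>r\<in>UNIV. ?R v i $ r $ p r)"
        by simp
    qed
    also have "\<dots> = (\<Sum>i\<in>UNIV. (G' v ** matrix_inv (G x)) $ i $ i * det (G x))"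
    proof (intro sum.cong refl)
      fix i
      let ?c = "(G' v ** matrix_inv (G x)) $ i"
      have "G' v = (G' v ** matrix_inv (G x)) ** G x"
        by (simp add: matrix_mul_assoc[symmetric] matrix_inv_mult[OF nz])
      then have "G' v $ i = ((G' v ** matrix_inv (G x)) ** G x) $ i" by (rule arg_cong)
      also have "\<dots> = (\<Sum>k\<in>UNIV. ?c $ k *s row k (G x))"
        by (simp add: vec_eq_iff matrix_matrix_mult_def[of _ "G x"] row_def)
      finally have new: "G' v $ i = (\<Sum>k\<in>UNIV. ?c $ k *s row k (G x))" .
      have old: "row r (G x) = G x $ r" for r by (simp add: row_def vec_eq_iff)
      have "?R v i = (\<chi> r. if r = i then (\<Sum>k\<in>UNIV. ?c $ k *s row k (G x)) else row r (G x))"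
        by (rule arg_cong[where f = vec_lambda], rule ext) (use new[unfolded old] in \<open>simp only: old split: if_split, blast\<close>)
      then show "det (?R v i) = ?c $ i * det (G x)"
        by (simp only: cramer_lemma_transpose)
    qed
    also have "\<dots> = det (G x) * trace (G' v ** matrix_inv (G x))"
      by (simp add: trace_def sum_distrib_left mult.commute)
    finally show ?thesis by (simp only: trace_mul_sym[of "G' v"])
  qed
  ultimately show ?thesis by (simp only:)
qed

text \<open>The Cholesky decomposition, by induction on the set of indices whose rows may be nonzero.  A pivot
  \<open>P a a > 0\<close> is removed by completing the square in the direction \<open>a\<close>; a pivot 0 forces the whole
  row to vanish, because otherwise the form would be linear and unbounded below in that direction.\<close>

lemma psd_sum_of_squares:
  fixes P :: "'n::finite \<Rightarrow> 'n \<Rightarrow> real"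
  assumes "finite I" and "\<And>i j. P i j = P j i"
    and "\<And>x. 0 \<le> (\<Sum>i\<in>UNIV. \<Sum>j\<in>UNIV. x i * P i j * x j)"
    and "\<And>i j. i \<notin> I \<Longrightarrow> P i j = 0"
  shows "\<exists>B. \<forall>i j. P i j = (\<Sum>k\<in>I. B k i * (B k j :: real))"
  using assms
proof (induction I arbitrary: P rule: finite_induct)
  case empty
  then show ?case by simp
next
  case (insert a I)
  note sym = insert.prems(1) and psd = insert.prems(2) and zero = insert.prems(3)
  let ?Q = "\<lambda>x. \<Sum>i\<in>UNIV. \<Sum>j\<in>UNIV. x i * P i j * x j"
  define L where "L x = (\<Sum>i\<in>UNIV. P a i * x i)" for x
  have delta: "(\<Sum>j\<in>UNIV. f j * (if j = b then t else 0)) = f b * t"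
    and delta': "(\<Sum>j\<in>UNIV. (if j = b then t else 0) * f j) = t * f b" for f :: "'n \<Rightarrow> real" and b t
    by (simp_all add: if_distrib[of "\<lambda>y. _ * y"] if_distrib[of "\<lambda>y. y * _"] sum.delta cong: if_cong)
  have shift: "?Q (\<lambda>i. x i + (if i = a then t else 0)) = ?Q x + 2 * t * L x + t\<^sup>2 * P a a" for x t
  proof -
    have "?Q (\<lambda>i. x i + (if i = a then t else 0)) = ?Q x + (\<Sum>i\<in>UNIV. \<Sum>j\<in>UNIV. x i * P i j * (if j = a then t else 0))
      + (\<Sum>i\<in>UNIV. \<Sum>j\<in>UNIV. (if i = a then t else 0) * P i j * x j)
      + (\<Sum>i\<in>UNIV. \<Sum>j\<in>UNIV. (if i = a then t else 0) * P i j * (if j = a then t else 0))"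
      unfolding sum.distrib[symmetric] by (intro sum.cong refl) (simp add: algebra_simps)
    also have "(\<Sum>i\<in>UNIV. \<Sum>j\<in>UNIV. x i * P i j * (if j = a then t else 0)) = t * L x"
      unfolding delta L_def sum_distrib_left by (intro sum.cong refl) (simp add: sym[of _ a])
    also have "(\<Sum>i\<in>UNIV. \<Sum>j\<in>UNIV. (if i = a then t else 0) * P i j * x j)
        = (\<Sum>j\<in>UNIV. \<Sum>i\<in>UNIV. (if i = a then t else 0) * P i j * x j)"
      by (rule sum.swap)
    also have "\<dots> = t * L x"
      unfolding mult.assoc delta' L_def sum_distrib_left ..
    also have "(\<Sum>i\<in>UNIV. \<Sum>j\<in>UNIV. (if i = a then t else 0) * P i j * (if j = a then t else 0)) = t\<^sup>2 * P a a"
      unfolding delta unfolding mult.assoc delta' by (simp add: power2_eq_square)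
    finally show ?thesis by (simp add: algebra_simps)
  qed
  have Q_axis: "?Q (\<lambda>i. if i = b then 1 else 0) = P b b" for b
    unfolding delta unfolding mult.assoc delta' by simp
  have L_axis: "L (\<lambda>i. if i = b then 1 else 0) = P a b" for b
    unfolding L_def delta by simp
  show ?case
  proof (cases "P a a = 0")
    case True
    have "P a b = 0" for b
    proof (rule ccontr)
      assume nz: "P a b \<noteq> 0"
      \<comment> \<open>On the line through the \<open>b\<close>-th unit vector in direction \<open>a\<close> the form is \<open>P b b + 2 * t * P a b\<close>;
        this \<open>t\<close> makes it equal to -1.\<close>
      define t where "t = - (P b b + 1) / (2 * P a b)"
      have "0 \<le> P b b + 2 * t * P a b"
        using psd[of "\<lambda>i. (if i = b then 1 else 0) + (if i = a then t else 0)"]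
        unfolding shift Q_axis L_axis by (simp add: True)
      moreover have "2 * t * P a b = - (P b b + 1)" using nz by (simp add: t_def)
      ultimately show False by simp
    qed
    then have "P i j = 0" if "i \<notin> I" for i j
      using that zero by (cases "i = a") auto
    then have "\<exists>B. \<forall>i j. P i j = (\<Sum>k\<in>I. B k i * B k j)"
      by (rule insert.IH[OF sym psd])
    then obtain B where B: "\<And>i j. P i j = (\<Sum>k\<in>I. B k i * B k j)" by blast
    have *: "P i j = (\<Sum>k\<in>insert a I. (B(a := \<lambda>_. 0)) k i * (B(a := \<lambda>_. 0)) k j)" for i j
      using insert.hyps unfolding B by (simp, intro sum.cong) auto
    show ?thesis by (rule exI, intro allI, rule *)
  next
    case False
    moreover have "0 \<le> P a a" using psd[of "\<lambda>i. if i = a then 1 else 0"] unfolding Q_axis .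
    ultimately have pos: "P a a > 0" by simp
    define P' where "P' i j = P i j - P a i * P a j / P a a" for i j
    have "0 \<le> (\<Sum>i\<in>UNIV. \<Sum>j\<in>UNIV. x i * P' i j * x j)" for x
    proof -
      have "(\<Sum>i\<in>UNIV. \<Sum>j\<in>UNIV. x i * P' i j * x j) = ?Q x - (\<Sum>i\<in>UNIV. \<Sum>j\<in>UNIV. (P a i * x i) * (P a j * x j) / P a a)"
        by (simp add: P'_def algebra_simps sum_subtractf)
      also have "(\<Sum>i\<in>UNIV. \<Sum>j\<in>UNIV. (P a i * x i) * (P a j * x j) / P a a) = (L x)\<^sup>2 / P a a"
        by (simp add: L_def power2_eq_square sum_product sum_divide_distrib)
      \<comment> \<open>The right-hand side is the form at the point shifted by \<open>- L x / P a a\<close> in direction \<open>a\<close>.\<close>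
      also have "?Q x - (L x)\<^sup>2 / P a a = ?Q x + 2 * (- L x / P a a) * L x + (- L x / P a a)\<^sup>2 * P a a"
        using pos by (simp add: field_simps power2_eq_square)
      also have "\<dots> \<ge> 0"
        using psd[of "\<lambda>i. x i + (if i = a then - L x / P a a else 0)"] unfolding shift .
      finally show ?thesis .
    qed
    moreover have "P' i j = 0" if "i \<notin> I" for i j
      using that zero[of i] zero[of i a] sym[of a i] pos by (cases "i = a") (auto simp: P'_def)
    moreover have "P' i j = P' j i" for i j
      using sym[of i j] by (simp add: P'_def)
    ultimately have "\<exists>B. \<forall>i j. P' i j = (\<Sum>k\<in>I. B k i * B k j)"
      by (intro insert.IH)
    then obtain B where B: "\<And>i j. P' i j = (\<Sum>k\<in>I. B k i * B k j)" by blast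
    have *: "P i j = (\<Sum>k\<in>insert a I. (B(a := \<lambda>i. P a i / sqrt (P a a))) k i * (B(a := \<lambda>i. P a i / sqrt (P a a))) k j)" for i j
    proof -
      have "(\<Sum>k\<in>I. (B(a := \<lambda>i. P a i / sqrt (P a a))) k i * (B(a := \<lambda>i. P a i / sqrt (P a a))) k j) = P' i j"
        using insert.hyps unfolding B by (intro sum.cong) auto
      then show ?thesis
        using insert.hyps pos by (simp add: P'_def)
    qed
    show ?thesis by (rule exI, intro allI, rule *)
  qed
qed

lemma sum_swap3: "(\<Sum>i\<in>I. \<Sum>a\<in>J. \<Sum>b\<in>K. f i a b) = (\<Sum>a\<in>J. \<Sum>b\<in>K. \<Sum>i\<in>I. f i a b)"
proof -
  have "(\<Sum>i\<in>I. \<Sum>a\<in>J. \<Sum>b\<in>K. f i a b) = (\<Sum>a\<in>J. \<Sum>i\<in>I. \<Sum>b\<in>K. f i a b)"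
    by (rule sum.swap)
  also have "\<dots> = (\<Sum>a\<in>J. \<Sum>b\<in>K. \<Sum>i\<in>I. f i a b)"
    by (intro sum.cong refl sum.swap)
  finally show ?thesis .
qed

text \<open>The inner product that a cometric \<open>G\<close> induces on (0,2)-tensors.\<close>

definition tensor_inner :: "real^'n^'n \<Rightarrow> real^'n^'n \<Rightarrow> real^'n^'n \<Rightarrow> real" where
  "tensor_inner G S T = (\<Sum>i\<in>UNIV. \<Sum>j\<in>UNIV. \<Sum>k\<in>UNIV. \<Sum>l\<in>UNIV.
     G $ i $ k * G $ j $ l * S $ i $ j * T $ k $ l)"

lemma tensor_inner_add_right: "tensor_inner G S (T + U) = tensor_inner G S T + tensor_inner G S U"
  by (simp add: tensor_inner_def algebra_simps sum.distrib)

lemma tensor_inner_scale_right: "tensor_inner G S (a *\<^sub>R T) = a * tensor_inner G S T"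
  by (simp add: tensor_inner_def sum_distrib_left mult_ac)

text \<open>In terms of the endomorphisms \<open>G S\<close> and \<open>G T\<close> the inner product is a trace, from which symmetry and
  independence of the basis can be read off.\<close>

lemma tensor_inner_eq_trace:
  assumes "transpose G = G" "transpose T = T"
  shows "tensor_inner G S T = trace ((G ** S) ** (G ** T))"
proof -
  have G: "G $ i $ k = G $ k $ i" for i k by (rule symmetric_matrix_nth[OF assms(1)])
  have T: "T $ i $ k = T $ k $ i" for i k by (rule symmetric_matrix_nth[OF assms(2)])
  have "trace ((G ** S) ** (G ** T)) = (\<Sum>k\<in>UNIV. \<Sum>j\<in>UNIV. \<Sum>i\<in>UNIV. \<Sum>l\<in>UNIV.
     G $ i $ k * G $ j $ l * S $ i $ j * T $ k $ l)"
  proof -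
    have "(G $ k $ i * S $ i $ j) * (G $ j $ l * T $ l $ k) = G $ i $ k * G $ j $ l * S $ i $ j * T $ k $ l" for i j k l
      by (simp only: G[of k i] T[of l k] mult_ac)
    note eq = this
    have "trace ((G ** S) ** (G ** T)) = (\<Sum>k\<in>UNIV. \<Sum>j\<in>UNIV. \<Sum>i\<in>UNIV. \<Sum>l\<in>UNIV.
        (G $ k $ i * S $ i $ j) * (G $ j $ l * T $ l $ k))"
      unfolding trace_def matrix_matrix_mult_def by (simp only: vec_lambda_beta sum_product)
    then show ?thesis by (simp only: eq)
  qed
  also have "\<dots> = (\<Sum>k\<in>UNIV. \<Sum>i\<in>UNIV. \<Sum>j\<in>UNIV. \<Sum>l\<in>UNIV.
     G $ i $ k * G $ j $ l * S $ i $ j * T $ k $ l)"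
    by (intro sum.cong refl sum.swap)
  also have "\<dots> = (\<Sum>i\<in>UNIV. \<Sum>k\<in>UNIV. \<Sum>j\<in>UNIV. \<Sum>l\<in>UNIV.
     G $ i $ k * G $ j $ l * S $ i $ j * T $ k $ l)"
    by (rule sum.swap)
  also have "\<dots> = tensor_inner G S T"
    unfolding tensor_inner_def by (intro sum.cong refl sum.swap)
  finally show ?thesis ..
qed

lemma posdef_det_nz:
  fixes G :: "real^'n^'n"
  assumes pd: "\<And>v. v \<noteq> 0 \<Longrightarrow> v \<bullet> (G *v v) > 0"
  shows "det G \<noteq> 0"
proof -
  have "v = 0" if "G *v v = 0" for v
    using pd[of v] that by (cases "v = 0") simp_all
  then obtain B where "B ** G = mat 1"
    using matrix_left_invertible_ker[of G] by blast
  then have "det B * det G = 1" by (metis det_I det_mul)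
  then show ?thesis by auto
qed

lemma posdef_sum_of_squares:
  fixes G :: "real^'n^'n"
  assumes "transpose G = G" and pd: "\<And>v. v \<noteq> 0 \<Longrightarrow> v \<bullet> (G *v v) > 0"
  shows "\<exists>B :: 'n \<Rightarrow> 'n \<Rightarrow> real. \<forall>i j. G $ i $ j = (\<Sum>k\<in>UNIV. B k i * B k j)"
proof (rule psd_sum_of_squares)
  show "G $ i $ j = G $ j $ i" for i j by (rule symmetric_matrix_nth[OF assms(1)])
  show "0 \<le> (\<Sum>i\<in>UNIV. \<Sum>j\<in>UNIV. x i * G $ i $ j * x j)" for x
  proof -
    have "(\<Sum>i\<in>UNIV. \<Sum>j\<in>UNIV. x i * G $ i $ j * x j) = (\<chi> i. x i) \<bullet> (G *v (\<chi> i. x i))"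
      by (simp add: inner_vec_def matrix_vector_mult_def sum_distrib_left mult_ac)
    moreover have "0 \<le> (\<chi> i. x i) \<bullet> (G *v (\<chi> i. x i))"
      using pd[of "\<chi> i. x i"] by (cases "(\<chi> i. x i) = 0") simp_all
    ultimately show ?thesis by simp
  qed
qed simp_all

text \<open>With \<open>G = transpose B ** B\<close> the determinant is a square.\<close>

lemma posdef_det_pos:
  fixes G :: "real^'n^'n"
  assumes "transpose G = G" and pd: "\<And>v. v \<noteq> 0 \<Longrightarrow> v \<bullet> (G *v v) > 0"
  shows "det G > 0"
proof -
  obtain B :: "'n \<Rightarrow> 'n \<Rightarrow> real" where B: "\<And>i j. G $ i $ j = (\<Sum>k\<in>UNIV. B k i * B k j)"
    using posdef_sum_of_squares[OF assms] by blast
  let ?B = "(\<chi> k i. B k i) :: real^'n^'n"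
  have "G = transpose ?B ** ?B"
    by (simp add: vec_eq_iff B matrix_matrix_mult_def transpose_def)
  then have "det G = (det ?B)\<^sup>2"
    by (simp add: det_mul det_transpose power2_eq_square)
  with posdef_det_nz[OF pd] show ?thesis by simp
qed

text \<open>The value of the inverse form at \<open>v = G w\<close> is the value of the form \<open>G\<close> at \<open>w\<close>.\<close>

lemma posdef_matrix_inv:
  fixes G :: "real^'n^'n"
  assumes "transpose G = G" and pd: "\<And>v. v \<noteq> 0 \<Longrightarrow> v \<bullet> (G *v v) > 0" and "v \<noteq> 0"
  shows "v \<bullet> (matrix_inv G *v v) > 0"
proof -
  let ?w = "matrix_inv G *v v"
  have v: "G *v ?w = v"
    by (simp add: matrix_vector_mul_assoc matrix_inv_mult[OF posdef_det_nz[OF pd]])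
  then have "?w \<noteq> 0" using \<open>v \<noteq> 0\<close> by auto
  from pd[OF this] show ?thesis by (simp add: v inner_commute)
qed

text \<open>With \<open>G = transpose B ** B\<close> the square norm of \<open>T\<close> is the sum of the squares of the numbers
  \<open>c a b\<close>, the values of \<open>T\<close> on pairs of rows of \<open>B\<close>.  They also express \<open>G T G\<close>, so they determine \<open>T\<close>.\<close>

lemma tensor_inner_self:
  fixes G T :: "real^'n^'n"
  assumes "transpose G = G" and pd: "\<And>v. v \<noteq> 0 \<Longrightarrow> v \<bullet> (G *v v) > 0"
  shows "tensor_inner G T T \<ge> 0" "tensor_inner G T T = 0 \<longleftrightarrow> T = 0"
proof -
  obtain B :: "'n \<Rightarrow> 'n \<Rightarrow> real" where B: "\<And>i j. G $ i $ j = (\<Sum>k\<in>UNIV. B k i * B k j)"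
    using posdef_sum_of_squares[OF assms] by blast
  define c where "c a b = (\<Sum>i\<in>UNIV. \<Sum>j\<in>UNIV. B a i * B b j * T $ i $ j)" for a b
  have sq: "tensor_inner G T T = (\<Sum>a\<in>UNIV. \<Sum>b\<in>UNIV. (c a b)\<^sup>2)"
  proof -
    let ?f = "\<lambda>i j k l a b. (B a i * B b j * T $ i $ j) * (B a k * B b l * T $ k $ l)"
    have "tensor_inner G T T = (\<Sum>i\<in>UNIV. \<Sum>j\<in>UNIV. \<Sum>k\<in>UNIV. \<Sum>l\<in>UNIV. \<Sum>a\<in>UNIV. \<Sum>b\<in>UNIV. ?f i j k l a b)"
      unfolding tensor_inner_def
    proof (intro sum.cong refl)
      fix i j k l
      have "G $ i $ k * G $ j $ l = (\<Sum>a\<in>UNIV. \<Sum>b\<in>UNIV. (B a i * B a k) * (B b j * B b l))"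
        unfolding B by (rule sum_product)
      then have "G $ i $ k * G $ j $ l * T $ i $ j * T $ k $ l =
          (\<Sum>a\<in>UNIV. \<Sum>b\<in>UNIV. (B a i * B a k) * (B b j * B b l) * T $ i $ j * T $ k $ l)"
        by (simp only: sum_distrib_right)
      also have "\<dots> = (\<Sum>a\<in>UNIV. \<Sum>b\<in>UNIV. ?f i j k l a b)"
        by (intro sum.cong refl) simp
      finally show "G $ i $ k * G $ j $ l * T $ i $ j * T $ k $ l = (\<Sum>a\<in>UNIV. \<Sum>b\<in>UNIV. ?f i j k l a b)" .
    qed
    also have "\<dots> = (\<Sum>i\<in>UNIV. \<Sum>j\<in>UNIV. \<Sum>k\<in>UNIV. \<Sum>a\<in>UNIV. \<Sum>b\<in>UNIV. \<Sum>l\<in>UNIV. ?f i j k l a b)"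
      by (intro sum.cong refl sum_swap3)
    also have "\<dots> = (\<Sum>i\<in>UNIV. \<Sum>j\<in>UNIV. \<Sum>a\<in>UNIV. \<Sum>b\<in>UNIV. \<Sum>k\<in>UNIV. \<Sum>l\<in>UNIV. ?f i j k l a b)"
      by (intro sum.cong refl sum_swap3)
    also have "\<dots> = (\<Sum>i\<in>UNIV. \<Sum>a\<in>UNIV. \<Sum>b\<in>UNIV. \<Sum>j\<in>UNIV. \<Sum>k\<in>UNIV. \<Sum>l\<in>UNIV. ?f i j k l a b)"
      by (intro sum.cong refl sum_swap3)
    also have "\<dots> = (\<Sum>a\<in>UNIV. \<Sum>b\<in>UNIV. \<Sum>i\<in>UNIV. \<Sum>j\<in>UNIV. \<Sum>k\<in>UNIV. \<Sum>l\<in>UNIV. ?f i j k l a b)"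
      by (intro sum.cong refl sum_swap3)
    also have "\<dots> = (\<Sum>a\<in>UNIV. \<Sum>b\<in>UNIV. (c a b)\<^sup>2)"
      unfolding c_def power2_eq_square
      by (intro sum.cong refl) (simp only: sum_distrib_right, simp only: sum_distrib_left)
    finally show ?thesis .
  qed
  then show "tensor_inner G T T \<ge> 0" by (simp add: sum_nonneg)
  show "tensor_inner G T T = 0 \<longleftrightarrow> T = 0"
  proof
    assume "tensor_inner G T T = 0"
    then have c0: "c a b = 0" for a b
      unfolding sq by (simp add: sum_nonneg_eq_0_iff sum_nonneg)
    have "G ** T ** G = 0"
    proof -
      have "(G ** T ** G) $ p $ q = (\<Sum>a\<in>UNIV. \<Sum>b\<in>UNIV. B a p * B b q * c a b)" for p q
      proof -
        let ?f = "\<lambda>i j a b. B a p * B a i * T $ i $ j * (B b j * B b q)"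
        have "(G ** T ** G) $ p $ q = (\<Sum>j\<in>UNIV. \<Sum>i\<in>UNIV. \<Sum>a\<in>UNIV. \<Sum>b\<in>UNIV. ?f i j a b)"
        proof -
          have "G $ p $ i * T $ i $ j * G $ j $ q = (\<Sum>a\<in>UNIV. \<Sum>b\<in>UNIV. ?f i j a b)" for i j
            unfolding B by (simp only: sum_distrib_right, simp only: sum_distrib_left)
          then show ?thesis by (simp add: matrix_matrix_mult_def sum_distrib_right)
        qed
        also have "\<dots> = (\<Sum>j\<in>UNIV. \<Sum>a\<in>UNIV. \<Sum>b\<in>UNIV. \<Sum>i\<in>UNIV. ?f i j a b)"
          by (intro sum.cong refl sum_swap3)
        also have "\<dots> = (\<Sum>a\<in>UNIV. \<Sum>b\<in>UNIV. \<Sum>j\<in>UNIV. \<Sum>i\<in>UNIV. ?f i j a b)"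
          by (rule sum_swap3)
        also have "\<dots> = (\<Sum>a\<in>UNIV. \<Sum>b\<in>UNIV. \<Sum>i\<in>UNIV. \<Sum>j\<in>UNIV. ?f i j a b)"
          by (intro sum.cong refl sum.swap)
        also have "\<dots> = (\<Sum>a\<in>UNIV. \<Sum>b\<in>UNIV. B a p * B b q * c a b)"
          unfolding c_def sum_distrib_left by (intro sum.cong refl) simp
        finally show ?thesis .
      qed
      then show ?thesis by (simp add: vec_eq_iff c0)
    qed
    moreover have "det G \<noteq> 0"
      by (rule posdef_det_nz[OF pd])
    ultimately have "matrix_inv G ** (G ** T ** G) ** matrix_inv G = 0" by simp
    moreover have "matrix_inv G ** (G ** T ** G) ** matrix_inv G = (matrix_inv G ** G) ** T ** (G ** matrix_inv G)"
      by (simp add: matrix_mul_assoc)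
    ultimately show "T = 0" using matrix_inv_mult[OF \<open>det G \<noteq> 0\<close>] by simp
  qed (simp add: tensor_inner_def)
qed

section \<open>Change of variables for coordinate spaces over an arbitrary finite index type\<close>

text \<open>The theorem \<open>has_absolute_integral_change_of_variables\<close> speaks of coordinates indexed by a
  well-ordered type.  Numbering an arbitrary finite type well-orders a copy of it; the statement is
  then carried back along the renaming of coordinates, which preserves Lebesgue measure and
  determinants.\<close>

typedef 'a ordered_copy = "UNIV :: 'a set"
  morphisms original copy_of by simp

lemma original_copy_of [simp]: "original (copy_of x) = x"
  by (simp add: copy_of_inverse)

lemma bij_original: "bij original"
  by (rule o_bij[of copy_of]) (auto simp: original_inverse)

lemma inj_original: "inj original"
  using bij_original by (rule bij_is_inj)

instance ordered_copy :: (finite) finite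
proof
  have "finite (range (copy_of :: 'a \<Rightarrow> 'a ordered_copy))" by simp
  moreover have "range copy_of = (UNIV :: 'a ordered_copy set)"
    by (metis original_inverse surj_def)
  ultimately show "finite (UNIV :: 'a ordered_copy set)" by (simp only:)
qed

instantiation ordered_copy :: (finite) wellorder
begin

definition "less_eq_ordered_copy x y \<longleftrightarrow> to_nat_on (UNIV :: 'a set) (original x) \<le> to_nat_on (UNIV :: 'a set) (original y)"
definition "less_ordered_copy x y \<longleftrightarrow> to_nat_on (UNIV :: 'a set) (original x) < to_nat_on (UNIV :: 'a set) (original y)"

instance
proof
  fix x y z :: "'a ordered_copy"
  show "x < y \<longleftrightarrow> x \<le> y \<and> \<not> y \<le> x" "x \<le> x" "x \<le> y \<or> y \<le> x"
    by (auto simp: less_eq_ordered_copy_def less_ordered_copy_def)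
  show "x \<le> y \<Longrightarrow> y \<le> z \<Longrightarrow> x \<le> z" by (simp add: less_eq_ordered_copy_def)
  assume "x \<le> y" "y \<le> x"
  then have "to_nat_on (UNIV :: 'a set) (original x) = to_nat_on (UNIV :: 'a set) (original y)"
    by (simp add: less_eq_ordered_copy_def)
  then have "original x = original y"
    by (rule inj_onD[OF inj_on_to_nat_on, rotated]) (simp_all add: countable_finite)
  then show "x = y" by (simp add: original_inject)
next
  fix P :: "'a ordered_copy \<Rightarrow> bool" and a
  assume step: "\<And>x. (\<And>y. y < x \<Longrightarrow> P y) \<Longrightarrow> P x"
  show "P a"
    by (induction "to_nat_on (UNIV :: 'a set) (original a)" arbitrary: a rule: less_induct)
      (rule step, simp add: less_ordered_copy_def)
qed

end

definition rename :: "real^'n \<Rightarrow> real^'n ordered_copy" where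
  "rename x = (\<chi> a. x $ original a)"

definition unname :: "real^'n ordered_copy \<Rightarrow> real^'n" where
  "unname y = (\<chi> i. y $ copy_of i)"

lemma rename_unname [simp]: "rename (unname y) = y" "unname (rename x) = x"
  by (simp_all add: rename_def unname_def vec_eq_iff original_inverse)

lemma bounded_linear_rename: "bounded_linear rename" "bounded_linear unname"
  by (auto intro!: linear_linear[THEN iffD1, THEN linear_conv_bounded_linear[THEN iffD1]]
      simp: linear_conv_bounded_linear[symmetric] linear_iff rename_def unname_def vec_eq_iff)

lemma borel_measurable_rename [measurable]: "rename \<in> borel_measurable borel" "unname \<in> borel_measurable borel"
  using bounded_linear_rename[THEN linear_continuous_on, THEN borel_measurable_continuous_onI] by auto

lemma prod_Basis_vec:
  fixes x :: "real^'n"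
  shows "(\<Prod>b\<in>Basis. x \<bullet> b) = (\<Prod>i\<in>UNIV. x $ i)"
proof -
  have B: "(Basis :: (real^'n) set) = (\<lambda>i. axis i 1) ` UNIV" by (auto simp: Basis_vec_def)
  have "inj (\<lambda>i. axis i 1 :: real^'n)" by (auto simp: inj_on_def axis_eq_axis)
  from prod.reindex[OF this, of "\<lambda>b. x \<bullet> b"] show ?thesis
    unfolding B by (simp add: o_def inner_axis)
qed

lemma lborel_unname: "distr lborel borel unname = (lborel :: (real^'n) measure)"
proof (rule lborel_eqI[symmetric])
  fix l u :: "real^'n" assume lu: "\<And>b. b \<in> Basis \<Longrightarrow> l \<bullet> b \<le> u \<bullet> b"
  then have "l $ i \<le> u $ i" for i
    using lu[of "axis i 1"] by (simp add: inner_axis)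
  then have lu': "rename l \<bullet> b \<le> rename u \<bullet> b" if "b \<in> Basis" for b
    using that by (auto simp: Basis_vec_def inner_axis rename_def)
  have "x \<in> box (rename l) (rename u)" if "unname x \<in> box l u" for x
    unfolding mem_box_cart
  proof
    fix a
    have "l $ original a < unname x $ original a \<and> unname x $ original a < u $ original a"
      using that unfolding mem_box_cart by blast
    then show "rename l $ a < x $ a \<and> x $ a < rename u $ a"
      by (simp add: rename_def unname_def original_inverse)
  qed
  moreover have "unname x \<in> box l u" if "x \<in> box (rename l) (rename u)" for x
    unfolding mem_box_cart
  proof
    fix i
    have "rename l $ copy_of i < x $ copy_of i \<and> x $ copy_of i < rename u $ copy_of i"
      using that unfolding mem_box_cart by blast
    then show "l $ i < unname x $ i \<and> unname x $ i < u $ i"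
      by (simp add: rename_def unname_def)
  qed
  ultimately have "unname -` box l u = box (rename l) (rename u)" by blast
  then have "emeasure (distr lborel borel unname) (box l u) = emeasure lborel (box (rename l) (rename u))"
    by (simp add: emeasure_distr)
  also have "\<dots> = (\<Prod>b\<in>Basis. (rename u - rename l) \<bullet> b)"
    by (rule emeasure_lborel_box[OF lu'])
  also have "(\<Prod>b\<in>Basis. (rename u - rename l) \<bullet> b) = (\<Prod>a\<in>UNIV. (u - l) $ original a)"
    by (simp add: prod_Basis_vec rename_def)
  also have "\<dots> = (\<Prod>i\<in>UNIV. (u - l) $ i)"
    by (rule prod.reindex_bij_betw[OF bij_original])
  also have "\<dots> = (\<Prod>b\<in>Basis. (u - l) \<bullet> b)"
    by (rule prod_Basis_vec[symmetric])
  finally show "emeasure (distr lborel borel unname) (box l u) = (\<Prod>b\<in>Basis. (u - l) \<bullet> b)" .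
qed simp

lemma det_rename:
  fixes M :: "real^'n^'n"
  shows "det (\<chi> a b. M $ original a $ original b) = det M"
proof -
  let ?s = "map_permutation UNIV (original :: 'n ordered_copy \<Rightarrow> 'n)"
  let ?t = "map_permutation UNIV (copy_of :: 'n \<Rightarrow> 'n ordered_copy)"
  have bij': "bij (copy_of :: 'n \<Rightarrow> 'n ordered_copy)"
    by (rule o_bij[of original]) (auto simp: original_inverse)
  have "(\<Sum>p | p permutes UNIV. of_int (sign p) * (\<Prod>a\<in>UNIV. M $ original a $ original (p a)))
      = (\<Sum>p | p permutes (UNIV :: 'n set). of_int (sign p) * (\<Prod>i\<in>UNIV. M $ i $ p i))"
  proof (rule sum.reindex_bij_witness[of _ ?t ?s])
    fix p :: "'n ordered_copy \<Rightarrow> 'n ordered_copy"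
    assume "p \<in> {p. p permutes UNIV}"
    then have p: "p permutes UNIV" by simp
    show "?t (?s p) = p"
      by (rule map_permutation_compose_inv[OF bij_original p]) (simp add: original_inverse)
    show "?s p \<in> {p. p permutes UNIV}"
      using map_permutation_permutes[OF bij_original p] by simp
    have "(\<Prod>i\<in>UNIV. M $ i $ ?s p i) = (\<Prod>a\<in>UNIV. M $ original a $ ?s p (original a))"
      by (rule prod.reindex_bij_betw[OF bij_original, symmetric])
    also have "\<dots> = (\<Prod>a\<in>UNIV. M $ original a $ original (p a))"
      by (simp add: map_permutation_apply[OF inj_original])
    finally show "of_int (sign (?s p)) * (\<Prod>i\<in>UNIV. M $ i $ ?s p i) =
        of_int (sign p) * (\<Prod>a\<in>UNIV. M $ original a $ original (p a))"
      by (simp add: sign_map_permutation[OF inj_original p])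
  next
    fix p :: "'n \<Rightarrow> 'n"
    assume "p \<in> {p. p permutes UNIV}"
    then have p: "p permutes UNIV" by simp
    show "?s (?t p) = p"
      by (rule map_permutation_compose_inv[OF bij' p]) simp
    show "?t p \<in> {p. p permutes UNIV}"
      using map_permutation_permutes[OF bij' p] by simp
  qed
  then show ?thesis by (simp add: det_def)
qed

text \<open>Finiteness of one side lets the formula pass from absolutely integrable functions to integrals of
  nonnegative ones.\<close>

lemma nn_integral_change_of_variables_ordered:
  fixes T :: "real^'m::{finite,wellorder} \<Rightarrow> real^'m::_" and h D :: "real^'m::_ \<Rightarrow> real"
  assumes S[measurable]: "S \<in> sets borel"
    and der: "\<And>x. x \<in> S \<Longrightarrow> (T has_derivative T' x) (at x within S)"
    and inj: "inj_on T S"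
    and D[measurable]: "D \<in> borel_measurable borel"
    and D_eq: "\<And>x. x \<in> S \<Longrightarrow> D x = \<bar>det (matrix (T' x))\<bar> * h (T x)"
    and h: "\<And>y. y \<in> T ` S \<Longrightarrow> 0 \<le> h y"
    and fin: "(\<integral>\<^sup>+x\<in>S. ennreal (D x) \<partial>lborel) < \<infinity>"
  shows "(\<integral>\<^sup>+y\<in>T ` S. ennreal (h y) \<partial>lborel) = (\<integral>\<^sup>+x\<in>S. ennreal (D x) \<partial>lborel)"
proof -
  define r where "r = enn2real (\<integral>\<^sup>+x\<in>S. ennreal (D x) \<partial>lborel)"
  have r: "(\<integral>\<^sup>+x\<in>S. ennreal (D x) \<partial>lborel) = ennreal r"
    using fin by (simp add: r_def)
  have nonneg: "0 \<le> D x" if "x \<in> S" for x using D_eq[OF that] h that by simp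
  have "((\<lambda>x. D x * indicator S x) has_integral r) UNIV"
  proof (rule nn_integral_has_integral)
    show "0 \<le> D x * indicator S x" for x using nonneg by (simp add: indicator_def)
    have "(\<integral>\<^sup>+x. ennreal (D x * indicator S x) \<partial>lborel) = (\<integral>\<^sup>+x\<in>S. ennreal (D x) \<partial>lborel)"
      by (intro nn_integral_cong) (simp add: indicator_def)
    then show "(\<integral>\<^sup>+x. ennreal (D x * indicator S x) \<partial>lborel) = ennreal r" by (simp only: r)
  qed (simp_all add: r_def)
  then have "((\<lambda>x. if x \<in> S then D x else 0) has_integral r) UNIV"
    by (rule has_integral_eq[rotated]) (simp add: indicator_def)
  then have "(D has_integral r) S" by (simp only: has_integral_restrict_UNIV)
  then have D_int: "((\<lambda>x. \<bar>det (matrix (T' x))\<bar> * h (T x)) has_integral r) S"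
    by (rule has_integral_eq[rotated]) (rule D_eq)
  then have "(\<lambda>x. \<bar>det (matrix (T' x))\<bar> * h (T x)) absolutely_integrable_on S"
    using h by (subst absolutely_integrable_on_iff_nonneg) (auto simp: integrable_on_def)
  moreover have "integral S (\<lambda>x. \<bar>det (matrix (T' x))\<bar> * h (T x)) = r"
    using D_int by (rule integral_unique)
  moreover have "S \<in> sets lebesgue" by simp
  \<comment> \<open>The change of variables formula is about vector valued functions, hence the lift to dimension 1.\<close>
  ultimately have "h absolutely_integrable_on T ` S \<and> integral (T ` S) h = r"
    using has_absolute_integral_change_of_variables[OF _ der inj, of "\<lambda>y. vec (h y) :: real^1" "vec r"]
    unfolding absolutely_integrable_on_1_iff integral_on_1_eq by (simp add: vec_eq_iff)
  then have "(h has_integral r) (T ` S)"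
    by (auto simp: has_integral_iff absolutely_integrable_on_def)
  from nn_integral_has_integral_lebesgue'[OF h this] show ?thesis by (simp only: r)
qed

lemma nn_integral_change_of_variables:
  fixes T :: "real^'n \<Rightarrow> real^'n" and h D :: "real^'n \<Rightarrow> real"
  assumes S[measurable]: "S \<in> sets borel" and TS[measurable]: "T ` S \<in> sets borel"
    and der: "\<And>x. x \<in> S \<Longrightarrow> (T has_derivative T' x) (at x)"
    and inj: "inj_on T S"
    and D[measurable]: "D \<in> borel_measurable borel"
    and h_meas[measurable]: "h \<in> borel_measurable borel"
    and D_eq: "\<And>x. x \<in> S \<Longrightarrow> D x = \<bar>det (matrix (T' x))\<bar> * h (T x)"
    and h: "\<And>y. y \<in> T ` S \<Longrightarrow> 0 \<le> h y"
    and fin: "(\<integral>\<^sup>+x\<in>S. ennreal (D x) \<partial>lborel) < \<infinity>"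
  shows "(\<integral>\<^sup>+y\<in>T ` S. ennreal (h y) \<partial>lborel) = (\<integral>\<^sup>+x\<in>S. ennreal (D x) \<partial>lborel)"
proof -
  have pull: "(\<integral>\<^sup>+x\<in>B. ennreal (f x) \<partial>lborel) = (\<integral>\<^sup>+y\<in>unname -` B. ennreal (f (unname y)) \<partial>lborel)"
    if [measurable]: "B \<in> sets borel" "f \<in> borel_measurable borel" for B and f :: "real^'n \<Rightarrow> real"
  proof -
    have "(\<integral>\<^sup>+x\<in>B. ennreal (f x) \<partial>lborel) = (\<integral>\<^sup>+x\<in>B. ennreal (f x) \<partial>distr lborel borel unname)"
      by (simp only: lborel_unname)
    also have "\<dots> = (\<integral>\<^sup>+y. ennreal (f (unname y)) * indicator B (unname y) \<partial>lborel)"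
      by (rule nn_integral_distr) measurable
    finally show ?thesis by (simp add: indicator_def vimage_def)
  qed
  let ?T = "\<lambda>y. rename (T (unname y))"
  let ?T' = "\<lambda>y v. rename (T' (unname y) (unname v))"
  have image: "unname -` (T ` S) = ?T ` (unname -` S)"
  proof (intro set_eqI iffI)
    fix y assume "y \<in> unname -` (T ` S)"
    then obtain x where x: "x \<in> S" "unname y = T x" by auto
    then have "y = ?T (rename x)" by (metis rename_unname)
    with x show "y \<in> ?T ` (unname -` S)" by (intro image_eqI[of _ _ "rename x"]) auto
  qed auto
  have "(\<integral>\<^sup>+y\<in>?T ` (unname -` S). ennreal (h (unname y)) \<partial>lborel) = (\<integral>\<^sup>+y\<in>unname -` S. ennreal (D (unname y)) \<partial>lborel)"
  proof (rule nn_integral_change_of_variables_ordered[where T' = ?T'])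
    show "unname -` S \<in> sets borel" using measurable_sets[OF borel_measurable_rename(2) S] by simp
    show "(?T has_derivative ?T' y) (at y within unname -` S)" if "y \<in> unname -` S" for y
    proof -
      have U: "(unname has_derivative unname) (at y)"
        by (rule bounded_linear_imp_has_derivative[OF bounded_linear_rename(2)])
      have "((\<lambda>y. T (unname y)) has_derivative (\<lambda>v. T' (unname y) (unname v))) (at y)"
        using has_derivative_compose[OF U der] that by simp
      from bounded_linear.has_derivative[OF bounded_linear_rename(1) this]
      show ?thesis by (rule has_derivative_at_withinI)
    qed
    show "inj_on ?T (unname -` S)"
    proof (rule inj_onI)
      fix x y assume xy: "x \<in> unname -` S" "y \<in> unname -` S" and "?T x = ?T y"
      then have "T (unname x) = T (unname y)" "unname x \<in> S" "unname y \<in> S"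
        by (metis rename_unname(2)) (use xy in auto)
      then have "unname x = unname y" using inj by (simp add: inj_on_eq_iff)
      then show "x = y" by (metis rename_unname(1))
    qed
    show "(\<lambda>y. D (unname y)) \<in> borel_measurable borel" by measurable
    show "D (unname y) = \<bar>det (matrix (?T' y))\<bar> * h (unname (?T y))" if "y \<in> unname -` S" for y
    proof -
      have "matrix (?T' y) = (\<chi> a b. matrix (T' (unname y)) $ original a $ original b)"
      proof -
        have "unname (axis b 1) = axis (original b) 1" for b :: "'n ordered_copy"
          by (auto simp: unname_def axis_def vec_eq_iff original_inverse)
        then show ?thesis by (simp add: matrix_def rename_def)
      qed
      then have "det (matrix (?T' y)) = det (matrix (T' (unname y)))"
        by (simp only: det_rename)
      then show ?thesis using D_eq[of "unname y"] that by simp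
    qed
    show "0 \<le> h (unname y)" if "y \<in> ?T ` (unname -` S)" for y
      using that h by auto
    show "(\<integral>\<^sup>+y\<in>unname -` S. ennreal (D (unname y)) \<partial>lborel) < \<infinity>"
      using fin by (simp only: pull[OF S D])
  qed
  then show ?thesis by (simp only: pull[OF S D] pull[OF TS h_meas] image)
qed

section \<open>Functions in charts\<close>

definition C1_in_chart :: "('m, 'n::finite) chart \<Rightarrow> ('m \<Rightarrow> real) \<Rightarrow> bool" where
  "C1_in_chart c f \<longleftrightarrow> C_k_on (Suc 0) (chart_img c) (f \<circ> chart_inv c)"

definition chart_differential :: "('m, 'n::finite) chart \<Rightarrow> ('m \<Rightarrow> real) \<Rightarrow> 'm \<Rightarrow> real^'n \<Rightarrow> real" where
  "chart_differential c f p v = frechet_derivative (f \<circ> chart_inv c) (at (chart_map c p)) v"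

locale manifold_without_boundary =
  fixes A :: "('m::t2_space, 'n::finite) chart set"
  assumes closed_manifold: "closed_manifold A"
begin

lemma compact_UNIV: "compact (UNIV :: 'm set)"
  using closed_manifold by (simp add: closed_manifold_def)

context
  fixes c assumes c: "c \<in> A"
begin

lemma is_chart: "is_chart c"
  using closed_manifold c by (simp add: closed_manifold_def smooth_atlas_def)

lemma open_chart_dom: "open (chart_dom c)" and open_chart_img: "open (chart_img c)"
  using is_chart by (simp_all add: is_chart_def)

lemma continuous_chart_map: "continuous_on (chart_dom c) (chart_map c)"
  and continuous_chart_inv: "continuous_on (chart_img c) (chart_inv c)"
  using is_chart by (simp_all add: is_chart_def homeomorphism_def)

lemma chart_inv_map: "p \<in> chart_dom c \<Longrightarrow> chart_inv c (chart_map c p) = p"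
  and chart_map_inv: "x \<in> chart_img c \<Longrightarrow> chart_map c (chart_inv c x) = x"
  and chart_inv_in_dom: "x \<in> chart_img c \<Longrightarrow> chart_inv c x \<in> chart_dom c"
  using is_chart unfolding is_chart_def homeomorphism_def by blast+

lemma chart_map_in_img: "p \<in> chart_dom c \<Longrightarrow> chart_map c p \<in> chart_img c"
  by (simp add: chart_img_def)

lemma chart_map_image:
  assumes "U \<subseteq> chart_dom c"
  shows "chart_map c ` U = chart_img c \<inter> chart_inv c -` U"
proof (intro set_eqI iffI)
  fix x assume "x \<in> chart_map c ` U"
  then show "x \<in> chart_img c \<inter> chart_inv c -` U"
    using assms chart_inv_map chart_map_in_img by auto
next
  fix x assume "x \<in> chart_img c \<inter> chart_inv c -` U"
  then show "x \<in> chart_map c ` U"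
    using chart_map_inv[of x] by (intro image_eqI[of x _ "chart_inv c x"]) simp_all
qed

lemma open_chart_map_image:
  assumes "open U" "U \<subseteq> chart_dom c"
  shows "open (chart_map c ` U)"
  unfolding chart_map_image[OF assms(2)]
  by (rule continuous_open_preimage[OF continuous_chart_inv open_chart_img assms(1)])

lemma continuous_on_chart_iff:
  "continuous_on (chart_img c) (f \<circ> chart_inv c) \<longleftrightarrow> continuous_on (chart_dom c) f"
proof
  assume "continuous_on (chart_img c) (f \<circ> chart_inv c)"
  then have "continuous_on (chart_dom c) ((f \<circ> chart_inv c) \<circ> chart_map c)"
    using continuous_on_compose[OF continuous_chart_map] by (simp only: chart_img_def)
  then show "continuous_on (chart_dom c) f"
    by (rule continuous_on_eq) (simp add: chart_inv_map)
next
  assume "continuous_on (chart_dom c) f"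
  then have "continuous_on (chart_inv c ` chart_img c) f"
    by (rule continuous_on_subset) (auto simp: chart_inv_in_dom)
  then show "continuous_on (chart_img c) (f \<circ> chart_inv c)"
    by (rule continuous_on_compose[OF continuous_chart_inv])
qed

lemma C1_in_chart_continuous: "C1_in_chart c f \<Longrightarrow> continuous_on (chart_dom c) f"
  unfolding C1_in_chart_def using C_k_on_continuous continuous_on_chart_iff by blast

lemma C1_in_chart_has_derivative:
  assumes "C1_in_chart c f" "p \<in> chart_dom c"
  shows "((f \<circ> chart_inv c) has_derivative chart_differential c f p) (at (chart_map c p))"
  unfolding chart_differential_def
  by (rule C_k_on_has_derivative[OF assms(1)[unfolded C1_in_chart_def] chart_map_in_img[OF assms(2)]])

lemma C1_in_chart_continuous_differential:
  assumes "C1_in_chart c f"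
  shows "continuous_on (chart_dom c) (\<lambda>p. chart_differential c f p v)"
proof -
  have "continuous_on (chart_img c) (\<lambda>x. frechet_derivative (f \<circ> chart_inv c) (at x) v)"
    using C_k_on_frechet_derivative[OF assms[unfolded C1_in_chart_def]] by simp
  then have "continuous_on (chart_img c) ((\<lambda>p. chart_differential c f p v) \<circ> chart_inv c)"
    by (rule continuous_on_eq) (simp add: chart_differential_def chart_map_inv)
  then show ?thesis by (simp only: continuous_on_chart_iff)
qed

lemma chart_differential_sum_partial:
  assumes "C1_in_chart c f" "p \<in> chart_dom c"
  shows "chart_differential c f p v = (\<Sum>i\<in>UNIV. v $ i * partial c i f p)"
proof -
  have lin: "linear (chart_differential c f p)"
    using C1_in_chart_has_derivative[OF assms] by (rule has_derivative_linear)
  have "v = (\<Sum>i\<in>UNIV. (v $ i) *\<^sub>R axis i 1)"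
    by (simp add: vec_eq_iff axis_def if_distrib sum.delta cong: if_cong)
  then have "chart_differential c f p v = chart_differential c f p (\<Sum>i\<in>UNIV. (v $ i) *\<^sub>R axis i 1)"
    by (rule arg_cong)
  also have "\<dots> = (\<Sum>i\<in>UNIV. v $ i * chart_differential c f p (axis i 1))"
    by (simp add: linear_sum[OF lin] linear_scale[OF lin])
  finally show ?thesis by (simp add: partial_def chart_differential_def)
qed

end

lemma chart_at: "chart_at A p \<in> A" "p \<in> chart_dom (chart_at A p)"
proof -
  have "\<exists>c. c \<in> A \<and> p \<in> chart_dom c"
    using closed_manifold by (auto simp: closed_manifold_def smooth_atlas_def)
  from someI_ex[OF this] show "chart_at A p \<in> A" "p \<in> chart_dom (chart_at A p)"
    unfolding chart_at_def by blast+
qed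

lemma continuous_on_manifold:
  fixes f :: "'m \<Rightarrow> 'b::topological_space"
  assumes "\<And>c. c \<in> A \<Longrightarrow> continuous_on (chart_dom c) f"
  shows "continuous_on UNIV f"
proof (rule continuous_at_imp_continuous_on, intro ballI)
  fix p :: 'm
  show "isCont f p"
    using assms[OF chart_at(1)[of p]] chart_at(2)[of p]
    by (simp add: continuous_on_eq_continuous_at open_chart_dom[OF chart_at(1)])
qed

text \<open>A function supported in a compact part of a chart domain is continuous there and on the open
  complement of its support, and these two sets cover the manifold.\<close>

lemma continuous_on_extend_zero:
  fixes f :: "'m \<Rightarrow> real"
  assumes c: "c \<in> A" and "continuous_on (chart_dom c) f"
    and "compact K" "K \<subseteq> chart_dom c" and zero: "\<And>p. p \<notin> K \<Longrightarrow> f p = 0"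
  shows "continuous_on UNIV f"
proof -
  have "continuous_on (- K) f"
    by (rule continuous_on_eq[OF continuous_on_const[of _ 0]]) (simp add: zero)
  then have "continuous_on (chart_dom c \<union> - K) f"
    using assms open_chart_dom[OF c] compact_imp_closed[OF \<open>compact K\<close>]
    by (intro continuous_on_open_Un) (simp_all add: open_Compl)
  moreover have "chart_dom c \<union> - K = UNIV" using assms by blast
  ultimately show ?thesis by (simp only:)
qed

section \<open>Changes of charts\<close>

context
  fixes c d assumes c: "c \<in> A" and d: "d \<in> A"
begin

lemma transition_map: "p \<in> chart_dom c \<Longrightarrow> transition c d (chart_map c p) = chart_map d p"
  by (simp add: transition_def chart_inv_map[OF c])

lemma open_overlap: "open (chart_map c ` (chart_dom c \<inter> chart_dom d))"
  by (intro open_chart_map_image[OF c] open_Int open_chart_dom c d) simp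

lemma C_k_on_transition: "C_k_on k (chart_map c ` (chart_dom c \<inter> chart_dom d)) (transition c d)"
  using closed_manifold c d by (simp add: closed_manifold_def smooth_atlas_def smooth_on_def)

lemma transition_has_derivative:
  assumes "p \<in> chart_dom c \<inter> chart_dom d"
  shows "(transition c d has_derivative (\<lambda>v. coord_jacobian c d p *v v)) (at (chart_map c p))"
proof -
  have D: "(transition c d has_derivative frechet_derivative (transition c d) (at (chart_map c p))) (at (chart_map c p))"
    by (rule C_k_on_has_derivative[OF C_k_on_transition]) (use assms in auto)
  have "(\<lambda>v. coord_jacobian c d p *v v) = frechet_derivative (transition c d) (at (chart_map c p))"
    unfolding coord_jacobian_def jacobian_def
    by (rule matrix_vector_mul(2)[OF has_derivative_linear[OF D]])
  with D show ?thesis by (simp only:)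
qed

text \<open>The chain rule: a vector transforms by the Jacobian matrix precisely so that its action on functions
  does not depend on the chart.\<close>

lemma chart_differential_change:
  assumes "C1_in_chart d f" and p: "p \<in> chart_dom c \<inter> chart_dom d"
  shows "chart_differential c f p v = chart_differential d f p (coord_jacobian c d p *v v)"
proof -
  have "((f \<circ> chart_inv d) has_derivative chart_differential d f p) (at (transition c d (chart_map c p)))"
    using C1_in_chart_has_derivative[OF d assms(1)] p by (simp add: transition_map)
  from has_derivative_compose[OF transition_has_derivative[OF p] this]
  have "((\<lambda>x. (f \<circ> chart_inv d) (transition c d x)) has_derivative
      (\<lambda>v. chart_differential d f p (coord_jacobian c d p *v v))) (at (chart_map c p))" .
  then have "((f \<circ> chart_inv c) has_derivative
      (\<lambda>v. chart_differential d f p (coord_jacobian c d p *v v))) (at (chart_map c p))"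
  proof (rule has_derivative_transform_within_open[OF _ open_overlap])
    show "chart_map c p \<in> chart_map c ` (chart_dom c \<inter> chart_dom d)" using p by blast
    fix x assume "x \<in> chart_map c ` (chart_dom c \<inter> chart_dom d)"
    then show "(f \<circ> chart_inv d) (transition c d x) = (f \<circ> chart_inv c) x"
      using chart_inv_map[OF c] chart_inv_map[OF d] transition_map by auto
  qed
  from frechet_derivative_at[OF this] show ?thesis
    unfolding chart_differential_def[of c] by (rule fun_cong[symmetric])
qed

end

section \<open>Bump functions and partitions of unity\<close>

lemma DERIV_max_0_square: "((\<lambda>t. (max 0 t)\<^sup>2) has_real_derivative 2 * max 0 t) (at t)"
proof -
  consider "t > 0" | "t < 0" | "t = 0" by linarith
  then show ?thesis
  proof cases
    case 1
    have "((\<lambda>t. t\<^sup>2) has_real_derivative 2 * max 0 t) (at t)"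
      using 1 by (auto intro!: derivative_eq_intros)
    then show ?thesis
      by (rule has_field_derivative_transform_within_open[of _ _ _ "{0<..}"]) (use 1 in auto)
  next
    case 2
    have "((\<lambda>t. 0) has_real_derivative 2 * max 0 t) (at t)"
      using 2 by auto
    then show ?thesis
      by (rule has_field_derivative_transform_within_open[of _ _ _ "{..<0}"]) (use 2 in auto)
  next
    case 3
    have "((\<lambda>h. ((max 0 (0 + h))\<^sup>2 - (max 0 0)\<^sup>2) / h) \<longlongrightarrow> 0) (at (0::real))"
    proof (rule Lim_null_comparison)
      show "\<forall>\<^sub>F h in at (0::real). norm (((max 0 (0 + h))\<^sup>2 - (max 0 0)\<^sup>2) / h) \<le> \<bar>h\<bar>"
        by (rule always_eventually) (auto simp: max_def power2_eq_square)
      show "((\<lambda>h. \<bar>h\<bar>) \<longlongrightarrow> 0) (at (0::real))"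
        using tendsto_rabs_zero[OF tendsto_ident_at] .
    qed
    then show ?thesis using 3 by (simp add: DERIV_def)
  qed
qed

text \<open>The square of the positive part of a paraboloid is a bump function of class \<open>C\<^sup>1\<close>, which is all that
  integration by parts asks of it.\<close>

lemma C1_paraboloid_bump:
  fixes a :: "real^'n"
  assumes "open S"
  shows "C_k_on (Suc 0) S (\<lambda>x. (max 0 (r\<^sup>2 - (x - a) \<bullet> (x - a)))\<^sup>2)"
proof (rule C_k_onI[OF assms])
  let ?u = "\<lambda>x. r\<^sup>2 - (x - a) \<bullet> (x - a)"
  fix x
  have "(?u has_derivative (\<lambda>v. - (2 * ((x - a) \<bullet> v)))) (at x)"
    by (auto intro!: derivative_eq_intros simp: inner_commute algebra_simps)
  from has_derivative_compose[OF this DERIV_max_0_square[unfolded has_field_derivative_def]]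
  show "((\<lambda>x. (max 0 (?u x))\<^sup>2) has_derivative (\<lambda>v. 2 * max 0 (?u x) * (- (2 * ((x - a) \<bullet> v))))) (at x)" .
next
  fix v :: "real^'n"
  show "C_k_on 0 S (\<lambda>x. 2 * max 0 (r\<^sup>2 - (x - a) \<bullet> (x - a)) * (- (2 * ((x - a) \<bullet> v))))"
    by (auto intro!: continuous_intros)
qed

text \<open>The bump lives in a ball in the chart \<open>c\<close>.  In another chart it is of class \<open>C\<^sup>1\<close> both on the overlap with
  \<open>c\<close>, by the chain rule, and off its compact support, where it vanishes; the two open sets cover that chart.\<close>

lemma bump_exists:
  assumes c: "c \<in> A" and "p \<in> V" "open V" "V \<subseteq> chart_dom c"
  obtains f :: "'m \<Rightarrow> real" and K where "compact K" "K \<subseteq> V" "0 < f p" "\<And>x. 0 \<le> f x"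
    "\<And>x. x \<notin> K \<Longrightarrow> f x = 0" "\<And>d. d \<in> A \<Longrightarrow> C1_in_chart d f"
proof -
  define a where "a = chart_map c p"
  have "open (chart_map c ` V)" by (rule open_chart_map_image[OF c assms(3,4)])
  moreover have "a \<in> chart_map c ` V" using assms(2) by (simp add: a_def)
  ultimately obtain r where r: "r > 0" "cball a r \<subseteq> chart_map c ` V"
    using open_contains_cball by blast
  have cball: "cball a r \<subseteq> chart_img c"
    using r(2) assms(4) by (auto simp: chart_img_def)
  define K where "K = chart_inv c ` cball a r"
  define u where "u x = (max 0 (r\<^sup>2 - (x - a) \<bullet> (x - a)))\<^sup>2" for x :: "real^'n"
  define f where "f x = (if x \<in> chart_dom c then u (chart_map c x) else 0)" for x
  have K: "compact K"
    unfolding K_def by (rule compact_continuous_image[OF continuous_on_subset[OF continuous_chart_inv[OF c] cball]]) simp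
  have KV: "K \<subseteq> V"
  proof
    fix x assume "x \<in> K"
    then obtain y where "y \<in> cball a r" "x = chart_inv c y" by (auto simp: K_def)
    then obtain q where "q \<in> V" "x = chart_inv c (chart_map c q)" using r(2) by blast
    then show "x \<in> V" using chart_inv_map[OF c, of q] assms(4) by auto
  qed
  have zero: "f x = 0" if "x \<notin> K" for x
  proof (cases "x \<in> chart_dom c")
    case True
    have "chart_map c x \<notin> cball a r"
    proof
      assume "chart_map c x \<in> cball a r"
      then have "chart_inv c (chart_map c x) \<in> K" unfolding K_def by blast
      then show False using that chart_inv_map[OF c True] by simp
    qed
    then have "r < norm (chart_map c x - a)" by (simp add: dist_norm norm_minus_commute)
    then have "r\<^sup>2 \<le> (norm (chart_map c x - a))\<^sup>2" using r(1) by (intro power_mono) auto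
    then have "r\<^sup>2 \<le> (chart_map c x - a) \<bullet> (chart_map c x - a)" by (simp only: power2_norm_eq_inner)
    then show ?thesis by (simp add: f_def u_def)
  qed (simp add: f_def)
  have fp: "0 < f p"
    using r(1) assms(2,4) by (auto simp: f_def u_def a_def)
  have nonneg: "0 \<le> f x" for x by (simp add: f_def u_def)
  have C1c: "C_k_on (Suc 0) (chart_img c) (f \<circ> chart_inv c)"
    by (rule C_k_on_cong[OF open_chart_img[OF c] C1_paraboloid_bump[OF open_chart_img[OF c], of r a]])
      (simp add: f_def u_def chart_inv_in_dom[OF c] chart_map_inv[OF c])
  have "C1_in_chart d f" if d: "d \<in> A" for d
  proof -
    let ?S = "chart_map d ` (chart_dom d \<inter> chart_dom c)" and ?T = "chart_map d ` (chart_dom d - K)"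
    have S: "open ?S" by (rule open_overlap[OF d c])
    have "closed K" using K by (rule compact_imp_closed)
    then have T: "open ?T" by (intro open_chart_map_image[OF d] open_Diff open_chart_dom[OF d]) auto
    have "C_k_on (Suc 0) ?S (\<lambda>x. (f \<circ> chart_inv c) (transition d c x))"
    proof (rule C_1_on_compose[OF open_chart_img[OF c] S _ C1c C_k_on_transition[OF d c]])
      show "transition d c ` ?S \<subseteq> chart_img c"
        using transition_map[OF d c] chart_map_in_img[OF c] by auto
    qed
    then have 1: "C_k_on (Suc 0) ?S (f \<circ> chart_inv d)"
    proof (rule C_k_on_cong[OF S])
      fix x assume "x \<in> ?S"
      then show "(f \<circ> chart_inv c) (transition d c x) = (f \<circ> chart_inv d) x"
        using chart_inv_map[OF c] chart_inv_map[OF d] transition_map[OF d c] by auto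
    qed
    have "C_k_on (Suc 0) ?T (\<lambda>x. 0 :: real)" by simp
    then have 2: "C_k_on (Suc 0) ?T (f \<circ> chart_inv d)"
    proof (rule C_k_on_cong[OF T])
      fix x assume "x \<in> ?T"
      then show "0 = (f \<circ> chart_inv d) x" using chart_inv_map[OF d] zero by auto
    qed
    have "?S \<union> ?T = chart_img d" using KV assms(4) by (auto simp: chart_img_def)
    then show ?thesis
      using C_k_on_Un[OF S T 1 2] by (simp only: C1_in_chart_def)
  qed
  with K KV fp nonneg zero show ?thesis by (rule that[of K f])
qed

text \<open>By compactness finitely many bumps have a positive sum; dividing by the sum normalises them.\<close>

lemma partition_of_unity:
  obtains P :: "'m set" and \<rho> :: "'m \<Rightarrow> 'm \<Rightarrow> real" and K where "finite P"
    "\<And>p. p \<in> P \<Longrightarrow> compact (K p)" "\<And>p. p \<in> P \<Longrightarrow> K p \<subseteq> chart_dom (chart_at A p)"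
    "\<And>p x. p \<in> P \<Longrightarrow> 0 \<le> \<rho> p x" "\<And>p x. p \<in> P \<Longrightarrow> x \<notin> K p \<Longrightarrow> \<rho> p x = 0"
    "\<And>p d. p \<in> P \<Longrightarrow> d \<in> A \<Longrightarrow> C1_in_chart d (\<rho> p)" "\<And>x. (\<Sum>p\<in>P. \<rho> p x) = 1"
proof -
  define Q where "Q p f K \<longleftrightarrow> compact K \<and> K \<subseteq> chart_dom (chart_at A p) \<and> 0 < f p \<and> (\<forall>x. 0 \<le> f x) \<and>
      (\<forall>x. x \<notin> K \<longrightarrow> f x = 0) \<and> (\<forall>d\<in>A. C1_in_chart d f)" for p :: 'm and f :: "'m \<Rightarrow> real" and K
  have "\<forall>p. \<exists>fK. Q p (fst fK) (snd fK)"
  proof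
    fix p
    show "\<exists>fK. Q p (fst fK) (snd fK)"
    proof (rule bump_exists[OF chart_at(1)[of p] chart_at(2)[of p] open_chart_dom[OF chart_at(1)] order_refl])
      fix f :: "'m \<Rightarrow> real" and K
      assume "compact K" "K \<subseteq> chart_dom (chart_at A p)" "0 < f p" "\<And>x. 0 \<le> f x"
        "\<And>x. x \<notin> K \<Longrightarrow> f x = 0" "\<And>d. d \<in> A \<Longrightarrow> C1_in_chart d f"
      then have "Q p f K" unfolding Q_def by (intro conjI allI ballI impI)
      then show ?thesis by (intro exI[of _ "(f, K)"]) (simp only: fst_conv snd_conv)
    qed
  qed
  from choice[OF this] obtain fK where fK: "\<forall>p. Q p (fst (fK p)) (snd (fK p))" by (rule exE)
  define f where "f p = fst (fK p)" for p
  define K where "K p = snd (fK p)" for p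
  have Q: "Q p (f p) (K p)" for p
    unfolding f_def K_def by (rule spec[OF fK])
  note f = Q[unfolded Q_def, THEN conjunct1] Q[unfolded Q_def, THEN conjunct2, THEN conjunct1]
    Q[unfolded Q_def, THEN conjunct2, THEN conjunct2, THEN conjunct1]
    Q[unfolded Q_def, THEN conjunct2, THEN conjunct2, THEN conjunct2, THEN conjunct1, rule_format]
    Q[unfolded Q_def, THEN conjunct2, THEN conjunct2, THEN conjunct2, THEN conjunct2, THEN conjunct1, rule_format]
    Q[unfolded Q_def, THEN conjunct2, THEN conjunct2, THEN conjunct2, THEN conjunct2, THEN conjunct2, rule_format]
  have cont: "continuous_on UNIV (f p)" for p
    by (rule continuous_on_manifold) (rule C1_in_chart_continuous[OF _ f(6)])
  have "open {x. 0 < f p x}" for p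
    using open_Collect_less[OF continuous_on_const[of UNIV 0] cont] .
  then have op: "\<And>p. p \<in> UNIV \<Longrightarrow> open {x. 0 < f p x}" .
  have "UNIV \<subseteq> (\<Union>p\<in>UNIV. {x. 0 < f p x})"
  proof
    fix x show "x \<in> (\<Union>p\<in>UNIV. {x. 0 < f p x})" by (intro UN_I[of x]) (simp_all add: f(3))
  qed
  with op obtain P where P: "finite P" "UNIV \<subseteq> (\<Union>p\<in>P. {x. 0 < f p x})"
    by (rule compactE_image[OF compact_UNIV])
  define s where "s x = (\<Sum>p\<in>P. f p x)" for x
  have s: "0 < s x" for x
  proof -
    have "x \<in> (\<Union>p\<in>P. {x. 0 < f p x})" by (rule subsetD[OF P(2) UNIV_I])
    then obtain p where "p \<in> P" "0 < f p x" by (elim UN_E CollectE)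
    then show ?thesis unfolding s_def by (intro sum_pos2[OF P(1)]) (simp_all add: f(4))
  qed
  show ?thesis
  proof (rule that[of P K "\<lambda>p x. f p x * inverse (s x)"])
    show "finite P" by (rule P(1))
    show "0 \<le> f p x * inverse (s x)" for p x using f(4)[of p x] s[of x] by simp
    show "f p x * inverse (s x) = 0" if "x \<notin> K p" for p x using f(5)[OF that] by simp
    show "C1_in_chart d (\<lambda>x. f p x * inverse (s x))" if "d \<in> A" for p d
    proof -
      have C: "C_k_on (Suc 0) (chart_img d) (\<lambda>x. f q (chart_inv d x))" for q
        using f(6)[OF that] by (simp add: C1_in_chart_def o_def)
      have "C_k_on (Suc 0) (chart_img d) (\<lambda>x. s (chart_inv d x))"
        unfolding s_def by (rule C_k_on_sum[OF open_chart_img[OF that] C])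
      moreover have "s y \<noteq> 0" for y using s[of y] by simp
      ultimately have "C_k_on (Suc 0) (chart_img d) (\<lambda>x. inverse (s (chart_inv d x)))"
        by (rule C_k_on_inverse[OF open_chart_img[OF that], rotated])
      from C_k_on_mult[OF open_chart_img[OF that] C this]
      show ?thesis unfolding C1_in_chart_def o_def .
    qed
    show "(\<Sum>p\<in>P. f p x * inverse (s x)) = 1" for x
      using s[of x] by (simp add: sum_distrib_right[symmetric] s_def[symmetric])
    show "compact (K p)" "K p \<subseteq> chart_dom (chart_at A p)" for p by (rule f(1), rule f(2))
  qed
qed

end

section \<open>The Riemannian volume measure\<close>

locale closed_riemannian_manifold = manifold_without_boundary A
  for A :: "('m::t2_space, 'n::finite) chart set" +
  fixes g :: "('m, 'n) tensor2"
  assumes riemannian_metric: "riemannian_metric A g"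
begin

lemma metric_symmetric:
  assumes "c \<in> A" "p \<in> chart_dom c"
  shows "transpose (g c p) = g c p"
  using riemannian_metric assms by (simp add: riemannian_metric_def symmetric_tensor_field_def)

lemma metric_posdef:
  assumes "c \<in> A" "p \<in> chart_dom c" "v \<noteq> 0"
  shows "v \<bullet> (g c p *v v) > 0"
  using riemannian_metric assms by (simp add: riemannian_metric_def)

lemma det_metric_pos:
  assumes "c \<in> A" "p \<in> chart_dom c"
  shows "det (g c p) > 0"
  by (rule posdef_det_pos[OF metric_symmetric[OF assms] metric_posdef[OF assms]])

lemma C_k_on_tensor_components:
  assumes "tensor_field A T" "c \<in> A"
  shows "C_k_on k (chart_img c) (\<lambda>x. T c (chart_inv c x) $ i $ j)"
proof -
  have "smooth_on (chart_img c) (T c \<circ> chart_inv c)"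
    using assms unfolding tensor_field_def smooth_in_chart_def by blast
  then have "C_k_on k (chart_img c) (\<lambda>x. T c (chart_inv c x))"
    unfolding smooth_on_def o_def by (rule spec)
  from C_k_on_nth[OF open_chart_img[OF assms(2)] C_k_on_nth[OF open_chart_img[OF assms(2)] this]]
  show ?thesis .
qed

lemma tensor_field_change:
  assumes "tensor_field A T" "c \<in> A" "d \<in> A" "p \<in> chart_dom c \<inter> chart_dom d"
  shows "T c p = transpose (coord_jacobian c d p) ** T d p ** coord_jacobian c d p"
  using assms unfolding tensor_field_def by blast

lemma metric_tensor_field: "tensor_field A g"
  using riemannian_metric by (simp add: riemannian_metric_def symmetric_tensor_field_def)

text \<open>The square root of this identity is the transformation rule of volume densities.\<close>

lemma det_metric_change:
  assumes "c \<in> A" "d \<in> A" "p \<in> chart_dom c \<inter> chart_dom d"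
  shows "det (g c p) = (det (coord_jacobian c d p))\<^sup>2 * det (g d p)"
  unfolding tensor_field_change[OF metric_tensor_field assms]
  by (simp add: det_mul power2_eq_square)

lemma det_coord_jacobian:
  assumes "c \<in> A" "d \<in> A" "p \<in> chart_dom c \<inter> chart_dom d"
  shows "det (coord_jacobian c d p) \<noteq> 0"
  using det_metric_change[OF assms] det_metric_pos[OF assms(1), of p] assms(3) by auto

definition vol_density :: "('m, 'n) chart \<Rightarrow> real^'n \<Rightarrow> real" where
  "vol_density c x = (if x \<in> chart_img c then sqrt (det (g c (chart_inv c x))) else 0)"

lemma vol_density_nonneg: "c \<in> A \<Longrightarrow> 0 \<le> vol_density c x"
  using det_metric_pos[OF _ chart_inv_in_dom] by (simp add: vol_density_def less_imp_le)

lemma vol_density_pos: "c \<in> A \<Longrightarrow> x \<in> chart_img c \<Longrightarrow> 0 < vol_density c x"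
  using det_metric_pos[OF _ chart_inv_in_dom] by (simp add: vol_density_def)

lemma C_k_on_det_metric:
  assumes "c \<in> A"
  shows "C_k_on k (chart_img c) (\<lambda>x. det (g c (chart_inv c x)))"
  by (rule C_k_on_det[OF open_chart_img[OF assms] C_k_on_tensor_components[OF metric_tensor_field assms]])

lemma continuous_vol_density:
  assumes "c \<in> A"
  shows "continuous_on (chart_img c) (vol_density c)"
proof -
  have "continuous_on (chart_img c) (\<lambda>x. sqrt (det (g c (chart_inv c x))))"
    by (rule continuous_on_real_sqrt[OF C_k_on_continuous[OF C_k_on_det_metric[OF assms]]])
  then show ?thesis by (rule continuous_on_eq) (simp add: vol_density_def)
qed

lemma borel_measurable_vol_density:
  assumes "c \<in> A"
  shows "vol_density c \<in> borel_measurable borel"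
proof -
  have "(\<lambda>x. if x \<in> chart_img c then vol_density c x else 0) \<in> borel_measurable borel"
    by (rule borel_measurable_continuous_on_if[OF _ continuous_vol_density[OF assms] continuous_on_const])
      (simp add: open_chart_img[OF assms])
  moreover have "(\<lambda>x. if x \<in> chart_img c then vol_density c x else 0) = vol_density c"
    by (rule ext) (simp add: vol_density_def)
  ultimately show ?thesis by (simp only:)
qed

lemma vol_density_change:
  assumes "c \<in> A" "d \<in> A" "p \<in> chart_dom c \<inter> chart_dom d"
  shows "vol_density c (chart_map c p) = \<bar>det (coord_jacobian c d p)\<bar> * vol_density d (chart_map d p)"
  using assms det_metric_change[OF assms]
  by (simp add: vol_density_def chart_map_in_img chart_inv_map real_sqrt_mult)

text \<open>The inverse of the chart, made a function on the whole coordinate space so that an image measure can be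
  formed; its value off the chart image carries no mass.\<close>

definition chart_point :: "('m, 'n) chart \<Rightarrow> real^'n \<Rightarrow> 'm" where
  "chart_point c x = (if x \<in> chart_img c then chart_inv c x else undefined)"

lemma borel_measurable_chart_point:
  assumes "c \<in> A"
  shows "chart_point c \<in> borel_measurable borel"
  unfolding chart_point_def
  by (rule borel_measurable_continuous_on_if[OF _ continuous_chart_inv[OF assms] continuous_on_const])
    (simp add: open_chart_img[OF assms])

definition chart_volume :: "('m, 'n) chart \<Rightarrow> 'm measure" where
  "chart_volume c = distr (density lborel (\<lambda>x. ennreal (vol_density c x))) borel (chart_point c)"

lemma sets_chart_volume: "sets (chart_volume c) = sets borel"
  by (simp add: chart_volume_def)

lemma sets_chart_map_image:
  assumes c: "c \<in> A" and B: "B \<in> sets borel" "B \<subseteq> chart_dom c"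
  shows "chart_map c ` B \<in> sets borel"
proof -
  have "chart_map c ` B = chart_img c \<inter> chart_point c -` B"
    unfolding chart_map_image[OF c B(2)] by (auto simp: chart_point_def)
  moreover have "chart_point c -` B \<in> sets borel"
    using measurable_sets[OF borel_measurable_chart_point[OF c] B(1)] by simp
  ultimately show ?thesis using open_chart_img[OF c] by auto
qed

lemma sets_chart_dom: "c \<in> A \<Longrightarrow> chart_dom c \<in> sets borel"
  by (rule borel_open[OF open_chart_dom])

lemma emeasure_chart_volume:
  assumes c: "c \<in> A" and B: "B \<in> sets borel"
  shows "emeasure (chart_volume c) B = (\<integral>\<^sup>+x\<in>chart_map c ` (B \<inter> chart_dom c). ennreal (vol_density c x) \<partial>lborel)"
proof -
  note [measurable] = borel_measurable_vol_density[OF c] borel_measurable_chart_point[OF c] B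
  have "emeasure (chart_volume c) B =
      emeasure (density lborel (\<lambda>x. ennreal (vol_density c x))) (chart_point c -` B)"
    unfolding chart_volume_def using borel_measurable_chart_point[OF c] B by (subst emeasure_distr) simp_all
  also have "\<dots> = (\<integral>\<^sup>+x. ennreal (vol_density c x) * indicator (chart_point c -` B) x \<partial>lborel)"
    using measurable_sets[OF borel_measurable_chart_point[OF c] B] by (subst emeasure_density) simp_all
  also have "\<dots> = (\<integral>\<^sup>+x\<in>chart_map c ` (B \<inter> chart_dom c). ennreal (vol_density c x) \<partial>lborel)"
  proof (rule nn_integral_cong)
    fix x
    show "ennreal (vol_density c x) * indicator (chart_point c -` B) x =
        ennreal (vol_density c x) * indicator (chart_map c ` (B \<inter> chart_dom c)) x"
    proof (cases "x \<in> chart_img c")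
      case True
      then have "x \<in> chart_point c -` B \<longleftrightarrow> x \<in> chart_map c ` (B \<inter> chart_dom c)"
        unfolding chart_map_image[OF c Int_lower2] using chart_inv_in_dom[OF c] by (auto simp: chart_point_def)
      then show ?thesis by (simp only: indicator_def)
    qed (simp add: vol_density_def)
  qed
  finally show ?thesis .
qed

lemma emeasure_chart_volume_eq_integral:
  assumes c: "c \<in> A" and B: "B \<in> sets borel" "B \<subseteq> chart_dom c"
  shows "emeasure (chart_volume c) B =
    (\<integral>\<^sup>+x\<in>chart_map c ` B. ennreal (sqrt (det (g c (chart_inv c x)))) \<partial>lborel)"
proof -
  have "B \<inter> chart_dom c = B" using B(2) by blast
  then have "emeasure (chart_volume c) B = (\<integral>\<^sup>+x\<in>chart_map c ` B. ennreal (vol_density c x) \<partial>lborel)"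
    using emeasure_chart_volume[OF c B(1)] by (simp only:)
  also have "\<dots> = (\<integral>\<^sup>+x\<in>chart_map c ` B. ennreal (sqrt (det (g c (chart_inv c x)))) \<partial>lborel)"
    using B(2) by (intro nn_integral_cong) (auto simp: vol_density_def chart_img_def indicator_def)
  finally show ?thesis .
qed

text \<open>On overlaps the volumes of two charts agree by the change of variables formula.  It is applied
  where both the coordinates and the density are bounded, so that all integrals are finite.\<close>

lemma chart_volume_overlap:
  assumes c: "c \<in> A" and d: "d \<in> A" and B: "B \<in> sets borel" "B \<subseteq> chart_dom c \<inter> chart_dom d"
  shows "emeasure (chart_volume c) B = emeasure (chart_volume d) B"
proof -
  define k where "k p = (if p \<in> chart_dom c then norm (chart_map c p) + vol_density c (chart_map c p) else 0)" for p
  have vd: "continuous_on (chart_dom c) (\<lambda>p. vol_density c (chart_map c p))"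
    by (rule continuous_on_compose2[OF continuous_vol_density[OF c] continuous_chart_map[OF c]])
      (use chart_map_in_img[OF c] in auto)
  have k: "k \<in> borel_measurable borel"
    unfolding k_def
    by (rule borel_measurable_continuous_on_if[OF sets_chart_dom[OF c] continuous_on_add[OF
        continuous_on_norm[OF continuous_chart_map[OF c]] vd] continuous_on_const])
  define b where "b n = B \<inter> {p. k p \<le> real n}" for n
  have b_sets: "b n \<in> sets borel" for n
  proof -
    have "{p \<in> space borel. k p \<le> real n} \<in> sets borel" using k by measurable
    then show ?thesis unfolding b_def using B(1) by auto
  qed
  have b_sub: "b n \<subseteq> chart_dom c" "b n \<subseteq> chart_dom d" for n using B(2) by (auto simp: b_def)
  have eq: "emeasure (chart_volume c) (b n) = emeasure (chart_volume d) (b n)" for n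
  proof -
    let ?S = "chart_map c ` b n"
    have image: "transition c d ` ?S = chart_map d ` b n"
      unfolding image_image
      by (rule image_cong[OF refl]) (rule transition_map[OF c d], use b_sub(1) in blast)
    have "(\<integral>\<^sup>+y\<in>transition c d ` ?S. ennreal (vol_density d y) \<partial>lborel) =
        (\<integral>\<^sup>+x\<in>?S. ennreal (vol_density c x) \<partial>lborel)"
    proof (rule nn_integral_change_of_variables[where T' = "\<lambda>x v. coord_jacobian c d (chart_inv c x) *v v"])
      show "?S \<in> sets borel" by (rule sets_chart_map_image[OF c b_sets b_sub(1)])
      show "transition c d ` ?S \<in> sets borel"
        unfolding image by (rule sets_chart_map_image[OF d b_sets b_sub(2)])
      show "vol_density c \<in> borel_measurable borel" "vol_density d \<in> borel_measurable borel"
        by (rule borel_measurable_vol_density[OF c], rule borel_measurable_vol_density[OF d])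
      show "inj_on (transition c d) ?S"
      proof (rule inj_onI)
        fix x y assume "x \<in> ?S" "y \<in> ?S" and eq: "transition c d x = transition c d y"
        then obtain p q where p: "p \<in> b n" "x = chart_map c p" and q: "q \<in> b n" "y = chart_map c q" by blast
        have "p \<in> chart_dom c" "p \<in> chart_dom d" "q \<in> chart_dom c" "q \<in> chart_dom d" using b_sub p q by auto
        moreover from this have "chart_map d p = chart_map d q"
          using eq p q transition_map[OF c d] by simp
        ultimately have "p = q" using chart_inv_map[OF d] by metis
        then show "x = y" using p q by simp
      qed
      show "0 \<le> vol_density d y" for y by (rule vol_density_nonneg[OF d])
      fix x assume "x \<in> ?S"
      then obtain p where p: "p \<in> b n" "x = chart_map c p" by blast
      then have dom: "p \<in> chart_dom c \<inter> chart_dom d" using b_sub by auto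
      have inv: "chart_inv c x = p" using p dom chart_inv_map[OF c] by simp
      show "(transition c d has_derivative (\<lambda>v. coord_jacobian c d (chart_inv c x) *v v)) (at x)"
        unfolding inv unfolding p(2) by (rule transition_has_derivative[OF c d dom])
      have "transition c d x = chart_map d p" using p dom transition_map[OF c d] by simp
      then show "vol_density c x = \<bar>det (matrix (\<lambda>v. coord_jacobian c d (chart_inv c x) *v v))\<bar> *
          vol_density d (transition c d x)"
        unfolding inv using vol_density_change[OF c d dom] p(2) by simp
    next
      have "(\<integral>\<^sup>+x\<in>?S. ennreal (vol_density c x) \<partial>lborel) \<le>
          (\<integral>\<^sup>+x. ennreal (real n) * indicator (cball (0::real^'n) (real n)) x \<partial>lborel)"
      proof (rule nn_integral_mono)
        fix x
        have "norm x \<le> real n \<and> vol_density c x \<le> real n" if x: "x \<in> ?S"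
        proof -
          obtain p where p: "p \<in> b n" "x = chart_map c p" using x by blast
          then have "norm x + vol_density c x \<le> real n"
            using b_sub(1)[of n] by (auto simp: b_def k_def)
          then show ?thesis using vol_density_nonneg[OF c, of x] norm_ge_zero[of x] by linarith
        qed
        then show "ennreal (vol_density c x) * indicator ?S x \<le> ennreal (real n) * indicator (cball 0 (real n)) x"
          by (cases "x \<in> ?S") (auto intro: ennreal_leI simp: indicator_def)
      qed
      also have "\<dots> = ennreal (real n) * emeasure lborel (cball (0::real^'n) (real n))"
        by (rule nn_integral_cmult_indicator) simp
      also have "\<dots> < \<infinity>"
        using emeasure_bounded_finite[OF bounded_cball[of "0::real^'n" "real n"]]
        by (simp add: ennreal_mult_less_top)
      finally show "(\<integral>\<^sup>+x\<in>?S. ennreal (vol_density c x) \<partial>lborel) < \<infinity>" .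
    qed
    moreover have "b n \<inter> chart_dom c = b n" "b n \<inter> chart_dom d = b n" using b_sub by blast+
    ultimately show ?thesis
      unfolding image emeasure_chart_volume[OF c b_sets] emeasure_chart_volume[OF d b_sets] by (simp only:)
  qed
  have "incseq b" by (rule incseq_SucI) (auto simp: b_def)
  have "(\<Union>n. b n) = B"
  proof -
    have "\<exists>n. k p \<le> real n" for p by (rule real_arch_simple)
    then show ?thesis by (auto simp: b_def)
  qed
  have "(\<lambda>n. emeasure (chart_volume e) (b n)) \<longlonglongrightarrow> emeasure (chart_volume e) B" for e
    using Lim_emeasure_incseq[of b "chart_volume e", OF _ \<open>incseq b\<close>] b_sets
    unfolding \<open>(\<Union>n. b n) = B\<close> by (auto simp: sets_chart_volume)
  from this[of c] this[of d] show ?thesis unfolding eq by (rule LIMSEQ_unique)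
qed

lemma is_riemannian_volume_iff:
  "is_riemannian_volume A g \<mu> \<longleftrightarrow> sets \<mu> = sets borel \<and>
    (\<forall>c\<in>A. \<forall>B\<in>sets borel. B \<subseteq> chart_dom c \<longrightarrow> emeasure \<mu> B = emeasure (chart_volume c) B)"
  unfolding is_riemannian_volume_def using emeasure_chart_volume_eq_integral by auto

text \<open>Weighting by the indicator function restricts a measure to \<open>U\<close>, and the integral of a function that
  vanishes outside \<open>U\<close> only sees this restriction.\<close>

lemma density_indicator_eqI:
  fixes \<mu> \<nu> :: "'m measure"
  assumes sets: "sets \<mu> = sets borel" "sets \<nu> = sets borel" and U: "U \<in> sets borel"
    and eq: "\<And>B. B \<in> sets borel \<Longrightarrow> B \<subseteq> U \<Longrightarrow> emeasure \<mu> B = emeasure \<nu> B"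
  shows "density \<mu> (\<lambda>x. ennreal (indicator U x)) = density \<nu> (\<lambda>x. ennreal (indicator U x))"
proof -
  have emeas: "emeasure (density M (\<lambda>x. ennreal (indicator U x))) B = emeasure M (B \<inter> U)"
    if M: "sets M = sets borel" and B: "B \<in> sets borel" for M :: "'m measure" and B
  proof -
    have "(\<lambda>x. ennreal (indicator U x)) \<in> borel_measurable M"
      using U by (simp add: M measurable_cong_sets[OF M refl])
    then have "emeasure (density M (\<lambda>x. ennreal (indicator U x))) B = (\<integral>\<^sup>+x. ennreal (indicator U x) * indicator B x \<partial>M)"
      using B by (intro emeasure_density) (simp_all add: M)
    also have "\<dots> = (\<integral>\<^sup>+x. indicator (B \<inter> U) x \<partial>M)"
      by (intro nn_integral_cong) (auto simp: indicator_def)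
    also have "\<dots> = emeasure M (B \<inter> U)"
      using B U by (intro nn_integral_indicator) (simp add: M)
    finally show ?thesis .
  qed
  show ?thesis
  proof (rule measure_eqI)
    fix B assume "B \<in> sets (density \<mu> (\<lambda>x. ennreal (indicator U x)))"
    then have B: "B \<in> sets borel" by (simp add: sets)
    have "emeasure \<mu> (B \<inter> U) = emeasure \<nu> (B \<inter> U)" using B U by (intro eq) auto
    then show "emeasure (density \<mu> (\<lambda>x. ennreal (indicator U x))) B = emeasure (density \<nu> (\<lambda>x. ennreal (indicator U x))) B"
      by (simp only: emeas[OF sets(1) B] emeas[OF sets(2) B])
  qed (simp add: sets)
qed

lemma nn_integral_eq_if_emeasure_eq:
  fixes \<mu> \<nu> :: "'m measure" and f :: "'m \<Rightarrow> ennreal"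
  assumes sets: "sets \<mu> = sets borel" "sets \<nu> = sets borel" and U: "U \<in> sets borel"
    and eq: "\<And>B. B \<in> sets borel \<Longrightarrow> B \<subseteq> U \<Longrightarrow> emeasure \<mu> B = emeasure \<nu> B"
    and f: "f \<in> borel_measurable borel" and zero: "\<And>x. x \<notin> U \<Longrightarrow> f x = 0"
  shows "integral\<^sup>N \<mu> f = integral\<^sup>N \<nu> f"
proof -
  have dens: "integral\<^sup>N M f = integral\<^sup>N (density M (\<lambda>x. ennreal (indicator U x))) f"
    if M: "sets M = sets borel" for M :: "'m measure"
  proof -
    have meas: "f \<in> borel_measurable M" "(\<lambda>x. ennreal (indicator U x)) \<in> borel_measurable M"
      using f U by (simp_all add: M measurable_cong_sets[OF M refl])
    have "integral\<^sup>N (density M (\<lambda>x. ennreal (indicator U x))) f = (\<integral>\<^sup>+x. ennreal (indicator U x) * f x \<partial>M)"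
      by (rule nn_integral_density[OF meas(2) meas(1)])
    also have "\<dots> = integral\<^sup>N M f"
      using zero by (intro nn_integral_cong) (auto simp: indicator_def)
    finally show ?thesis ..
  qed
  show ?thesis
    unfolding dens[OF sets(1)] dens[OF sets(2)] by (simp only: density_indicator_eqI[OF sets U eq])
qed

lemma integral_eq_if_emeasure_eq:
  fixes \<mu> \<nu> :: "'m measure" and f :: "'m \<Rightarrow> real"
  assumes sets: "sets \<mu> = sets borel" "sets \<nu> = sets borel" and U: "U \<in> sets borel"
    and eq: "\<And>B. B \<in> sets borel \<Longrightarrow> B \<subseteq> U \<Longrightarrow> emeasure \<mu> B = emeasure \<nu> B"
    and f: "f \<in> borel_measurable borel" and zero: "\<And>x. x \<notin> U \<Longrightarrow> f x = 0"
  shows "integral\<^sup>L \<mu> f = integral\<^sup>L \<nu> f"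
proof -
  have dens: "integral\<^sup>L M f = integral\<^sup>L (density M (\<lambda>x. ennreal (indicator U x))) f"
    if M: "sets M = sets borel" for M :: "'m measure"
  proof -
    have meas: "f \<in> borel_measurable M" "indicator U \<in> borel_measurable M"
      using f U by (simp_all add: M measurable_cong_sets[OF M refl])
    have "integral\<^sup>L (density M (\<lambda>x. ennreal (indicator U x))) f = (\<integral>x. indicator U x *\<^sub>R f x \<partial>M)"
      by (rule integral_density[OF meas]) simp
    also have "\<dots> = integral\<^sup>L M f"
      using zero by (intro Bochner_Integration.integral_cong) (auto simp: indicator_def)
    finally show ?thesis ..
  qed
  show ?thesis
    unfolding dens[OF sets(1)] dens[OF sets(2)] by (simp only: density_indicator_eqI[OF sets U eq])
qed

text \<open>With a partition of unity subordinate to finitely many charts, the volume measure of a set is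
  the sum of the weighted volumes computed in these charts.  The formula gives both existence and
  uniqueness.\<close>

lemma is_riemannian_volume_unique_exists: "\<exists>!\<mu>. is_riemannian_volume A g \<mu>"
proof (rule partition_of_unity)
  fix P :: "'m set" and \<rho> :: "'m \<Rightarrow> 'm \<Rightarrow> real" and K
  assume P: "finite P"
    and K: "\<And>p. p \<in> P \<Longrightarrow> compact (K p)" "\<And>p. p \<in> P \<Longrightarrow> K p \<subseteq> chart_dom (chart_at A p)"
    and nonneg: "\<And>p x. p \<in> P \<Longrightarrow> 0 \<le> \<rho> p x" and zero: "\<And>p x. p \<in> P \<Longrightarrow> x \<notin> K p \<Longrightarrow> \<rho> p x = 0"
    and C1: "\<And>p d. p \<in> P \<Longrightarrow> d \<in> A \<Longrightarrow> C1_in_chart d (\<rho> p)" and sum1: "\<And>x. (\<Sum>p\<in>P. \<rho> p x) = 1"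
  have \<rho>_meas: "\<rho> p \<in> borel_measurable borel" if "p \<in> P" for p
    by (rule borel_measurable_continuous_onI[OF continuous_on_manifold[OF C1_in_chart_continuous[OF _ C1[OF that]]]])
  define w where "w p B x = ennreal (\<rho> p x) * indicator B x" for p x and B :: "'m set"
  have w_meas: "w p B \<in> borel_measurable borel" if "p \<in> P" "B \<in> sets borel" for p B
    unfolding w_def using \<rho>_meas[OF that(1)] that(2) by measurable
  have sum_w: "(\<Sum>p\<in>P. integral\<^sup>N M (w p B)) = emeasure M B"
    if M: "sets M = sets borel" and B: "B \<in> sets borel" for M :: "'m measure" and B
  proof -
    have "(\<Sum>p\<in>P. integral\<^sup>N M (w p B)) = (\<integral>\<^sup>+x. (\<Sum>p\<in>P. w p B x) \<partial>M)"
      using w_meas[OF _ B] measurable_cong_sets[OF M refl] by (intro nn_integral_sum[symmetric]) blast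
    also have "\<dots> = (\<integral>\<^sup>+x. indicator B x \<partial>M)"
    proof (rule nn_integral_cong)
      fix x
      have "(\<Sum>p\<in>P. ennreal (\<rho> p x)) = ennreal (\<Sum>p\<in>P. \<rho> p x)" using nonneg by (rule sum_ennreal)
      then show "(\<Sum>p\<in>P. w p B x) = indicator B x"
        by (simp add: w_def sum_distrib_right[symmetric] sum1)
    qed
    finally show ?thesis using B by (simp add: M)
  qed
  define \<Phi> where "\<Phi> B = (\<Sum>p\<in>P. integral\<^sup>N (chart_volume (chart_at A p)) (w p B))" for B
  define \<mu> where "\<mu> = measure_of UNIV (sets borel) \<Phi>"
  have zero_w: "w p B x = 0" if "p \<in> P" "x \<notin> chart_dom (chart_at A p)" for p B x
  proof -
    have "x \<notin> K p" using that(2) K(2)[OF that(1)] by blast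
    from zero[OF that(1) this] show ?thesis by (simp add: w_def)
  qed
  have sets_\<mu>: "sets \<mu> = sets borel"
    unfolding \<mu>_def using sets.sigma_sets_eq[of borel] by (simp add: sets_measure_of_conv)
  have \<mu>: "emeasure \<mu> B = \<Phi> B" if "B \<in> sets borel" for B
  proof (rule emeasure_measure_of[OF \<mu>_def])
    show "positive (sets \<mu>) \<Phi>"
    proof -
      have "w p {} = (\<lambda>x. 0)" for p by (rule ext) (simp add: w_def)
      then show ?thesis by (simp add: positive_def \<Phi>_def)
    qed
    show "countably_additive (sets \<mu>) \<Phi>"
      unfolding sets_\<mu>
    proof (rule countably_additiveI)
      fix F :: "nat \<Rightarrow> 'm set" assume F: "range F \<subseteq> sets borel" "disjoint_family F"
      have F_i: "F i \<in> sets borel" for i using F(1) by blast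
      have "(\<Sum>i. integral\<^sup>N (chart_volume (chart_at A p)) (w p (F i))) =
          integral\<^sup>N (chart_volume (chart_at A p)) (w p (\<Union>i. F i))" if p: "p \<in> P" for p
      proof -
        let ?M = "chart_volume (chart_at A p)"
        have "(\<Sum>i. integral\<^sup>N ?M (w p (F i))) = (\<integral>\<^sup>+x. (\<Sum>i. w p (F i) x) \<partial>?M)"
          using w_meas[OF p F_i] measurable_cong_sets[OF sets_chart_volume refl]
          by (intro nn_integral_suminf[symmetric]) blast
        also have "\<dots> = integral\<^sup>N ?M (w p (\<Union>i. F i))"
          unfolding w_def by (intro nn_integral_cong) (simp add: suminf_indicator[OF F(2)])
        finally show ?thesis .
      qed
      then show "(\<Sum>i. \<Phi> (F i)) = \<Phi> (\<Union>i. F i)"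
        unfolding \<Phi>_def by (subst suminf_sum) (simp_all add: summableI)
    qed
    show "sets borel \<subseteq> Pow (UNIV :: 'm set)" by simp
    show "B \<in> sets \<mu>" using that by (simp only: sets_\<mu>)
  qed
  show ?thesis
  proof (rule ex1I)
    show "is_riemannian_volume A g \<mu>"
      unfolding is_riemannian_volume_iff
    proof (intro conjI ballI impI)
      show "sets \<mu> = sets borel" by (rule sets_\<mu>)
      fix c and B :: "'m set" assume c: "c \<in> A" and B: "B \<in> sets borel" "B \<subseteq> chart_dom c"
      have "integral\<^sup>N (chart_volume (chart_at A p)) (w p B) = integral\<^sup>N (chart_volume c) (w p B)" if p: "p \<in> P" for p
      proof (rule nn_integral_eq_if_emeasure_eq[OF sets_chart_volume sets_chart_volume])
        let ?U = "chart_dom (chart_at A p) \<inter> chart_dom c"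
        show "?U \<in> sets borel" using sets_chart_dom[OF chart_at(1)] sets_chart_dom[OF c] by blast
        show "emeasure (chart_volume (chart_at A p)) C = emeasure (chart_volume c) C" if "C \<in> sets borel" "C \<subseteq> ?U" for C
          by (rule chart_volume_overlap[OF chart_at(1) c that])
        show "w p B \<in> borel_measurable borel" by (rule w_meas[OF p B(1)])
        show "w p B x = 0" if "x \<notin> ?U" for x
        proof (cases "x \<in> chart_dom c")
          case True
          then show ?thesis using that zero_w[OF p] by blast
        next
          case False
          then have "x \<notin> B" using B(2) by blast
          then show ?thesis by (simp add: w_def)
        qed
      qed
      then have "\<Phi> B = (\<Sum>p\<in>P. integral\<^sup>N (chart_volume c) (w p B))"
        unfolding \<Phi>_def by (rule sum.cong[OF refl])
      also have "\<dots> = emeasure (chart_volume c) B" by (rule sum_w[OF sets_chart_volume B(1)])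
      finally show "emeasure \<mu> B = emeasure (chart_volume c) B" by (simp only: \<mu>[OF B(1)])
    qed
  next
    fix \<nu> assume "is_riemannian_volume A g \<nu>"
    then have sets_\<nu>: "sets \<nu> = sets borel" and
      \<nu>: "\<And>c B. c \<in> A \<Longrightarrow> B \<in> sets borel \<Longrightarrow> B \<subseteq> chart_dom c \<Longrightarrow> emeasure \<nu> B = emeasure (chart_volume c) B"
      unfolding is_riemannian_volume_iff by blast+
    show "\<nu> = \<mu>"
    proof (rule measure_eqI)
      show "sets \<nu> = sets \<mu>" by (simp only: sets_\<mu> sets_\<nu>)
      fix B assume "B \<in> sets \<nu>"
      then have B: "B \<in> sets borel" by (simp only: sets_\<nu>)
      have "integral\<^sup>N \<nu> (w p B) = integral\<^sup>N (chart_volume (chart_at A p)) (w p B)" if p: "p \<in> P" for p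
        by (rule nn_integral_eq_if_emeasure_eq[OF sets_\<nu> sets_chart_volume sets_chart_dom[OF chart_at(1)]
            \<nu>[OF chart_at(1)] w_meas[OF p B] zero_w[OF p]])
      then have "(\<Sum>p\<in>P. integral\<^sup>N \<nu> (w p B)) = \<Phi> B"
        unfolding \<Phi>_def by (rule sum.cong[OF refl])
      then show "emeasure \<nu> B = emeasure \<mu> B" by (simp only: sum_w[OF sets_\<nu> B] \<mu>[OF B])
    qed
  qed
qed

lemma is_riemannian_volume_dvol: "is_riemannian_volume A g (dvol A g)"
  unfolding dvol_def by (rule theI'[OF is_riemannian_volume_unique_exists])

lemma sets_dvol: "sets (dvol A g) = sets borel"
  and emeasure_dvol: "c \<in> A \<Longrightarrow> B \<in> sets borel \<Longrightarrow> B \<subseteq> chart_dom c \<Longrightarrow>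
    emeasure (dvol A g) B = emeasure (chart_volume c) B"
  using is_riemannian_volume_dvol unfolding is_riemannian_volume_iff by blast+

lemma integral_dvol_chart:
  fixes f :: "'m \<Rightarrow> real"
  assumes c: "c \<in> A" and f: "f \<in> borel_measurable borel" and zero: "\<And>p. p \<notin> chart_dom c \<Longrightarrow> f p = 0"
  shows "(LINT p|dvol A g. f p) = (LINT x|lborel. vol_density c x * f (chart_point c x))"
proof -
  have "(LINT p|dvol A g. f p) = (LINT p|chart_volume c. f p)"
    by (rule integral_eq_if_emeasure_eq[OF sets_dvol sets_chart_volume sets_chart_dom[OF c] emeasure_dvol[OF c] f zero])
  also have "\<dots> = (LINT x|density lborel (\<lambda>x. ennreal (vol_density c x)). f (chart_point c x))"
    unfolding chart_volume_def using borel_measurable_chart_point[OF c] f by (intro integral_distr) simp_all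
  also have "\<dots> = (LINT x|lborel. vol_density c x *\<^sub>R f (chart_point c x))"
    using borel_measurable_vol_density[OF c] vol_density_nonneg[OF c]
      measurable_compose[OF borel_measurable_chart_point[OF c] f]
    by (intro integral_density) simp_all
  finally show ?thesis by simp
qed

lemma dvol_compact_finite:
  assumes c: "c \<in> A" and K: "compact K" "K \<subseteq> chart_dom c"
  shows "emeasure (dvol A g) K < \<infinity>"
proof -
  have K_sets: "K \<in> sets borel" using compact_imp_closed[OF K(1)] by (rule borel_closed)
  have comp: "compact (chart_map c ` K)"
    by (rule compact_continuous_image[OF continuous_on_subset[OF continuous_chart_map[OF c] K(2)] K(1)])
  have sub: "chart_map c ` K \<subseteq> chart_img c" using K(2) by (auto simp: chart_img_def)
  have "bounded (vol_density c ` (chart_map c ` K))"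
    by (rule compact_imp_bounded[OF compact_continuous_image[OF continuous_on_subset[OF continuous_vol_density[OF c] sub] comp]])
  then obtain C where C: "\<And>x. x \<in> chart_map c ` K \<Longrightarrow> \<bar>vol_density c x\<bar> \<le> C"
    unfolding bounded_iff by auto
  have "K \<inter> chart_dom c = K" using K(2) by blast
  then have "emeasure (dvol A g) K = (\<integral>\<^sup>+x\<in>chart_map c ` K. ennreal (vol_density c x) \<partial>lborel)"
    using emeasure_dvol[OF c K_sets K(2)] emeasure_chart_volume[OF c K_sets] by (simp only:)
  also have "\<dots> \<le> (\<integral>\<^sup>+x. ennreal C * indicator (chart_map c ` K) x \<partial>lborel)"
    using C[THEN abs_le_D1] by (intro nn_integral_mono) (auto intro!: ennreal_leI simp: indicator_def)
  also have "\<dots> = ennreal C * emeasure lborel (chart_map c ` K)"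
    using borel_closed[OF compact_imp_closed[OF comp]] by (intro nn_integral_cmult_indicator) simp
  also have "\<dots> < \<infinity>"
    using emeasure_bounded_finite[OF compact_imp_bounded[OF comp]] by (simp add: ennreal_mult_less_top)
  finally show ?thesis .
qed

text \<open>Each piece of a partition of unity is supported in a compact subset of a chart domain, and such sets
  have finite volume because the density is bounded on them.\<close>

lemma finite_measure_dvol: "finite_measure (dvol A g)"
proof (rule partition_of_unity)
  fix P :: "'m set" and \<rho> :: "'m \<Rightarrow> 'm \<Rightarrow> real" and K
  assume P: "finite P"
    and K: "\<And>p. p \<in> P \<Longrightarrow> compact (K p)" "\<And>p. p \<in> P \<Longrightarrow> K p \<subseteq> chart_dom (chart_at A p)"
    and zero: "\<And>p x. p \<in> P \<Longrightarrow> x \<notin> K p \<Longrightarrow> \<rho> p x = 0" and sum1: "\<And>x. (\<Sum>p\<in>P. \<rho> p x) = 1"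
  have "UNIV \<subseteq> (\<Union>p\<in>P. K p)"
  proof
    fix x
    have "\<exists>p\<in>P. x \<in> K p"
    proof (rule ccontr)
      assume "\<not> (\<exists>p\<in>P. x \<in> K p)"
      then have "(\<Sum>p\<in>P. \<rho> p x) = 0" using zero by (intro sum.neutral) blast
      then show False using sum1[of x] by simp
    qed
    then show "x \<in> (\<Union>p\<in>P. K p)" by blast
  qed
  moreover have K_sets: "K p \<in> sets (dvol A g)" if "p \<in> P" for p
    unfolding sets_dvol using compact_imp_closed[OF K(1)[OF that]] by (rule borel_closed)
  ultimately have "emeasure (dvol A g) UNIV \<le> emeasure (dvol A g) (\<Union>p\<in>P. K p)"
    by (intro emeasure_mono sets.finite_UN P)
  also have "\<dots> \<le> (\<Sum>p\<in>P. emeasure (dvol A g) (K p))"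
    using K_sets by (intro emeasure_subadditive_finite P) blast
  also have "\<dots> < \<infinity>"
    using dvol_compact_finite[OF chart_at(1) K] P by simp
  finally have "emeasure (dvol A g) UNIV \<noteq> \<infinity>" by simp
  moreover have "space (dvol A g) = UNIV" using sets_eq_imp_space_eq[OF sets_dvol] by simp
  ultimately show ?thesis by (intro finite_measureI) simp
qed

lemma integrable_dvol_continuous:
  fixes f :: "'m \<Rightarrow> real"
  assumes "continuous_on UNIV f"
  shows "integrable (dvol A g) f"
proof -
  interpret finite_measure "dvol A g" by (rule finite_measure_dvol)
  have "bounded (range f)"
    by (rule compact_imp_bounded[OF compact_continuous_image[OF assms compact_UNIV]])
  then obtain C where C: "\<And>x. norm (f x) \<le> C" unfolding bounded_iff by auto
  have "f \<in> borel_measurable (dvol A g)"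
    using borel_measurable_continuous_onI[OF assms] measurable_cong_sets[OF sets_dvol refl] by blast
  then show ?thesis using C by (intro integrable_const_bound[of _ C]) simp_all
qed

text \<open>The density is positive, so open sets have positive volume.\<close>

lemma integral_dvol_eq_0_imp:
  fixes f :: "'m \<Rightarrow> real"
  assumes f: "continuous_on UNIV f" and nonneg: "\<And>x. 0 \<le> f x" and int: "(LINT x|dvol A g. f x) = 0"
  shows "f p = 0"
proof (rule ccontr)
  assume "f p \<noteq> 0"
  define c where "c = chart_at A p"
  have c: "c \<in> A" "p \<in> chart_dom c" unfolding c_def by (rule chart_at)+
  define U where "U = chart_dom c \<inter> {x. 0 < f x}"
  have U: "open U" "U \<subseteq> chart_dom c" "p \<in> U"
    unfolding U_def using c nonneg[of p] \<open>f p \<noteq> 0\<close>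
    by (auto intro!: open_Int open_chart_dom open_Collect_less continuous_on_const f)
  have "AE x in dvol A g. f x = 0"
    using integral_nonneg_eq_0_iff_AE[OF integrable_dvol_continuous[OF f]] nonneg int by simp
  then have "AE x in dvol A g. x \<notin> U" by (rule AE_mp) (simp add: U_def)
  moreover have "U \<in> sets (dvol A g)" unfolding sets_dvol by (rule borel_open[OF U(1)])
  ultimately have "emeasure (dvol A g) U = 0"
    using AE_iff_measurable[of U "dvol A g" "\<lambda>x. x \<notin> U"] sets_eq_imp_space_eq[OF sets_dvol] by simp
  moreover have "emeasure (dvol A g) U = (\<integral>\<^sup>+x\<in>chart_map c ` U. ennreal (vol_density c x) \<partial>lborel)"
  proof -
    have "U \<inter> chart_dom c = U" using U(2) by blast
    then show ?thesis
      using emeasure_dvol[OF c(1) borel_open[OF U(1)] U(2)] emeasure_chart_volume[OF c(1) borel_open[OF U(1)]] by (simp only:)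
  qed
  moreover have openU: "open (chart_map c ` U)" by (rule open_chart_map_image[OF c(1) U(1,2)])
  ultimately have "AE x in lborel. ennreal (vol_density c x) * indicator (chart_map c ` U) x = 0"
    using borel_measurable_vol_density[OF c(1)] by (subst nn_integral_0_iff_AE[symmetric]) auto
  then have "AE x in lborel. x \<notin> chart_map c ` U"
  proof (rule AE_mp, intro AE_I2 impI notI)
    fix x assume "ennreal (vol_density c x) * indicator (chart_map c ` U) x = 0" and x: "x \<in> chart_map c ` U"
    moreover have "x \<in> chart_img c" using x U(2) by (auto simp: chart_img_def)
    ultimately show False using vol_density_pos[OF c(1), of x] by simp
  qed
  then have "emeasure lborel (chart_map c ` U) = 0"
    using AE_iff_measurable[of "chart_map c ` U" lborel "\<lambda>x. x \<notin> chart_map c ` U"] openU by simp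
  then have "chart_map c ` U \<in> null_sets lebesgue"
    using openU by (intro null_sets_completionI) auto
  then have "negligible (chart_map c ` U)" by (simp only: negligible_iff_null_sets)
  then show False using open_not_negligible[OF openU] U(3) by blast
qed

end

section \<open>Integration by parts\<close>

text \<open>A translation invariant integral kills derivatives: the difference quotients of a compactly
  supported function have integral 0, and they converge boundedly.\<close>

lemma integral_derivative_compact_support:
  fixes F :: "'a::euclidean_space \<Rightarrow> real"
  assumes D: "\<And>x. (F has_derivative F' x) (at x)" and cont: "continuous_on UNIV (\<lambda>x. F' x v)"
    and K: "compact K" and zero: "\<And>x. x \<notin> K \<Longrightarrow> F x = 0"
  shows "(LINT x|lborel. F' x v) = 0"
proof -
  have contF: "continuous_on UNIV F"
    using D has_derivative_continuous by (blast intro: continuous_at_imp_continuous_on)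
  have line: "((\<lambda>t. F (x + t *\<^sub>R v)) has_real_derivative F' (x + t *\<^sub>R v) v) (at t)" for x t
  proof -
    have "((\<lambda>t. x + t *\<^sub>R v) has_derivative (\<lambda>s. s *\<^sub>R v)) (at t)"
      by (auto intro!: derivative_eq_intros)
    from has_derivative_compose[OF this D]
    have "((\<lambda>t. F (x + t *\<^sub>R v)) has_derivative (\<lambda>s. F' (x + t *\<^sub>R v) (s *\<^sub>R v))) (at t)" .
    moreover have "F' (x + t *\<^sub>R v) (s *\<^sub>R v) = F' (x + t *\<^sub>R v) v * s" for s
      using linear_scale[OF has_derivative_linear[OF D]] by (simp add: mult.commute)
    ultimately show ?thesis by (simp add: has_field_derivative_def)
  qed
  have F'_zero: "F' x v = 0" if "x \<notin> K" for x
  proof -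
    have "(F has_derivative (\<lambda>_. 0)) (at x)"
    proof (rule has_derivative_transform_within_open[OF has_derivative_const[of 0]])
      show "open (- K)" using compact_imp_closed[OF K] by (rule open_Compl)
      show "x \<in> - K" using that by simp
      show "0 = F y" if "y \<in> - K" for y using zero that by simp
    qed
    then have "F' x = (\<lambda>_. 0)" by (rule has_derivative_unique[OF D])
    then show ?thesis by simp
  qed
  have "bounded ((\<lambda>x. F' x v) ` K)"
    by (rule compact_imp_bounded[OF compact_continuous_image[OF continuous_on_subset[OF cont] K]]) simp
  then obtain C where "\<And>x. x \<in> K \<Longrightarrow> \<bar>F' x v\<bar> \<le> C" unfolding bounded_iff by auto
  then have C: "\<bar>F' x v\<bar> \<le> max C 0" for x
    using F'_zero[of x] by (cases "x \<in> K") force+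
  \<comment> \<open>A compact set that contains the supports of all difference quotients with step at most 1.\<close>
  define L where "L = (\<lambda>(x, t). x - t *\<^sub>R v) ` (K \<times> {0..1::real})"
  have L: "compact L"
    unfolding L_def case_prod_unfold
    by (intro compact_continuous_image continuous_intros compact_Times K) simp
  have in_L: "x \<in> L" if "x + t *\<^sub>R v \<in> K" "0 \<le> t" "t \<le> 1" for x t
    unfolding L_def using that by (intro image_eqI[of _ _ "(x + t *\<^sub>R v, t)"]) auto
  define h where "h n = inverse (real (Suc n))" for n
  have h: "0 < h n" "h n \<le> 1" for n by (simp_all add: h_def field_simps)
  define s where "s n x = (F (x + h n *\<^sub>R v) - F x) / h n" for n x
  have bound: "norm (s n x) \<le> max C 0 * indicator L x" for n x
  proof (cases "x \<in> L")
    case True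
    obtain z where "F (x + h n *\<^sub>R v) - F (x + 0 *\<^sub>R v) = (h n - 0) * F' (x + z *\<^sub>R v) v"
      using MVT2[OF h(1)[of n], of "\<lambda>t. F (x + t *\<^sub>R v)" "\<lambda>t. F' (x + t *\<^sub>R v) v"] line by blast
    then have "s n x = F' (x + z *\<^sub>R v) v" using h(1)[of n] by (simp add: s_def)
    then show ?thesis using C True by simp
  next
    case False
    then have "x + h n *\<^sub>R v \<notin> K" "x + 0 *\<^sub>R v \<notin> K"
      using in_L[of x "h n"] in_L[of x 0] h[of n] by (metis less_imp_le, fastforce)
    then show ?thesis using False zero by (simp add: s_def)
  qed
  have int_F: "integrable lborel F"
  proof -
    have "integrable lborel (\<lambda>x. indicator K x *\<^sub>R F x)"
      by (rule borel_integrable_compact[OF K continuous_on_subset[OF contF]]) simp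
    moreover have "(\<lambda>x. indicator K x *\<^sub>R F x) = F"
    proof
      fix x show "indicator K x *\<^sub>R F x = F x" by (cases "x \<in> K") (simp_all add: zero)
    qed
    ultimately show ?thesis by (simp only:)
  qed
  have F_meas: "F \<in> borel_measurable borel" using contF by (rule borel_measurable_continuous_onI)
  have shift_meas: "(+) a \<in> borel_measurable borel" for a :: 'a by measurable
  have trans: "(LINT x|lborel. F (a + x)) = (LINT x|lborel. F x)" "integrable lborel (\<lambda>x. F (a + x))" for a
  proof -
    have "(LINT x|lborel. F x) = (LINT x|distr lborel borel ((+) a). F x)" by (simp only: lborel_distr_plus)
    also have "\<dots> = (LINT x|lborel. F (a + x))" using F_meas shift_meas by (intro integral_distr) simp_all
    finally show "(LINT x|lborel. F (a + x)) = (LINT x|lborel. F x)" ..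
    have "integrable (distr lborel borel ((+) a)) F" using int_F by (simp only: lborel_distr_plus)
    then show "integrable lborel (\<lambda>x. F (a + x))"
      by (subst (asm) integrable_distr_eq) (use F_meas shift_meas in simp_all)
  qed
  have s_zero: "(LINT x|lborel. s n x) = 0" for n
  proof -
    have "(LINT x|lborel. s n x) = (LINT x|lborel. (F (h n *\<^sub>R v + x) - F x) / h n)"
      by (simp only: s_def add.commute)
    also have "\<dots> = (LINT x|lborel. F (h n *\<^sub>R v + x) - F x) / h n" by (rule integral_divide_zero)
    also have "(LINT x|lborel. F (h n *\<^sub>R v + x) - F x) = (LINT x|lborel. F (h n *\<^sub>R v + x)) - (LINT x|lborel. F x)"
      by (rule Bochner_Integration.integral_diff[OF trans(2) int_F])
    finally show ?thesis by (simp only: trans(1)) simp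
  qed
  have "(\<lambda>n. LINT x|lborel. s n x) \<longlonglongrightarrow> (LINT x|lborel. F' x v)"
  proof (rule integral_dominated_convergence)
    show "(\<lambda>x. F' x v) \<in> borel_measurable lborel"
      using borel_measurable_continuous_onI[OF cont] by simp
    have "(\<lambda>x. (F (h n *\<^sub>R v + x) - F x) / h n) \<in> borel_measurable borel" for n
      using measurable_compose[OF shift_meas F_meas] F_meas
      by (intro borel_measurable_divide borel_measurable_diff borel_measurable_const)
    then show "s n \<in> borel_measurable lborel" for n
      unfolding s_def by (simp add: add.commute)
    show "integrable lborel (\<lambda>x. max C 0 * indicator L x)"
      using borel_closed[OF compact_imp_closed[OF L]] emeasure_bounded_finite[OF compact_imp_bounded[OF L]]
      by (intro integrable_mult_right) (simp add: integrable_indicator_iff)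
    show "AE x in lborel. norm (s n x) \<le> max C 0 * indicator L x" for n
      by (rule AE_I2) (rule bound)
    show "AE x in lborel. (\<lambda>n. s n x) \<longlonglongrightarrow> F' x v"
    proof (rule AE_I2)
      fix x
      have "((\<lambda>k. (F (x + (0 + k) *\<^sub>R v) - F (x + 0 *\<^sub>R v)) / k) \<longlongrightarrow> F' (x + 0 *\<^sub>R v) v) (at 0)"
        using line[of x 0] unfolding DERIV_def .
      moreover have "filterlim h (at 0) sequentially"
      proof -
        have "h \<longlonglongrightarrow> 0" unfolding h_def by (rule LIMSEQ_inverse_real_of_nat)
        moreover have "\<forall>\<^sub>F n in sequentially. h n \<noteq> 0"
          by (rule always_eventually) (use h(1) in \<open>simp add: less_imp_neq[symmetric]\<close>)
        ultimately show ?thesis by (simp add: filterlim_at)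
      qed
      ultimately show "(\<lambda>n. s n x) \<longlonglongrightarrow> F' x v"
        unfolding s_def using filterlim_compose by fastforce
    qed
  qed
  then show ?thesis using LIMSEQ_unique[OF tendsto_const] unfolding s_zero by metis
qed

lemma C_1_on_sqrt:
  fixes f :: "'a::real_normed_vector \<Rightarrow> real"
  assumes "open S" "C_k_on (Suc 0) S f" "\<And>x. x \<in> S \<Longrightarrow> 0 < f x"
  shows "C_k_on (Suc 0) S (\<lambda>x. sqrt (f x))"
    and "x \<in> S \<Longrightarrow> ((\<lambda>x. sqrt (f x)) has_derivative
      (\<lambda>v. frechet_derivative f (at x) v * (inverse (sqrt (f x)) / 2))) (at x)"
proof -
  show D: "((\<lambda>x. sqrt (f x)) has_derivative
      (\<lambda>v. frechet_derivative f (at x) v * (inverse (sqrt (f x)) / 2))) (at x)" if x: "x \<in> S" for x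
    by (rule has_derivative_real_sqrt[OF assms(3)[OF x] C_k_on_has_derivative[OF assms(2) x]])
  show "C_k_on (Suc 0) S (\<lambda>x. sqrt (f x))"
  proof (rule C_k_onI[OF assms(1) D])
    fix v
    have "continuous_on S (\<lambda>x. frechet_derivative f (at x) v)"
      using C_k_on_frechet_derivative[OF assms(2)] by simp
    moreover have "continuous_on S f" by (rule C_k_on_continuous[OF assms(2)])
    moreover have "sqrt (f x) \<noteq> 0" if "x \<in> S" for x using assms(3)[OF that] by simp
    ultimately show "C_k_on 0 S (\<lambda>x. frechet_derivative f (at x) v * (inverse (sqrt (f x)) / 2))"
      by (simp add: continuous_on_mult continuous_on_divide continuous_on_inverse continuous_on_real_sqrt)
  qed
qed

definition chart_div :: "('m, 'n::finite) tensor2 \<Rightarrow> ('m, 'n) chart \<Rightarrow> ('m, 'n) vfield \<Rightarrow> 'm \<Rightarrow> real" where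
  "chart_div g c Y p = (\<Sum>i\<in>UNIV. nabla_vector g Y c i i p)"

definition metric_partial :: "('m, 'n::finite) tensor2 \<Rightarrow> ('m, 'n) chart \<Rightarrow> 'n \<Rightarrow> 'm \<Rightarrow> real^'n^'n" where
  "metric_partial g c k p = (\<chi> i j. partial c k (\<lambda>y. g c y $ i $ j) p)"

context closed_riemannian_manifold
begin

lemma C1_in_chart_tensor:
  assumes "tensor_field A T" "c \<in> A"
  shows "C1_in_chart c (\<lambda>p. T c p $ i $ j)"
  unfolding C1_in_chart_def o_def by (rule C_k_on_tensor_components[OF assms])

lemma C_k_on_metric_inv:
  assumes c: "c \<in> A"
  shows "C_k_on k (chart_img c) (\<lambda>x. metric_inv g c (chart_inv c x) $ i $ j)"
  unfolding metric_inv_def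
proof (rule C_k_on_matrix_inv[OF open_chart_img[OF c] C_k_on_tensor_components[OF metric_tensor_field c]])
  show "det (g c (chart_inv c x)) \<noteq> 0" if "x \<in> chart_img c" for x
    using det_metric_pos[OF c chart_inv_in_dom[OF c that]] by simp
qed

lemma continuous_metric_inv:
  assumes c: "c \<in> A"
  shows "continuous_on (chart_dom c) (\<lambda>p. metric_inv g c p $ i $ j)"
  using C_k_on_continuous[OF C_k_on_metric_inv[OF c]]
  unfolding continuous_on_chart_iff[OF c, symmetric] o_def .

lemma continuous_partial:
  assumes c: "c \<in> A" and "C1_in_chart c f"
  shows "continuous_on (chart_dom c) (partial c i f)"
  using C1_in_chart_continuous_differential[OF assms, of "axis i 1"]
  unfolding chart_differential_def partial_def[abs_def] .

lemma metric_partial_symmetric: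
  assumes c: "c \<in> A" and p: "p \<in> chart_dom c"
  shows "metric_partial g c k p $ i $ j = metric_partial g c k p $ j $ i"
proof -
  have "((\<lambda>y. g c y $ j $ i) \<circ> chart_inv c has_derivative
      chart_differential c (\<lambda>y. g c y $ i $ j) p) (at (chart_map c p))"
  proof (rule has_derivative_transform_within_open[OF
        C1_in_chart_has_derivative[OF c C1_in_chart_tensor[OF metric_tensor_field c] p] open_chart_img[OF c] chart_map_in_img[OF c p]])
    fix x assume "x \<in> chart_img c"
    then show "((\<lambda>y. g c y $ i $ j) \<circ> chart_inv c) x = ((\<lambda>y. g c y $ j $ i) \<circ> chart_inv c) x"
      using symmetric_matrix_nth[OF metric_symmetric[OF c chart_inv_in_dom[OF c]]] by simp
  qed
  from frechet_derivative_at[OF this]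
  have "chart_differential c (\<lambda>y. g c y $ i $ j) p (axis k 1) = chart_differential c (\<lambda>y. g c y $ j $ i) p (axis k 1)"
    unfolding chart_differential_def[of c "\<lambda>y. g c y $ j $ i"] by (rule fun_cong)
  then show ?thesis
    by (simp add: metric_partial_def partial_def chart_differential_def)
qed

lemma metric_inv_symmetric:
  assumes "c \<in> A" "p \<in> chart_dom c"
  shows "metric_inv g c p $ i $ j = metric_inv g c p $ j $ i"
  unfolding metric_inv_def
  using det_metric_pos[OF assms]
  by (intro symmetric_matrix_nth matrix_inv_symmetric metric_symmetric[OF assms]) simp

lemma christoffel_metric_partial:
  "christoffel g c k i j p = (\<Sum>l\<in>UNIV. 1/2 * metric_inv g c p $ k $ l *
     (metric_partial g c i p $ j $ l + metric_partial g c j p $ i $ l - metric_partial g c l p $ i $ j))"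
  by (simp add: christoffel_def metric_partial_def)

text \<open>Of the three derivatives of the metric in the Christoffel symbol, the first and the last cancel in the
  trace, by symmetry of \<open>g\<close> and its inverse.\<close>

lemma christoffel_contracted:
  assumes "c \<in> A" "p \<in> chart_dom c"
  shows "(\<Sum>i\<in>UNIV. christoffel g c i i k p) = 1/2 * trace (metric_inv g c p ** metric_partial g c k p)"
proof -
  let ?G = "\<lambda>i l. metric_inv g c p $ i $ l" and ?d = "\<lambda>m i j. metric_partial g c m p $ i $ j"
  have "(\<Sum>i\<in>UNIV. christoffel g c i i k p) = (\<Sum>i\<in>UNIV. \<Sum>l\<in>UNIV. 1/2 * (?G i l * ?d i k l))
     + (\<Sum>i\<in>UNIV. \<Sum>l\<in>UNIV. 1/2 * (?G i l * ?d k i l)) - (\<Sum>i\<in>UNIV. \<Sum>l\<in>UNIV. 1/2 * (?G i l * ?d l i k))"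
    unfolding christoffel_metric_partial sum.distrib[symmetric] sum_subtractf[symmetric]
    by (intro sum.cong refl) (simp add: algebra_simps)
  also have "(\<Sum>i\<in>UNIV. \<Sum>l\<in>UNIV. 1/2 * (?G i l * ?d l i k)) = (\<Sum>l\<in>UNIV. \<Sum>i\<in>UNIV. 1/2 * (?G i l * ?d l i k))"
    by (rule sum.swap)
  also have "\<dots> = (\<Sum>i\<in>UNIV. \<Sum>l\<in>UNIV. 1/2 * (?G i l * ?d i k l))"
    by (intro sum.cong refl) (simp only: metric_inv_symmetric[OF assms, of _ l for l] metric_partial_symmetric[OF assms, of _ _ k])
  also have "(\<Sum>i\<in>UNIV. \<Sum>l\<in>UNIV. 1/2 * (?G i l * ?d k i l)) = 1/2 * trace (metric_inv g c p ** metric_partial g c k p)"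
  proof -
    have "(\<Sum>i\<in>UNIV. \<Sum>l\<in>UNIV. 1/2 * (?G i l * ?d k i l)) = (\<Sum>i\<in>UNIV. \<Sum>l\<in>UNIV. 1/2 * (?G i l * ?d k l i))"
      by (intro sum.cong refl) (simp only: metric_partial_symmetric[OF assms, of k])
    then show ?thesis
      by (simp only: trace_def matrix_matrix_mult_def vec_lambda_beta sum_distrib_left)
  qed
  finally show ?thesis by simp
qed

lemma chart_div_trace:
  assumes "c \<in> A" "p \<in> chart_dom c"
  shows "chart_div g c Y p = (\<Sum>i\<in>UNIV. partial c i (\<lambda>y. Y c y $ i) p
    + 1/2 * trace (metric_inv g c p ** metric_partial g c i p) * Y c p $ i)"
proof -
  have "chart_div g c Y p = (\<Sum>i\<in>UNIV. partial c i (\<lambda>y. Y c y $ i) p)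
      + (\<Sum>i\<in>UNIV. \<Sum>k\<in>UNIV. christoffel g c i i k p * Y c p $ k)"
    by (simp add: chart_div_def nabla_vector_def sum.distrib)
  also have "(\<Sum>i\<in>UNIV. \<Sum>k\<in>UNIV. christoffel g c i i k p * Y c p $ k)
      = (\<Sum>k\<in>UNIV. (\<Sum>i\<in>UNIV. christoffel g c i i k p) * Y c p $ k)"
    unfolding sum_distrib_right by (rule sum.swap)
  finally show ?thesis by (simp only: christoffel_contracted[OF assms] sum.distrib)
qed

lemma continuous_chart_div:
  assumes c: "c \<in> A" and Y: "\<And>i. C1_in_chart c (\<lambda>p. Y c p $ i)"
  shows "continuous_on (chart_dom c) (chart_div g c Y)"
proof -
  have "continuous_on (chart_dom c) (\<lambda>p. metric_partial g c m p $ i $ j)" for m i j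
    unfolding metric_partial_def
    using continuous_partial[OF c C1_in_chart_tensor[OF metric_tensor_field c]] by simp
  note cont = this continuous_metric_inv[OF c] continuous_partial[OF c Y] C1_in_chart_continuous[OF c Y]
  have "continuous_on (chart_dom c) (\<lambda>p. \<Sum>i\<in>UNIV. partial c i (\<lambda>y. Y c y $ i) p
    + 1/2 * trace (metric_inv g c p ** metric_partial g c i p) * Y c p $ i)"
    unfolding trace_def matrix_matrix_mult_def vec_lambda_beta
    by (intro continuous_on_sum continuous_on_add continuous_on_mult continuous_on_const cont)
  then show ?thesis
    by (rule continuous_on_eq) (simp only: chart_div_trace[OF c])
qed

text \<open>Jacobi's formula gives the logarithmic derivative of \<open>sqrt (det g)\<close>, which is the contracted
  Christoffel symbol.\<close>

lemma C1_vol_density: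
  assumes c: "c \<in> A"
  shows "C_k_on (Suc 0) (chart_img c) (vol_density c)"
    and "x \<in> chart_img c \<Longrightarrow> frechet_derivative (vol_density c) (at x) (axis i 1) =
      vol_density c x * (1/2 * trace (metric_inv g c (chart_inv c x) ** metric_partial g c i (chart_inv c x)))"
proof -
  let ?D = "\<lambda>x. det (g c (chart_inv c x))"
  have pos: "0 < ?D x" if "x \<in> chart_img c" for x
    by (rule det_metric_pos[OF c chart_inv_in_dom[OF c that]])
  note D1 = C_k_on_det_metric[OF c, of "Suc 0"]
  show "C_k_on (Suc 0) (chart_img c) (vol_density c)"
    by (rule C_k_on_cong[OF open_chart_img[OF c] C_1_on_sqrt(1)[OF open_chart_img[OF c] D1 pos]])
      (simp_all add: vol_density_def)
  assume x: "x \<in> chart_img c"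
  have vd: "(vol_density c has_derivative
      (\<lambda>v. frechet_derivative ?D (at x) v * (inverse (sqrt (?D x)) / 2))) (at x)"
    by (rule has_derivative_transform_within_open[OF C_1_on_sqrt(2)[OF open_chart_img[OF c] D1 pos x] open_chart_img[OF c] x])
      (simp_all add: vol_density_def)
  let ?g' = "\<lambda>v. (\<chi> r s. frechet_derivative (\<lambda>x. g c (chart_inv c x) $ r $ s) (at x) v) :: real^'n^'n"
  have "(?D has_derivative (\<lambda>v. ?D x * trace (matrix_inv (g c (chart_inv c x)) ** ?g' v))) (at x)"
  proof (rule has_derivative_det)
    fix r s
    show "((\<lambda>x. g c (chart_inv c x) $ r $ s) has_derivative (\<lambda>v. ?g' v $ r $ s)) (at x)"
      using C_k_on_has_derivative[OF C_k_on_tensor_components[OF metric_tensor_field c] x] by simp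
    show "det (g c (chart_inv c x)) \<noteq> 0" using pos[OF x] by simp
  qed
  from frechet_derivative_at[OF this, symmetric]
  have fd: "frechet_derivative ?D (at x) (axis i 1) = ?D x * trace (matrix_inv (g c (chart_inv c x)) ** ?g' (axis i 1))"
    by simp
  have g': "?g' (axis i 1) = metric_partial g c i (chart_inv c x)"
    by (simp add: metric_partial_def partial_def o_def chart_map_inv[OF c x])
  have "frechet_derivative (vol_density c) (at x) (axis i 1) =
      frechet_derivative ?D (at x) (axis i 1) * (inverse (sqrt (?D x)) / 2)"
    by (rule fun_cong[OF frechet_derivative_at[OF vd, symmetric]])
  also have "\<dots> = ?D x * inverse (sqrt (?D x)) * (1/2 * trace (metric_inv g c (chart_inv c x) ** metric_partial g c i (chart_inv c x)))"
    unfolding fd g' metric_inv_def by simp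
  also have "?D x * inverse (sqrt (?D x)) = vol_density c x"
    using pos[OF x] x by (simp add: vol_density_def field_simps)
  finally show "frechet_derivative (vol_density c) (at x) (axis i 1) =
      vol_density c x * (1/2 * trace (metric_inv g c (chart_inv c x) ** metric_partial g c i (chart_inv c x)))" .
qed

lemma chart_differential_eq_0:
  assumes c: "c \<in> A" and "C1_in_chart c f" and "closed K" and zero: "\<And>q. q \<notin> K \<Longrightarrow> f q = 0"
    and p: "p \<in> chart_dom c" "p \<notin> K"
  shows "chart_differential c f p v = 0"
proof -
  have U: "open (chart_map c ` (chart_dom c - K))"
    using assms(3) by (intro open_chart_map_image[OF c] open_Diff open_chart_dom[OF c]) auto
  have "(f \<circ> chart_inv c has_derivative (\<lambda>_. 0)) (at (chart_map c p))"
  proof (rule has_derivative_transform_within_open[OF has_derivative_const[of 0] U])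
    show "chart_map c p \<in> chart_map c ` (chart_dom c - K)" using p by blast
    fix x assume "x \<in> chart_map c ` (chart_dom c - K)"
    then obtain q where "q \<in> chart_dom c" "q \<notin> K" "x = chart_map c q" by blast
    then show "0 = (f \<circ> chart_inv c) x" using zero chart_inv_map[OF c] by simp
  qed
  from has_derivative_unique[OF C1_in_chart_has_derivative[OF c assms(2) p(1)] this] show ?thesis by simp
qed

text \<open>The integrand is \<open>f * div Y + Y f\<close>, the divergence of \<open>f Y\<close>.  In coordinates, \<open>vol_density c\<close> times
  the integrand is the Euclidean divergence of \<open>vol_density c * f * Y\<close>, because the logarithmic derivatives
  of the density are the contracted Christoffel symbols.\<close>

lemma integration_by_parts_chart:
  assumes c: "c \<in> A" and f: "C1_in_chart c f"
    and K: "compact K" "K \<subseteq> chart_dom c" and zero: "\<And>p. p \<notin> K \<Longrightarrow> f p = 0"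
    and Y: "\<And>i. C1_in_chart c (\<lambda>p. Y c p $ i)"
    and H: "\<And>p. p \<in> chart_dom c \<Longrightarrow> H p = f p * chart_div g c Y p + chart_differential c f p (Y c p)"
    and H_out: "\<And>p. p \<notin> chart_dom c \<Longrightarrow> H p = 0"
  shows "continuous_on UNIV H" "(LINT p|dvol A g. H p) = 0"
proof -
  have img: "open (chart_img c)" by (rule open_chart_img[OF c])
  have df_zero: "chart_differential c f p v = 0" if "p \<in> chart_dom c" "p \<notin> K" for p v
    by (rule chart_differential_eq_0[OF c f compact_imp_closed[OF K(1)] zero that])
  have H_zero: "H p = 0" if "p \<notin> K" for p
    using that zero[OF that] H[of p] H_out[of p] df_zero[of p] by (cases "p \<in> chart_dom c") simp_all
  have "continuous_on (chart_dom c) (\<lambda>p. f p * chart_div g c Y p + (\<Sum>i\<in>UNIV. Y c p $ i * partial c i f p))"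
    by (intro continuous_on_add continuous_on_mult continuous_on_sum continuous_chart_div[where Y = Y, OF c Y]
        C1_in_chart_continuous[OF c] continuous_partial[OF c] f Y)
  then have "continuous_on (chart_dom c) H"
    by (rule continuous_on_eq) (simp add: H chart_differential_sum_partial[OF c f])
  then show contH: "continuous_on UNIV H"
    by (rule continuous_on_extend_zero[OF c _ K H_zero])
  \<comment> \<open>The components of the density times \<open>f Y\<close>, extended by 0 outside the chart image.\<close>
  define F where "F i x = vol_density c x * (f (chart_point c x) * Y c (chart_point c x) $ i)" for i x
  define L where "L = chart_map c ` K"
  have L: "compact L"
    unfolding L_def by (rule compact_continuous_image[OF continuous_on_subset[OF continuous_chart_map[OF c] K(2)] K(1)])
  have L_img: "L \<subseteq> chart_img c" using K(2) by (auto simp: L_def chart_img_def)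
  have not_L: "chart_inv c x \<notin> K" if "x \<in> chart_img c" "x \<notin> L" for x
    using that chart_map_inv[OF c that(1)] unfolding L_def by (metis imageI)
  have F_zero: "F i x = 0" if "x \<notin> L" for i x
  proof (cases "x \<in> chart_img c")
    case True
    then show ?thesis using zero[OF not_L[OF True that]] by (simp add: F_def chart_point_def)
  qed (simp add: F_def vol_density_def)
  define u where "u x = f (chart_inv c x)" for x
  define y where "y i x = Y c (chart_inv c x) $ i" for i x
  have C1u: "C_k_on (Suc 0) (chart_img c) u" and C1y: "C_k_on (Suc 0) (chart_img c) (y i)" for i
    using f Y[of i] unfolding C1_in_chart_def o_def u_def y_def by simp_all
  have F_in: "vol_density c x * (u x * y i x) = F i x" if "x \<in> chart_img c" for i x
    using that by (simp add: F_def u_def y_def chart_point_def)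
  have F1: "C_k_on (Suc 0) (chart_img c) (F i)" for i
    by (rule C_k_on_cong[OF img C_k_on_mult[OF img C1_vol_density(1)[OF c] C_k_on_mult[OF img C1u C1y]] F_in])
  have oL: "open (- L)" using compact_imp_closed[OF L] by (rule open_Compl)
  have F2: "C_k_on (Suc 0) (- L) (F i)" for i
    by (rule C_k_on_cong[OF oL C_k_on_const[of _ _ 0]]) (simp add: F_zero)
  have "chart_img c \<union> - L = UNIV" using L_img by blast
  then have F: "C_k_on (Suc 0) UNIV (F i)" for i
    using C_k_on_Un[OF img oL F1 F2] by (simp only:)
  let ?d = "\<lambda>i x. frechet_derivative (F i) (at x) (axis i 1)"
  have contF: "continuous_on UNIV (?d i)" for i
    using C_k_on_frechet_derivative[OF F] by simp
  have F_int: "(LINT x|lborel. ?d i x) = 0" for i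
    by (rule integral_derivative_compact_support[OF C_k_on_has_derivative[OF F UNIV_I] contF L F_zero])
  have d_zero: "?d i x = 0" if "x \<notin> L" for i x
  proof -
    have "(F i has_derivative (\<lambda>_. 0)) (at x)"
      by (rule has_derivative_transform_within_open[OF has_derivative_const[of 0] oL])
        (use that F_zero in auto)
    from frechet_derivative_at[OF this, symmetric] show ?thesis by simp
  qed
  have d_int: "integrable lborel (?d i)" for i
  proof -
    have "integrable lborel (\<lambda>x. indicator L x *\<^sub>R ?d i x)"
      by (rule borel_integrable_compact[OF L continuous_on_subset[OF contF]]) simp
    moreover have "(\<lambda>x. indicator L x *\<^sub>R ?d i x) = ?d i"
    proof
      fix x show "indicator L x *\<^sub>R ?d i x = ?d i x" by (cases "x \<in> L") (simp_all add: d_zero)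
    qed
    ultimately show ?thesis by (simp only:)
  qed
  have sum_d: "(\<Sum>i\<in>UNIV. ?d i x) = vol_density c x * H (chart_point c x)" for x
  proof (cases "x \<in> chart_img c")
    case x: True
    let ?p = "chart_inv c x"
    let ?t = "\<lambda>i. 1/2 * trace (metric_inv g c ?p ** metric_partial g c i ?p)"
    have p: "?p \<in> chart_dom c" by (rule chart_inv_in_dom[OF c x])
    have d: "?d i x = vol_density c x * (u x * (frechet_derivative (y i) (at x) (axis i 1) + ?t i * y i x)
        + frechet_derivative u (at x) (axis i 1) * y i x)" for i
    proof -
      note D = C1_vol_density(1)[OF c, THEN C_k_on_has_derivative, OF x]
        C1u[THEN C_k_on_has_derivative, OF x] C1y[THEN C_k_on_has_derivative, OF x]
      have "(F i has_derivative (\<lambda>v. vol_density c x * (u x * frechet_derivative (y i) (at x) v + frechet_derivative u (at x) v * y i x)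
          + frechet_derivative (vol_density c) (at x) v * (u x * y i x))) (at x)"
        by (rule has_derivative_transform_within_open[OF has_derivative_mult[OF D(1) has_derivative_mult[OF D(2,3)]] img x F_in])
      from fun_cong[OF frechet_derivative_at[OF this, symmetric], of "axis i 1"]
      show ?thesis unfolding C1_vol_density(2)[OF c x] by (simp add: algebra_simps)
    qed
    have fy: "frechet_derivative (y i) (at x) (axis i 1) = partial c i (\<lambda>p. Y c p $ i) ?p" for i
      by (simp add: partial_def y_def[abs_def] o_def chart_map_inv[OF c x])
    have fu: "frechet_derivative u (at x) (axis i 1) = partial c i f ?p" for i
      by (simp add: partial_def u_def[abs_def] o_def chart_map_inv[OF c x])
    have "(\<Sum>i\<in>UNIV. ?d i x) = vol_density c x * (f ?p * (\<Sum>i\<in>UNIV. partial c i (\<lambda>p. Y c p $ i) ?p + ?t i * Y c ?p $ i)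
        + (\<Sum>i\<in>UNIV. Y c ?p $ i * partial c i f ?p))"
      unfolding d fy fu sum_distrib_left sum.distrib[symmetric]
      by (intro sum.cong refl) (simp add: u_def y_def algebra_simps)
    also have "\<dots> = vol_density c x * H ?p"
      by (simp only: H[OF p] chart_div_trace[OF c p] chart_differential_sum_partial[OF c f p])
    finally show ?thesis using x by (simp add: chart_point_def)
  next
    case False
    then have "x \<notin> L" using L_img by blast
    then show ?thesis using False d_zero by (simp add: vol_density_def)
  qed
  have "(LINT p|dvol A g. H p) = (LINT x|lborel. vol_density c x * H (chart_point c x))"
    by (rule integral_dvol_chart[OF c borel_measurable_continuous_onI[OF contH] H_out])
  also have "\<dots> = (LINT x|lborel. (\<Sum>i\<in>UNIV. ?d i x))" by (simp only: sum_d)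
  also have "\<dots> = (\<Sum>i\<in>UNIV. LINT x|lborel. ?d i x)"
    by (rule Bochner_Integration.integral_sum) (rule d_int)
  also have "\<dots> = 0" by (simp add: F_int)
  finally show "(LINT p|dvol A g. H p) = 0" .
qed

section \<open>The divergence theorem\<close>

lemma C1_in_chart_vector_field:
  assumes "vector_field A Y" "c \<in> A"
  shows "C1_in_chart c (\<lambda>p. Y c p $ i)"
proof -
  have "smooth_on (chart_img c) (Y c \<circ> chart_inv c)"
    using assms unfolding vector_field_def smooth_in_chart_def by blast
  then have "C_k_on (Suc 0) (chart_img c) (\<lambda>x. Y c (chart_inv c x))"
    unfolding smooth_on_def o_def by (rule spec)
  from C_k_on_nth[OF open_chart_img[OF assms(2)] this]
  show ?thesis unfolding C1_in_chart_def o_def .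
qed

lemma vector_field_change:
  assumes "vector_field A Y" "c \<in> A" "d \<in> A" "p \<in> chart_dom c \<inter> chart_dom d"
  shows "Y d p = coord_jacobian c d p *v Y c p"
  using assms unfolding vector_field_def by blast

lemma derivation_change:
  assumes Y: "vector_field A Y" and c: "c \<in> A" and d: "d \<in> A" and p: "p \<in> chart_dom c \<inter> chart_dom d"
    and f: "C1_in_chart d f"
  shows "chart_differential c f p (Y c p) = chart_differential d f p (Y d p)"
  by (simp only: chart_differential_change[OF c d f p] vector_field_change[OF Y c d p])

text \<open>Integrating by parts against a bump function, the term with the derivative of the bump is the
  same in both charts; hence so is the term with the divergence.  A strict inequality between the two
  divergences at a point would persist nearby and be detected by a bump there.\<close>

lemma chart_div_change_le:
  assumes Y: "vector_field A Y" and c: "c \<in> A" and d: "d \<in> A" and p: "p \<in> chart_dom c \<inter> chart_dom d"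
  shows "chart_div g d Y p \<le> chart_div g c Y p"
proof (rule ccontr)
  assume less: "\<not> ?thesis"
  let ?O = "chart_dom c \<inter> chart_dom d"
  define h where "h x = chart_div g d Y x - chart_div g c Y x" for x
  have openO: "open ?O" by (intro open_Int open_chart_dom c d)
  have h: "continuous_on ?O h"
    unfolding h_def
    using continuous_chart_div[where Y = Y, OF c C1_in_chart_vector_field[OF Y c]] continuous_chart_div[where Y = Y, OF d C1_in_chart_vector_field[OF Y d]]
    by (intro continuous_on_diff) (auto elim: continuous_on_subset)
  define V where "V = ?O \<inter> h -` {0<..}"
  have "open V" unfolding V_def by (rule continuous_open_preimage[OF h openO]) simp
  moreover have "p \<in> V" using less p by (simp add: V_def h_def)
  moreover have "V \<subseteq> chart_dom c" by (auto simp: V_def)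
  ultimately show False
  proof (rule_tac bump_exists[OF c, of p V])
    fix f :: "'m \<Rightarrow> real" and K
    assume K: "compact K" "K \<subseteq> V" and fp: "0 < f p" and nonneg: "\<And>x. 0 \<le> f x"
      and zero: "\<And>x. x \<notin> K \<Longrightarrow> f x = 0" and C1: "\<And>e. e \<in> A \<Longrightarrow> C1_in_chart e f"
    have K_c: "K \<subseteq> chart_dom c" and K_d: "K \<subseteq> chart_dom d" using K(2) by (auto simp: V_def)
    define H where "H e x = (if x \<in> chart_dom e then f x * chart_div g e Y x + chart_differential e f x (Y e x) else 0)" for e x
    have Hc: "continuous_on UNIV (H c)" "(LINT x|dvol A g. H c x) = 0"
      by (rule integration_by_parts_chart[where Y = Y and f = f and H = "H c", OF c C1[OF c] K(1) K_c zero C1_in_chart_vector_field[OF Y c]]; simp add: H_def)+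
    have Hd: "continuous_on UNIV (H d)" "(LINT x|dvol A g. H d x) = 0"
      by (rule integration_by_parts_chart[where Y = Y and f = f and H = "H d", OF d C1[OF d] K(1) K_d zero C1_in_chart_vector_field[OF Y d]]; simp add: H_def)+
    have on_O: "H d x - H c x = f x * h x" if "x \<in> ?O" for x
      using that derivation_change[OF Y c d that C1[OF d]] by (simp add: H_def h_def algebra_simps)
    have support: "H e x = 0" if "e \<in> A" "x \<notin> K" for e x
      using zero[OF that(2)] chart_differential_eq_0[OF that(1) C1[OF that(1)] compact_imp_closed[OF K(1)] zero _ that(2)]
      by (simp add: H_def)
    have "0 \<le> H d x - H c x" for x
    proof (cases "x \<in> K")
      case True
      then have "x \<in> V" using K(2) by blast
      then have "x \<in> ?O" "0 < h x" by (auto simp: V_def)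
      then show ?thesis using on_O[of x] nonneg[of x] by simp
    next
      case False
      then show ?thesis using support[OF c False] support[OF d False] by simp
    qed
    moreover have "(LINT x|dvol A g. H d x - H c x) = 0"
      using Bochner_Integration.integral_diff[OF integrable_dvol_continuous[OF Hd(1)] integrable_dvol_continuous[OF Hc(1)]]
      by (simp only: Hc(2) Hd(2))
    ultimately have "H d p - H c p = 0"
      by (intro integral_dvol_eq_0_imp[where f = "\<lambda>x. H d x - H c x"] continuous_on_diff Hc(1) Hd(1))
    moreover have "0 < h p" using \<open>p \<in> V\<close> by (simp add: V_def)
    ultimately show False using on_O[OF p] fp by simp
  qed
qed

lemma chart_div_change:
  assumes "vector_field A Y" "c \<in> A" "d \<in> A" "p \<in> chart_dom c" "p \<in> chart_dom d"
  shows "chart_div g c Y p = chart_div g d Y p"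
  using chart_div_change_le[OF assms(1-3), of p] chart_div_change_le[OF assms(1,3,2), of p] assms(4,5)
  by (simp add: order_antisym)

lemma div_vector_chart:
  assumes "vector_field A Y" "c \<in> A" "p \<in> chart_dom c"
  shows "div_vector A g Y p = chart_div g c Y p"
  using chart_div_change[OF assms(1) chart_at(1) assms(2) chart_at(2) assms(3)]
  by (simp add: div_vector_def chart_div_def)

lemma continuous_div_vector:
  assumes Y: "vector_field A Y"
  shows "continuous_on UNIV (div_vector A g Y)"
proof (rule continuous_on_manifold)
  fix c assume c: "c \<in> A"
  show "continuous_on (chart_dom c) (div_vector A g Y)"
    by (rule continuous_on_eq[OF continuous_chart_div[where Y = Y, OF c C1_in_chart_vector_field[OF Y c]]])
      (simp only: div_vector_chart[OF Y c])
qed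

text \<open>Integration by parts against the members \<open>\<rho> p\<close> of a partition of unity: the functions \<open>\<rho> p\<close> sum to 1,
  so the terms \<open>\<rho> p * div Y\<close> sum to the divergence and the derivatives \<open>Y (\<rho> p)\<close> sum to 0.\<close>

theorem divergence_theorem:
  assumes Y: "vector_field A Y"
  shows "(LINT p|dvol A g. div_vector A g Y p) = 0"
proof (rule partition_of_unity)
  fix P :: "'m set" and \<rho> :: "'m \<Rightarrow> 'm \<Rightarrow> real" and K
  assume P: "finite P"
    and K: "\<And>p. p \<in> P \<Longrightarrow> compact (K p)" "\<And>p. p \<in> P \<Longrightarrow> K p \<subseteq> chart_dom (chart_at A p)"
    and zero: "\<And>p x. p \<in> P \<Longrightarrow> x \<notin> K p \<Longrightarrow> \<rho> p x = 0"
    and C1: "\<And>p d. p \<in> P \<Longrightarrow> d \<in> A \<Longrightarrow> C1_in_chart d (\<rho> p)" and sum1: "\<And>x. (\<Sum>p\<in>P. \<rho> p x) = 1"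
  define H where "H p x = (if x \<in> chart_dom (chart_at A p) then \<rho> p x * chart_div g (chart_at A p) Y x
      + chart_differential (chart_at A p) (\<rho> p) x (Y (chart_at A p) x) else 0)" for p x
  have H: "continuous_on UNIV (H p)" "(LINT x|dvol A g. H p x) = 0" if p: "p \<in> P" for p
    by (rule integration_by_parts_chart[where Y = Y and f = "\<rho> p" and H = "H p", OF chart_at(1) C1[OF p chart_at(1)] K[OF p] zero[OF p]
        C1_in_chart_vector_field[OF Y chart_at(1)]]; simp add: H_def)+
  have H_eq: "H p x = \<rho> p x * div_vector A g Y x + chart_differential (chart_at A x) (\<rho> p) x (Y (chart_at A x) x)"
    if p: "p \<in> P" for p x
  proof (cases "x \<in> chart_dom (chart_at A p)")
    case True
    then have "x \<in> chart_dom (chart_at A p) \<inter> chart_dom (chart_at A x)" using chart_at(2) by blast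
    from derivation_change[OF Y chart_at(1) chart_at(1) this C1[OF p chart_at(1)]] True
    show ?thesis by (simp add: H_def div_vector_chart[OF Y chart_at(1) True])
  next
    case False
    let ?c = "chart_at A x"
    have c: "?c \<in> A" "x \<in> chart_dom ?c" by (rule chart_at)+
    have x: "x \<notin> K p" using False K(2)[OF p] by blast
    from chart_differential_eq_0[OF c(1) C1[OF p c(1)] compact_imp_closed[OF K(1)[OF p]] zero[OF p] c(2) x]
    show ?thesis using False zero[OF p x] by (simp add: H_def)
  qed
  have sum_H: "(\<Sum>p\<in>P. H p x) = div_vector A g Y x" for x
  proof -
    let ?c = "chart_at A x"
    have c: "?c \<in> A" "x \<in> chart_dom ?c" by (rule chart_at)+
    have "((\<lambda>z. \<Sum>p\<in>P. (\<rho> p \<circ> chart_inv ?c) z) has_derivative (\<lambda>v. \<Sum>p\<in>P. chart_differential ?c (\<rho> p) x v)) (at (chart_map ?c x))"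
      by (rule has_derivative_sum) (rule C1_in_chart_has_derivative[OF c(1) C1[OF _ c(1)] c(2)])
    moreover have "(\<lambda>z. \<Sum>p\<in>P. (\<rho> p \<circ> chart_inv ?c) z) = (\<lambda>z. 1)" by (simp add: sum1)
    ultimately have "((\<lambda>z. 1) has_derivative (\<lambda>v. \<Sum>p\<in>P. chart_differential ?c (\<rho> p) x v)) (at (chart_map ?c x))"
      by (simp only:)
    from has_derivative_unique[OF this has_derivative_const]
    have "(\<Sum>p\<in>P. chart_differential ?c (\<rho> p) x (Y ?c x)) = 0" by (rule fun_cong)
    moreover have "(\<Sum>p\<in>P. H p x) = (\<Sum>p\<in>P. \<rho> p x) * div_vector A g Y x + (\<Sum>p\<in>P. chart_differential ?c (\<rho> p) x (Y ?c x))"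
      by (simp add: H_eq sum.distrib sum_distrib_right)
    ultimately show ?thesis by (simp add: sum1)
  qed
  have "(LINT x|dvol A g. div_vector A g Y x) = (LINT x|dvol A g. (\<Sum>p\<in>P. H p x))" by (simp only: sum_H)
  also have "\<dots> = (\<Sum>p\<in>P. LINT x|dvol A g. H p x)"
    by (rule Bochner_Integration.integral_sum) (rule integrable_dvol_continuous[OF H(1)])
  also have "\<dots> = 0" using H(2) by simp
  finally show ?thesis .
qed

end

section \<open>Traces, norms and divergences of (0,2)-tensors\<close>

context closed_riemannian_manifold
begin

lemma metric_inv_matrix:
  assumes "c \<in> A" "p \<in> chart_dom c"
  shows "metric_inv g c p ** g c p = mat 1" "g c p ** metric_inv g c p = mat 1"
    "transpose (metric_inv g c p) = metric_inv g c p"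
  unfolding metric_inv_def
  using det_metric_pos[OF assms]
  by (intro matrix_inv_mult matrix_inv_symmetric metric_symmetric[OF assms]; simp)+

text \<open>The endomorphism with components \<open>g\<^sup>i\<^sup>k T\<^sub>k\<^sub>j\<close> changes by conjugation, which
  makes traces chart independent.\<close>

lemma raised_tensor_change:
  assumes T: "tensor_field A T" and c: "c \<in> A" and d: "d \<in> A" and p: "p \<in> chart_dom c" "p \<in> chart_dom d"
  shows "coord_jacobian c d p ** (metric_inv g c p ** T c p) = (metric_inv g d p ** T d p) ** coord_jacobian c d p"
proof -
  let ?J = "coord_jacobian c d p"
  have overlap: "p \<in> chart_dom c \<inter> chart_dom d" using p by blast
  have J: "det ?J \<noteq> 0" by (rule det_coord_jacobian[OF c d overlap])
  have J': "det (transpose ?J) \<noteq> 0" using J by (simp add: det_transpose)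
  let ?B = "matrix_inv ?J ** metric_inv g d p ** matrix_inv (transpose ?J)"
  have "?B ** g c p = matrix_inv ?J ** metric_inv g d p ** (matrix_inv (transpose ?J) ** transpose ?J) ** g d p ** ?J"
    unfolding tensor_field_change[OF metric_tensor_field c d overlap] by (simp only: matrix_mul_assoc)
  also have "\<dots> = matrix_inv ?J ** (metric_inv g d p ** g d p) ** ?J"
    by (simp only: matrix_inv_mult[OF J'] matrix_mul_rid matrix_mul_assoc)
  also have "\<dots> = mat 1"
    by (simp only: metric_inv_matrix[OF d p(2)] matrix_mul_rid matrix_inv_mult[OF J])
  finally have B: "metric_inv g c p = ?B"
    unfolding metric_inv_def[of g c] by (rule matrix_inv_unique)
  have "?J ** (metric_inv g c p ** T c p) =
      (?J ** matrix_inv ?J) ** metric_inv g d p ** (matrix_inv (transpose ?J) ** transpose ?J) ** T d p ** ?J"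
    unfolding B tensor_field_change[OF T c d overlap] by (simp only: matrix_mul_assoc)
  then show ?thesis
    by (simp only: matrix_inv_mult[OF J'] matrix_inv_mult[OF J] matrix_mul_lid matrix_mul_rid matrix_mul_assoc)
qed

lemma trace_conjugate:
  fixes J M N :: "real^'k^'k"
  assumes "det J \<noteq> 0" "J ** M = N ** J"
  shows "trace M = trace N"
proof -
  have "M = matrix_inv J ** (J ** M)"
    by (simp only: matrix_mul_assoc matrix_inv_mult[OF assms(1)] matrix_mul_lid)
  then have "trace M = trace (matrix_inv J ** (N ** J))" by (simp only: assms(2))
  also have "\<dots> = trace ((N ** J) ** matrix_inv J)" by (rule trace_mul_sym)
  also have "(N ** J) ** matrix_inv J = N"
    by (simp only: matrix_mul_assoc[symmetric] matrix_inv_mult[OF assms(1)] matrix_mul_rid)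
  finally show ?thesis .
qed

lemma intertwine_square:
  fixes J M N :: "real^'k^'k"
  assumes "J ** M = N ** J"
  shows "J ** (M ** M) = (N ** N) ** J"
proof -
  have "J ** (M ** M) = (J ** M) ** M" by (rule matrix_mul_assoc)
  also have "\<dots> = (N ** J) ** M" by (simp only: assms)
  also have "\<dots> = N ** (J ** M)" by (rule matrix_mul_assoc[symmetric])
  also have "\<dots> = N ** (N ** J)" by (simp only: assms)
  also have "\<dots> = (N ** N) ** J" by (rule matrix_mul_assoc)
  finally show ?thesis .
qed

definition chart_trace :: "('m, 'n) chart \<Rightarrow> ('m, 'n) tensor2 \<Rightarrow> 'm \<Rightarrow> real" where
  "chart_trace c T p = (\<Sum>i\<in>UNIV. \<Sum>j\<in>UNIV. metric_inv g c p $ i $ j * T c p $ i $ j)"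

lemma chart_trace_eq_trace:
  assumes "c \<in> A" "p \<in> chart_dom c"
  shows "chart_trace c T p = trace (metric_inv g c p ** T c p)"
proof -
  have "trace (metric_inv g c p ** T c p) = (\<Sum>i\<in>UNIV. \<Sum>j\<in>UNIV. metric_inv g c p $ i $ j * T c p $ j $ i)"
    by (simp only: trace_def matrix_matrix_mult_def vec_lambda_beta)
  also have "\<dots> = (\<Sum>j\<in>UNIV. \<Sum>i\<in>UNIV. metric_inv g c p $ i $ j * T c p $ j $ i)" by (rule sum.swap)
  also have "\<dots> = chart_trace c T p"
    unfolding chart_trace_def by (intro sum.cong refl) (simp only: metric_inv_symmetric[OF assms])
  finally show ?thesis ..
qed

lemma tr_chart:
  assumes T: "tensor_field A T" and c: "c \<in> A" and p: "p \<in> chart_dom c"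
  shows "tr A g T p = chart_trace c T p"
proof -
  have "tr A g T p = chart_trace (chart_at A p) T p" by (simp only: tr_def Let_def chart_trace_def)
  also have "\<dots> = trace (metric_inv g (chart_at A p) p ** T (chart_at A p) p)"
    by (rule chart_trace_eq_trace[OF chart_at])
  also have "\<dots> = trace (metric_inv g c p ** T c p)"
  proof (rule trace_conjugate)
    show "det (coord_jacobian (chart_at A p) c p) \<noteq> 0"
      by (rule det_coord_jacobian[OF chart_at(1) c]) (use chart_at(2) p in blast)
  qed (rule raised_tensor_change[OF T chart_at(1) c chart_at(2) p])
  also have "\<dots> = chart_trace c T p" by (rule chart_trace_eq_trace[OF c p, symmetric])
  finally show ?thesis .
qed

lemma norm_sq_inner:
  "norm_sq A g T p = tensor_inner (metric_inv g (chart_at A p) p) (T (chart_at A p) p) (T (chart_at A p) p)"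
  by (simp only: norm_sq_def Let_def tensor_inner_def)

text \<open>For symmetric \<open>T\<close> the square norm is the trace of the square of the endomorphism obtained by raising
  an index, and conjugation by the Jacobian matrix preserves it.\<close>

lemma norm_sq_chart:
  assumes T: "symmetric_tensor_field A T" and c: "c \<in> A" and p: "p \<in> chart_dom c"
  shows "norm_sq A g T p = tensor_inner (metric_inv g c p) (T c p) (T c p)"
proof -
  have sym: "transpose (T d p) = T d p" if "d \<in> A" "p \<in> chart_dom d" for d
    using T that unfolding symmetric_tensor_field_def by blast
  have tf: "tensor_field A T" using T unfolding symmetric_tensor_field_def by blast
  let ?c = "chart_at A p" and ?M = "\<lambda>d. metric_inv g d p ** T d p"
  have tr: "tensor_inner (metric_inv g d p) (T d p) (T d p) = trace (?M d ** ?M d)" if "d \<in> A" "p \<in> chart_dom d" for d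
    by (rule tensor_inner_eq_trace[OF metric_inv_matrix(3)[OF that] sym[OF that]])
  have J: "coord_jacobian ?c c p ** ?M ?c = ?M c ** coord_jacobian ?c c p"
    by (rule raised_tensor_change[OF tf chart_at(1) c chart_at(2) p])
  have "trace (?M ?c ** ?M ?c) = trace (?M c ** ?M c)"
  proof (rule trace_conjugate)
    show "det (coord_jacobian ?c c p) \<noteq> 0"
      by (rule det_coord_jacobian[OF chart_at(1) c]) (use chart_at(2) p in blast)
    show "coord_jacobian ?c c p ** (?M ?c ** ?M ?c) = (?M c ** ?M c) ** coord_jacobian ?c c p"
      by (rule intertwine_square[OF J])
  qed
  then show ?thesis by (simp only: norm_sq_inner tr[OF chart_at] tr[OF c p])
qed

lemma norm_sq_nonneg: "0 \<le> norm_sq A g T p"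
  and norm_sq_eq_0_iff: "norm_sq A g T p = 0 \<longleftrightarrow> T (chart_at A p) p = 0"
proof -
  let ?c = "chart_at A p"
  have pd: "0 < v \<bullet> (metric_inv g ?c p *v v)" if "v \<noteq> 0" for v
    unfolding metric_inv_def
    by (rule posdef_matrix_inv[OF metric_symmetric[OF chart_at] metric_posdef[OF chart_at] that])
  show "0 \<le> norm_sq A g T p" "norm_sq A g T p = 0 \<longleftrightarrow> T (chart_at A p) p = 0"
    unfolding norm_sq_inner
    using tensor_inner_self[OF metric_inv_matrix(3)[OF chart_at] pd] by blast+
qed

lemma C_k_on_chart_trace:
  assumes T: "tensor_field A T" and c: "c \<in> A"
  shows "C_k_on k (chart_img c) (\<lambda>x. chart_trace c T (chart_inv c x))"
  unfolding chart_trace_def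
  by (intro C_k_on_sum C_k_on_mult open_chart_img[OF c] C_k_on_metric_inv[OF c] C_k_on_tensor_components[OF T c])

lemma smooth_tr:
  assumes T: "tensor_field A T"
  shows "smooth_function A (tr A g T)"
  unfolding smooth_function_def smooth_in_chart_def smooth_on_def
proof (intro ballI allI)
  fix c k assume c: "c \<in> A"
  show "C_k_on k (chart_img c) (tr A g T \<circ> chart_inv c)"
    by (rule C_k_on_cong[OF open_chart_img[OF c] C_k_on_chart_trace[OF T c]])
      (simp add: tr_chart[OF T c chart_inv_in_dom[OF c]])
qed

lemma smooth_function_C_k_on:
  assumes "smooth_function A f" "c \<in> A"
  shows "C_k_on k (chart_img c) (\<lambda>x. f (chart_inv c x))"
proof -
  have "smooth_on (chart_img c) (f \<circ> chart_inv c)"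
    using assms unfolding smooth_function_def smooth_in_chart_def by blast
  then show ?thesis unfolding smooth_on_def o_def by (rule spec)
qed

lemma continuous_norm_sq:
  assumes T: "symmetric_tensor_field A T"
  shows "continuous_on UNIV (norm_sq A g T)"
proof (rule continuous_on_manifold)
  have tf: "tensor_field A T" using T unfolding symmetric_tensor_field_def by blast
  fix c assume c: "c \<in> A"
  have "continuous_on (chart_dom c) (\<lambda>p. tensor_inner (metric_inv g c p) (T c p) (T c p))"
    unfolding tensor_inner_def
    by (intro continuous_on_sum continuous_on_mult continuous_metric_inv[OF c]
        C1_in_chart_continuous[OF c C1_in_chart_tensor[OF tf c]])
  then show "continuous_on (chart_dom c) (norm_sq A g T)"
    by (rule continuous_on_eq) (simp only: norm_sq_chart[OF T c])
qed

lemma scaled_metric_symmetric_tensor_field: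
  assumes T: "symmetric_tensor_field A T" and f: "smooth_function A f"
  shows "symmetric_tensor_field A (\<lambda>c p. T c p + f p *\<^sub>R g c p)"
proof -
  have tf: "tensor_field A T" using T unfolding symmetric_tensor_field_def by blast
  have "tensor_field A (\<lambda>c p. T c p + f p *\<^sub>R g c p)"
    unfolding tensor_field_def
  proof (intro conjI ballI)
    fix c assume c: "c \<in> A"
    have vec: "C_k_on k (chart_img c) (\<lambda>x. U c (chart_inv c x))" if "tensor_field A U" for U :: "('m, 'n) tensor2" and k
      using that c unfolding tensor_field_def smooth_in_chart_def smooth_on_def o_def by blast
    show "smooth_in_chart c (\<lambda>p. T c p + f p *\<^sub>R g c p)"
      unfolding smooth_in_chart_def smooth_on_def o_def
      by (intro allI C_k_on_add C_k_on_scaleR open_chart_img[OF c] vec tf metric_tensor_field smooth_function_C_k_on[OF f c])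
    fix d p assume d: "d \<in> A" and p: "p \<in> chart_dom c \<inter> chart_dom d"
    let ?J = "coord_jacobian c d p"
    have "transpose ?J ** (T d p + f p *\<^sub>R g d p) ** ?J
        = transpose ?J ** T d p ** ?J + f p *\<^sub>R (transpose ?J ** g d p ** ?J)"
      by (simp add: vec_eq_iff matrix_matrix_mult_def distrib_left distrib_right sum.distrib
          sum_distrib_left sum_distrib_right mult_ac)
    then show "T c p + f p *\<^sub>R g c p = transpose ?J ** (T d p + f p *\<^sub>R g d p) ** ?J"
      by (simp only: tensor_field_change[OF tf c d p] tensor_field_change[OF metric_tensor_field c d p])
  qed
  moreover have "transpose (T c p + f p *\<^sub>R g c p) = T c p + f p *\<^sub>R g c p" if "c \<in> A" "p \<in> chart_dom c" for c p
  proof -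
    have "T c p $ i $ j = T c p $ j $ i" for i j
      using T that unfolding symmetric_tensor_field_def by (blast intro: symmetric_matrix_nth)
    moreover have "g c p $ i $ j = g c p $ j $ i" for i j
      by (rule symmetric_matrix_nth[OF metric_symmetric[OF that]])
    ultimately show ?thesis
      unfolding vec_eq_iff transpose_def vec_lambda_beta vector_add_component vector_scaleR_component by metis
  qed
  ultimately show ?thesis unfolding symmetric_tensor_field_def by blast
qed

end

section \<open>The divergence of a contracted tensor\<close>

lemma sum_swap4:
  "(\<Sum>a\<in>I. \<Sum>b\<in>J. \<Sum>c\<in>K. \<Sum>d\<in>L. f a b c d) = (\<Sum>b\<in>J. \<Sum>c\<in>K. \<Sum>d\<in>L. \<Sum>a\<in>I. f a b c d)"
proof -
  have "(\<Sum>a\<in>I. \<Sum>b\<in>J. \<Sum>c\<in>K. \<Sum>d\<in>L. f a b c d) = (\<Sum>b\<in>J. \<Sum>a\<in>I. \<Sum>c\<in>K. \<Sum>d\<in>L. f a b c d)"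
    by (rule sum.swap)
  also have "\<dots> = (\<Sum>b\<in>J. \<Sum>c\<in>K. \<Sum>d\<in>L. \<Sum>a\<in>I. f a b c d)"
    by (intro sum.cong refl sum_swap3)
  finally show ?thesis .
qed

text \<open>The covariant derivative of \<open>T\<close> has two terms with Christoffel symbols \<open>\<Gamma>\<close>; the next two lemmas
  contract them with the cometric \<open>G\<close> and with \<open>X\<close>, at a single point.  There \<open>dg m i j\<close> is the derivative
  of the metric in the direction \<open>m\<close>, and \<open>U = T X\<close>, \<open>V = G T X\<close>.\<close>

context
  fixes G T :: "'n::finite \<Rightarrow> 'n \<Rightarrow> real" and dg :: "'n \<Rightarrow> 'n \<Rightarrow> 'n \<Rightarrow> real"
    and X U V :: "'n \<Rightarrow> real" and \<Gamma> :: "'n \<Rightarrow> 'n \<Rightarrow> 'n \<Rightarrow> real"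
  assumes G: "\<And>i j. G i j = G j i" and T: "\<And>i j. T i j = T j i" and dg: "\<And>m i j. dg m i j = dg m j i"
    and U: "\<And>i. U i = (\<Sum>k\<in>UNIV. T i k * X k)" and V: "\<And>i. V i = (\<Sum>j\<in>UNIV. G i j * U j)"
    and \<Gamma>: "\<And>k i j. \<Gamma> k i j = (\<Sum>l\<in>UNIV. 1/2 * G k l * (dg i j l + dg j i l - dg l i j))"
begin

text \<open>Contracted with the symmetric \<open>G\<close>, two of the three derivatives in \<open>\<Gamma>\<close> coincide.  The result is
  minus the contribution that the derivatives of the cometric and of the density make to the divergence
  of \<open>V\<close>.\<close>

lemma christoffel_contraction_trace:
  "(\<Sum>j\<in>UNIV. \<Sum>i\<in>UNIV. \<Sum>k\<in>UNIV. \<Sum>l\<in>UNIV. G i k * (\<Gamma> l k i * T l j) * X j)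
   = (\<Sum>i\<in>UNIV. \<Sum>a\<in>UNIV. \<Sum>b\<in>UNIV. G i a * (dg i a b * V b))
     - (\<Sum>i\<in>UNIV. 1/2 * (\<Sum>a\<in>UNIV. \<Sum>b\<in>UNIV. G a b * dg i b a) * V i)"
proof -
  have \<Gamma>U: "(\<Sum>l\<in>UNIV. \<Gamma> l k i * U l) = (\<Sum>m\<in>UNIV. 1/2 * (dg k i m + dg i k m - dg m k i) * V m)" for k i
  proof -
    have "(\<Sum>l\<in>UNIV. \<Gamma> l k i * U l) = (\<Sum>l\<in>UNIV. \<Sum>m\<in>UNIV. 1/2 * (dg k i m + dg i k m - dg m k i) * (G m l * U l))"
      unfolding \<Gamma> sum_distrib_right by (intro sum.cong refl) (simp add: G[of _ _])
    also have "\<dots> = (\<Sum>m\<in>UNIV. \<Sum>l\<in>UNIV. 1/2 * (dg k i m + dg i k m - dg m k i) * (G m l * U l))"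
      by (rule sum.swap)
    finally show ?thesis by (simp only: V sum_distrib_left)
  qed
  have "(\<Sum>j\<in>UNIV. \<Sum>i\<in>UNIV. \<Sum>k\<in>UNIV. \<Sum>l\<in>UNIV. G i k * (\<Gamma> l k i * T l j) * X j)
      = (\<Sum>i\<in>UNIV. \<Sum>k\<in>UNIV. \<Sum>l\<in>UNIV. \<Sum>j\<in>UNIV. G i k * (\<Gamma> l k i * T l j) * X j)"
    by (rule sum_swap4)
  also have "\<dots> = (\<Sum>i\<in>UNIV. \<Sum>k\<in>UNIV. G i k * (\<Sum>l\<in>UNIV. \<Gamma> l k i * U l))"
    unfolding U sum_distrib_left by (intro sum.cong refl) simp
  also have "\<dots> = (\<Sum>i\<in>UNIV. \<Sum>k\<in>UNIV. \<Sum>m\<in>UNIV. 1/2 * (G i k * (dg k i m * V m))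
      + 1/2 * (G i k * (dg i k m * V m)) - 1/2 * (G i k * dg m k i * V m))"
    unfolding \<Gamma>U sum_distrib_left by (intro sum.cong refl) (simp add: algebra_simps)
  also have "\<dots> = (\<Sum>i\<in>UNIV. \<Sum>k\<in>UNIV. \<Sum>m\<in>UNIV. 1/2 * (G i k * (dg k i m * V m)))
      + (\<Sum>i\<in>UNIV. \<Sum>k\<in>UNIV. \<Sum>m\<in>UNIV. 1/2 * (G i k * (dg i k m * V m)))
      - (\<Sum>i\<in>UNIV. \<Sum>k\<in>UNIV. \<Sum>m\<in>UNIV. 1/2 * (G i k * dg m k i * V m))"
    by (simp only: sum.distrib sum_subtractf)
  also have "(\<Sum>i\<in>UNIV. \<Sum>k\<in>UNIV. \<Sum>m\<in>UNIV. 1/2 * (G i k * (dg k i m * V m)))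
      = (\<Sum>k\<in>UNIV. \<Sum>i\<in>UNIV. \<Sum>m\<in>UNIV. 1/2 * (G i k * (dg k i m * V m)))"
    by (rule sum.swap)
  also have "\<dots> = (\<Sum>i\<in>UNIV. \<Sum>k\<in>UNIV. \<Sum>m\<in>UNIV. 1/2 * (G i k * (dg i k m * V m)))"
    by (intro sum.cong refl) (simp only: G)
  also have "(\<Sum>i\<in>UNIV. \<Sum>k\<in>UNIV. \<Sum>m\<in>UNIV. 1/2 * (G i k * dg m k i * V m))
      = (\<Sum>i\<in>UNIV. \<Sum>m\<in>UNIV. \<Sum>k\<in>UNIV. 1/2 * (G i k * dg m k i * V m))"
    by (intro sum.cong refl sum.swap)
  also have "\<dots> = (\<Sum>m\<in>UNIV. \<Sum>i\<in>UNIV. \<Sum>k\<in>UNIV. 1/2 * (G i k * dg m k i * V m))"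
    by (rule sum.swap)
  also have "\<dots> = (\<Sum>i\<in>UNIV. 1/2 * (\<Sum>a\<in>UNIV. \<Sum>b\<in>UNIV. G a b * dg i b a) * V i)"
    by (simp only: sum_distrib_left sum_distrib_right mult.assoc)
  also have "(\<Sum>i\<in>UNIV. \<Sum>k\<in>UNIV. \<Sum>m\<in>UNIV. 1/2 * (G i k * (dg i k m * V m)))
      + (\<Sum>i\<in>UNIV. \<Sum>k\<in>UNIV. \<Sum>m\<in>UNIV. 1/2 * (G i k * (dg i k m * V m)))
      = (\<Sum>i\<in>UNIV. \<Sum>a\<in>UNIV. \<Sum>b\<in>UNIV. G i a * (dg i a b * V b))"
    unfolding sum.distrib[symmetric] by (intro sum.cong refl) simp
  finally show ?thesis .
qed

text \<open>The tensor \<open>G T G\<close> is symmetric, so only the derivative in the direction of \<open>X\<close> survives.\<close>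

lemma christoffel_contraction_symmetric:
  "(\<Sum>j\<in>UNIV. \<Sum>i\<in>UNIV. \<Sum>k\<in>UNIV. \<Sum>l\<in>UNIV. G i k * (\<Gamma> l k j * T i l) * X j)
   = 1/2 * (\<Sum>i\<in>UNIV. \<Sum>j\<in>UNIV. \<Sum>k\<in>UNIV. \<Sum>l\<in>UNIV. G i k * G j l * T i j * (\<Sum>m\<in>UNIV. X m * dg m k l))"
proof -
  define S where "S k m = (\<Sum>i\<in>UNIV. \<Sum>l\<in>UNIV. G i k * T i l * G l m)" for k m
  have S: "S k m = S m k" for k m
  proof -
    have "S k m = (\<Sum>l\<in>UNIV. \<Sum>i\<in>UNIV. G i k * T i l * G l m)" unfolding S_def by (rule sum.swap)
    also have "\<dots> = (\<Sum>l\<in>UNIV. \<Sum>i\<in>UNIV. G l m * T l i * G i k)"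
      by (intro sum.cong refl) (simp add: T[of _ _])
    finally show ?thesis by (simp only: S_def)
  qed
  have one: "(\<Sum>i\<in>UNIV. \<Sum>k\<in>UNIV. \<Sum>l\<in>UNIV. G i k * (\<Gamma> l k j * T i l)) = 1/2 * (\<Sum>k\<in>UNIV. \<Sum>m\<in>UNIV. S k m * dg j k m)" for j
  proof -
    let ?E = "\<lambda>k m. dg k j m + dg j k m - dg m k j"
    have "(\<Sum>i\<in>UNIV. \<Sum>k\<in>UNIV. \<Sum>l\<in>UNIV. G i k * (\<Gamma> l k j * T i l))
        = (\<Sum>i\<in>UNIV. \<Sum>k\<in>UNIV. \<Sum>l\<in>UNIV. \<Sum>m\<in>UNIV. G i k * T i l * G l m * (1/2 * ?E k m))"
      unfolding \<Gamma> sum_distrib_left sum_distrib_right by (intro sum.cong refl) simp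
    also have "\<dots> = (\<Sum>k\<in>UNIV. \<Sum>i\<in>UNIV. \<Sum>l\<in>UNIV. \<Sum>m\<in>UNIV. G i k * T i l * G l m * (1/2 * ?E k m))"
      by (rule sum.swap)
    also have "\<dots> = (\<Sum>k\<in>UNIV. \<Sum>m\<in>UNIV. \<Sum>i\<in>UNIV. \<Sum>l\<in>UNIV. G i k * T i l * G l m * (1/2 * ?E k m))"
      by (intro sum.cong refl sum_swap3[symmetric])
    also have "\<dots> = (\<Sum>k\<in>UNIV. \<Sum>m\<in>UNIV. S k m * (1/2 * ?E k m))"
      by (simp only: S_def sum_distrib_right)
    also have "\<dots> = (\<Sum>k\<in>UNIV. \<Sum>m\<in>UNIV. 1/2 * (S k m * dg k j m)) + (\<Sum>k\<in>UNIV. \<Sum>m\<in>UNIV. 1/2 * (S k m * dg j k m))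
        - (\<Sum>k\<in>UNIV. \<Sum>m\<in>UNIV. 1/2 * (S k m * dg m k j))"
      unfolding sum.distrib[symmetric] sum_subtractf[symmetric] by (intro sum.cong refl) (simp add: algebra_simps)
    also have "(\<Sum>k\<in>UNIV. \<Sum>m\<in>UNIV. 1/2 * (S k m * dg m k j)) = (\<Sum>m\<in>UNIV. \<Sum>k\<in>UNIV. 1/2 * (S k m * dg m k j))"
      by (rule sum.swap)
    also have "\<dots> = (\<Sum>k\<in>UNIV. \<Sum>m\<in>UNIV. 1/2 * (S k m * dg k j m))"
      by (intro sum.cong refl) (simp only: S dg)
    finally show ?thesis by (simp add: sum_distrib_left)
  qed
  have "(\<Sum>j\<in>UNIV. \<Sum>i\<in>UNIV. \<Sum>k\<in>UNIV. \<Sum>l\<in>UNIV. G i k * (\<Gamma> l k j * T i l) * X j)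
      = (\<Sum>j\<in>UNIV. 1/2 * (\<Sum>k\<in>UNIV. \<Sum>m\<in>UNIV. S k m * dg j k m) * X j)"
    unfolding one[symmetric] by (simp only: sum_distrib_right)
  also have "\<dots> = 1/2 * (\<Sum>j\<in>UNIV. \<Sum>k\<in>UNIV. \<Sum>m\<in>UNIV. S k m * (X j * dg j k m))"
    unfolding sum_distrib_left sum_distrib_right by (intro sum.cong refl) simp
  also have "(\<Sum>j\<in>UNIV. \<Sum>k\<in>UNIV. \<Sum>m\<in>UNIV. S k m * (X j * dg j k m)) = (\<Sum>k\<in>UNIV. \<Sum>m\<in>UNIV. S k m * (\<Sum>j\<in>UNIV. X j * dg j k m))"
    unfolding sum_distrib_left by (rule sum_swap3)
  also have "\<dots> = (\<Sum>k\<in>UNIV. \<Sum>l\<in>UNIV. \<Sum>i\<in>UNIV. \<Sum>j\<in>UNIV. G i k * G j l * T i j * (\<Sum>m\<in>UNIV. X m * dg m k l))"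
    unfolding S_def sum_distrib_right by (intro sum.cong refl) (simp add: mult_ac)
  also have "\<dots> = (\<Sum>l\<in>UNIV. \<Sum>i\<in>UNIV. \<Sum>j\<in>UNIV. \<Sum>k\<in>UNIV. G i k * G j l * T i j * (\<Sum>m\<in>UNIV. X m * dg m k l))"
    by (rule sum_swap4)
  also have "\<dots> = (\<Sum>i\<in>UNIV. \<Sum>j\<in>UNIV. \<Sum>k\<in>UNIV. \<Sum>l\<in>UNIV. G i k * G j l * T i j * (\<Sum>m\<in>UNIV. X m * dg m k l))"
    by (rule sum_swap4)
  finally show ?thesis .
qed

end

lemma tensor_inner_conjugate:
  assumes "transpose G = G"
  shows "tensor_inner G T M = (\<Sum>i\<in>UNIV. \<Sum>j\<in>UNIV. T $ i $ j * (G ** M ** G) $ i $ j)"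
proof -
  have "(\<Sum>k\<in>UNIV. \<Sum>l\<in>UNIV. G $ i $ k * G $ j $ l * T $ i $ j * M $ k $ l) = T $ i $ j * (G ** M ** G) $ i $ j" for i j
  proof -
    have "(\<Sum>k\<in>UNIV. \<Sum>l\<in>UNIV. G $ i $ k * G $ j $ l * T $ i $ j * M $ k $ l)
        = (\<Sum>l\<in>UNIV. \<Sum>k\<in>UNIV. G $ i $ k * G $ j $ l * T $ i $ j * M $ k $ l)" by (rule sum.swap)
    also have "\<dots> = (\<Sum>l\<in>UNIV. \<Sum>k\<in>UNIV. T $ i $ j * (G $ i $ k * M $ k $ l * G $ l $ j))"
      by (intro sum.cong refl) (simp only: symmetric_matrix_nth[OF assms, of _ j] mult_ac)
    finally show ?thesis
      by (simp only: matrix_matrix_mult_def vec_lambda_beta sum_distrib_left sum_distrib_right)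
  qed
  then show ?thesis by (simp only: tensor_inner_def)
qed

context closed_riemannian_manifold
begin

lemma C1_in_chart_mult:
  assumes "c \<in> A" "C1_in_chart c f" "C1_in_chart c h"
  shows "C1_in_chart c (\<lambda>y. f y * h y)"
  using C_k_on_mult[OF open_chart_img[OF assms(1)] assms(2,3)[unfolded C1_in_chart_def]]
  unfolding C1_in_chart_def o_def .

lemma C1_in_chart_sum:
  assumes "c \<in> A" "\<And>i. i \<in> I \<Longrightarrow> C1_in_chart c (f i)"
  shows "C1_in_chart c (\<lambda>y. \<Sum>i\<in>I. f i y)"
  using C_k_on_sum[OF open_chart_img[OF assms(1)] assms(2)[unfolded C1_in_chart_def]]
  unfolding C1_in_chart_def o_def .

lemma C1_in_chart_metric_inv: "c \<in> A \<Longrightarrow> C1_in_chart c (\<lambda>y. metric_inv g c y $ i $ j)"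
  unfolding C1_in_chart_def o_def by (rule C_k_on_metric_inv)

lemma partial_eqI:
  assumes "(f \<circ> chart_inv c has_derivative D) (at (chart_map c p))"
  shows "partial c m f p = D (axis m 1)"
  unfolding partial_def by (rule fun_cong[OF frechet_derivative_at[OF assms, symmetric]])

lemma partial_cong:
  assumes c: "c \<in> A" and p: "p \<in> chart_dom c" and f: "C1_in_chart c f"
    and eq: "\<And>y. y \<in> chart_dom c \<Longrightarrow> f y = h y"
  shows "partial c m h p = partial c m f p"
proof -
  have "(h \<circ> chart_inv c has_derivative chart_differential c f p) (at (chart_map c p))"
    by (rule has_derivative_transform_within_open[OF C1_in_chart_has_derivative[OF c f p] open_chart_img[OF c] chart_map_in_img[OF c p]])
      (simp add: eq chart_inv_in_dom[OF c])
  from partial_eqI[OF this, of m] show ?thesis by (simp add: partial_def chart_differential_def)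
qed

lemma partial_mult:
  assumes c: "c \<in> A" and p: "p \<in> chart_dom c" and f: "C1_in_chart c f" and h: "C1_in_chart c h"
  shows "partial c m (\<lambda>y. f y * h y) p = f p * partial c m h p + partial c m f p * h p"
proof -
  have "((\<lambda>y. f y * h y) \<circ> chart_inv c has_derivative
      (\<lambda>v. (f \<circ> chart_inv c) (chart_map c p) * chart_differential c h p v
        + chart_differential c f p v * (h \<circ> chart_inv c) (chart_map c p))) (at (chart_map c p))"
    using has_derivative_mult[OF C1_in_chart_has_derivative[OF c f p] C1_in_chart_has_derivative[OF c h p]]
    unfolding o_def .
  from partial_eqI[OF this, of m] show ?thesis
    by (simp add: partial_def chart_differential_def chart_inv_map[OF c p])
qed

lemma partial_sum:
  assumes c: "c \<in> A" and p: "p \<in> chart_dom c" and f: "\<And>i. i \<in> I \<Longrightarrow> C1_in_chart c (f i)"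
  shows "partial c m (\<lambda>y. \<Sum>i\<in>I. f i y) p = (\<Sum>i\<in>I. partial c m (f i) p)"
proof -
  have "((\<lambda>y. \<Sum>i\<in>I. f i y) \<circ> chart_inv c has_derivative (\<lambda>v. \<Sum>i\<in>I. chart_differential c (f i) p v)) (at (chart_map c p))"
    using has_derivative_sum[OF C1_in_chart_has_derivative[OF c f p]] unfolding o_def .
  from partial_eqI[OF this, of m] show ?thesis
    by (simp add: partial_def chart_differential_def)
qed

text \<open>Differentiate \<open>metric_inv g ** g = mat 1\<close>.\<close>

lemma partial_metric_inv:
  assumes c: "c \<in> A" and p: "p \<in> chart_dom c"
  shows "(\<chi> i j. partial c m (\<lambda>y. metric_inv g c y $ i $ j) p)
    = - (metric_inv g c p ** metric_partial g c m p ** metric_inv g c p)"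
proof -
  let ?G = "metric_inv g c p" and ?g = "g c p" and ?dg = "metric_partial g c m p"
  let ?dG = "(\<chi> i j. partial c m (\<lambda>y. metric_inv g c y $ i $ j) p) :: real^'n^'n"
  note C1 = C1_in_chart_metric_inv[OF c] C1_in_chart_tensor[OF metric_tensor_field c]
  have "?G ** ?dg + ?dG ** ?g = 0"
  proof -
    have "(?G ** ?dg + ?dG ** ?g) $ i $ k = 0" for i k
    proof -
      have C1p: "C1_in_chart c (\<lambda>y. metric_inv g c y $ i $ j * g c y $ j $ k)" for j
        by (rule C1_in_chart_mult[OF c C1])
      have "partial c m (\<lambda>y. mat 1 $ i $ k) p = partial c m (\<lambda>y. \<Sum>j\<in>UNIV. metric_inv g c y $ i $ j * g c y $ j $ k) p"
      proof (rule partial_cong[OF c p C1_in_chart_sum[OF c C1p]])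
        fix y assume y: "y \<in> chart_dom c"
        have "(metric_inv g c y ** g c y) $ i $ k = mat 1 $ i $ k"
          by (simp only: metric_inv_matrix[OF c y])
        then show "(\<Sum>j\<in>UNIV. metric_inv g c y $ i $ j * g c y $ j $ k) = mat 1 $ i $ k"
          by (simp only: matrix_matrix_mult_def vec_lambda_beta)
      qed
      also have "\<dots> = (\<Sum>j\<in>UNIV. partial c m (\<lambda>y. metric_inv g c y $ i $ j * g c y $ j $ k) p)"
        by (rule partial_sum[OF c p C1p])
      also have "\<dots> = (\<Sum>j\<in>UNIV. ?G $ i $ j * ?dg $ j $ k + ?dG $ i $ j * ?g $ j $ k)"
        by (intro sum.cong refl) (simp only: partial_mult[OF c p C1] metric_partial_def vec_lambda_beta)
      also have "\<dots> = (?G ** ?dg + ?dG ** ?g) $ i $ k"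
        by (simp only: vector_add_component matrix_matrix_mult_def vec_lambda_beta sum.distrib)
      also have "partial c m (\<lambda>y. mat 1 $ i $ k :: real) p = 0"
        by (rule partial_eqI[of _ _ "\<lambda>_. 0"]) (simp add: o_def)
      finally show ?thesis by simp
    qed
    then show ?thesis by (simp add: vec_eq_iff)
  qed
  then have "?dG ** ?g = - (?G ** ?dg)" by (simp only: add_eq_0_iff)
  then have "(?dG ** ?g) ** ?G = (- (?G ** ?dg)) ** ?G" by (simp only:)
  moreover have "(?dG ** ?g) ** ?G = ?dG"
    by (simp only: matrix_mul_assoc[symmetric] metric_inv_matrix[OF c p] matrix_mul_rid)
  moreover have "(- (?G ** ?dg)) ** ?G = - (?G ** ?dg ** ?G)"
    by (simp add: vec_eq_iff matrix_matrix_mult_def sum_negf)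
  ultimately show ?thesis by (simp only:)
qed

definition contraction :: "('m, 'n) tensor2 \<Rightarrow> ('m, 'n) vfield \<Rightarrow> ('m, 'n) vfield" where
  "contraction T X c p = metric_inv g c p *v (T c p *v X c p)"

lemma vector_field_contraction:
  assumes T: "tensor_field A T" and X: "vector_field A X"
  shows "vector_field A (contraction T X)"
  unfolding vector_field_def
proof (intro conjI ballI)
  fix c assume c: "c \<in> A"
  have X_C_k: "C_k_on k (chart_img c) (\<lambda>x. X c (chart_inv c x) $ i)" for k i
  proof -
    have "smooth_on (chart_img c) (X c \<circ> chart_inv c)"
      using X c unfolding vector_field_def smooth_in_chart_def by blast
    then have "C_k_on k (chart_img c) (\<lambda>x. X c (chart_inv c x))"
      unfolding smooth_on_def o_def by (rule spec)
    from C_k_on_nth[OF open_chart_img[OF c] this] show ?thesis .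
  qed
  show "smooth_in_chart c (contraction T X c)"
    unfolding smooth_in_chart_def smooth_on_def o_def contraction_def matrix_vector_mult_def vec_lambda_beta
    by (intro allI C_k_on_vec C_k_on_sum C_k_on_mult open_chart_img[OF c] C_k_on_metric_inv[OF c]
        C_k_on_tensor_components[OF T c] X_C_k)
  fix d p assume d: "d \<in> A" and p: "p \<in> chart_dom c \<inter> chart_dom d"
  let ?J = "coord_jacobian c d p"
  have p': "p \<in> chart_dom c" "p \<in> chart_dom d" using p by blast+
  have "contraction T X d p = ((metric_inv g d p ** T d p) ** ?J) *v X c p"
    unfolding contraction_def vector_field_change[OF X c d p] by (simp only: matrix_vector_mul_assoc matrix_mul_assoc)
  also have "\<dots> = (?J ** (metric_inv g c p ** T c p)) *v X c p"
    by (simp only: raised_tensor_change[OF T c d p'])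
  also have "\<dots> = ?J *v contraction T X c p"
    unfolding contraction_def by (simp only: matrix_vector_mul_assoc matrix_mul_assoc)
  finally show "contraction T X d p = ?J *v contraction T X c p" .
qed

text \<open>The product rule \<open>div (T X) = (div T) X + \<langle>T, \<nabla>X\<rangle>\<close>; a symmetric \<open>T\<close> only sees the symmetric part
  of \<open>\<nabla>X\<close>, which is half of the Lie derivative of the metric.  The proof compares coordinate expressions.
  The derivatives of \<open>T\<close> and of \<open>X\<close> give \<open>A2\<close> and \<open>A1\<close>, and those of the metric occur in the contracted
  Christoffel terms and in the part \<open>?L1\<close> of the Lie derivative.\<close>

lemma chart_div_contraction:
  assumes T: "symmetric_tensor_field A T" and X: "vector_field A X" and c: "c \<in> A" and p: "p \<in> chart_dom c"
  shows "chart_div g c (contraction T X) p = (\<Sum>j\<in>UNIV. div_tensor g T c p $ j * X c p $ j)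
    + 1/2 * tensor_inner (metric_inv g c p) (T c p) (lie_derivative X g c p)"
proof -
  have tf: "tensor_field A T" using T unfolding symmetric_tensor_field_def by blast
  have symT: "transpose (T c p) = T c p" using T c p unfolding symmetric_tensor_field_def by blast
  define G where "G i j = metric_inv g c p $ i $ j" for i j
  define t where "t i j = T c p $ i $ j" for i j
  define x where "x i = X c p $ i" for i
  define dg where "dg m i j = metric_partial g c m p $ i $ j" for m i j
  define dt where "dt m i j = partial c m (\<lambda>y. T c y $ i $ j) p" for m i j
  define dx where "dx m i = partial c m (\<lambda>y. X c y $ i) p" for m i
  define \<Gamma> where "\<Gamma> k i j = christoffel g c k i j p" for k i j
  define U where "U i = (\<Sum>k\<in>UNIV. t i k * x k)" for i
  define V where "V i = (\<Sum>j\<in>UNIV. G i j * U j)" for i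
  have symG: "G i j = G j i" for i j unfolding G_def by (rule metric_inv_symmetric[OF c p])
  have symt: "t i j = t j i" for i j unfolding t_def by (rule symmetric_matrix_nth[OF symT])
  have symdg: "dg m i j = dg m j i" for m i j unfolding dg_def by (rule metric_partial_symmetric[OF c p])
  have \<Gamma>_eq: "\<Gamma> k i j = (\<Sum>l\<in>UNIV. 1/2 * G k l * (dg i j l + dg j i l - dg l i j))" for k i j
    unfolding \<Gamma>_def G_def dg_def by (rule christoffel_metric_partial)
  note contr = symG symt symdg U_def V_def \<Gamma>_eq
  have Y: "contraction T X c p $ i = V i" for i
    by (simp only: contraction_def matrix_vector_mult_def vec_lambda_beta V_def U_def G_def t_def x_def)
  have dY: "partial c i (\<lambda>y. contraction T X c y $ i) p
      = (\<Sum>j\<in>UNIV. G i j * (\<Sum>k\<in>UNIV. t j k * dx i k + dt i j k * x k)) - (\<Sum>a\<in>UNIV. \<Sum>b\<in>UNIV. G i a * (dg i a b * V b))" for i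
  proof -
    define u where "u j y = (\<Sum>k\<in>UNIV. T c y $ j $ k * X c y $ k)" for j y
    note C1T = C1_in_chart_tensor[OF tf c] and C1X = C1_in_chart_vector_field[OF X c]
    have C1u: "C1_in_chart c (u j)" for j
      unfolding u_def by (intro C1_in_chart_sum[OF c] C1_in_chart_mult[OF c] C1T C1X)
    have u: "u j p = U j" for j by (simp only: u_def U_def t_def x_def)
    have du: "partial c i (u j) p = (\<Sum>k\<in>UNIV. t j k * dx i k + dt i j k * x k)" for j
      unfolding u_def
      by (simp only: partial_sum[OF c p C1_in_chart_mult[OF c C1T C1X]] partial_mult[OF c p C1T C1X] t_def x_def dt_def dx_def)
    let ?dG = "(\<chi> r s. partial c i (\<lambda>y. metric_inv g c y $ r $ s) p) :: real^'n^'n"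
    have "(\<Sum>j\<in>UNIV. ?dG $ i $ j * U j) = - (\<Sum>a\<in>UNIV. \<Sum>b\<in>UNIV. G i a * (dg i a b * V b))"
    proof -
      have "(\<Sum>j\<in>UNIV. ?dG $ i $ j * U j) = (?dG *v (\<chi> j. U j)) $ i"
        by (simp only: matrix_vector_mult_def vec_lambda_beta)
      also have "?dG *v (\<chi> j. U j) = - (metric_inv g c p *v (metric_partial g c i p *v (metric_inv g c p *v (\<chi> j. U j))))"
        unfolding partial_metric_inv[OF c p]
        by (simp only: matrix_vector_mul_assoc matrix_mul_assoc) (simp add: vec_eq_iff matrix_vector_mult_def sum_negf)
      also have "metric_inv g c p *v (\<chi> j. U j) = (\<chi> j. V j)"
        by (simp only: matrix_vector_mult_def vec_lambda_beta V_def G_def)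
      finally show ?thesis
        by (simp only: matrix_vector_mult_def vec_lambda_beta vector_uminus_component sum_distrib_left G_def dg_def)
    qed
    moreover have "partial c i (\<lambda>y. contraction T X c y $ i) p
        = (\<Sum>j\<in>UNIV. G i j * (\<Sum>k\<in>UNIV. t j k * dx i k + dt i j k * x k)) + (\<Sum>j\<in>UNIV. ?dG $ i $ j * U j)"
    proof -
      have "(\<lambda>y. contraction T X c y $ i) = (\<lambda>y. \<Sum>j\<in>UNIV. metric_inv g c y $ i $ j * u j y)"
        by (simp only: contraction_def matrix_vector_mult_def vec_lambda_beta u_def)
      then have "partial c i (\<lambda>y. contraction T X c y $ i) p = partial c i (\<lambda>y. \<Sum>j\<in>UNIV. metric_inv g c y $ i $ j * u j y) p"
        by (simp only:)
      also have "\<dots> = (\<Sum>j\<in>UNIV. partial c i (\<lambda>y. metric_inv g c y $ i $ j * u j y) p)"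
        by (rule partial_sum[OF c p C1_in_chart_mult[OF c C1_in_chart_metric_inv[OF c] C1u]])
      also have "\<dots> = (\<Sum>j\<in>UNIV. G i j * partial c i (u j) p + ?dG $ i $ j * U j)"
        by (simp only: partial_mult[OF c p C1_in_chart_metric_inv[OF c] C1u] u G_def vec_lambda_beta)
      finally show ?thesis by (simp only: du sum.distrib)
    qed
    ultimately show ?thesis by simp
  qed
  define A1 where "A1 = (\<Sum>i\<in>UNIV. \<Sum>j\<in>UNIV. \<Sum>k\<in>UNIV. G i j * t j k * dx i k)"
  define A2 where "A2 = (\<Sum>i\<in>UNIV. \<Sum>j\<in>UNIV. \<Sum>k\<in>UNIV. G i j * dt i j k * x k)"
  let ?W = "(\<Sum>i\<in>UNIV. \<Sum>a\<in>UNIV. \<Sum>b\<in>UNIV. G i a * (dg i a b * V b))"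
  let ?R = "(\<Sum>i\<in>UNIV. 1/2 * (\<Sum>a\<in>UNIV. \<Sum>b\<in>UNIV. G a b * dg i b a) * V i)"
  let ?D3 = "(\<Sum>j\<in>UNIV. \<Sum>i\<in>UNIV. \<Sum>k\<in>UNIV. \<Sum>l\<in>UNIV. G i k * (\<Gamma> l k j * t i l) * x j)"
  have "chart_div g c (contraction T X) p = (\<Sum>i\<in>UNIV. \<Sum>j\<in>UNIV. G i j * (\<Sum>k\<in>UNIV. t j k * dx i k + dt i j k * x k)) - ?W + ?R"
  proof -
    have "trace (metric_inv g c p ** metric_partial g c i p) = (\<Sum>a\<in>UNIV. \<Sum>b\<in>UNIV. G a b * dg i b a)" for i
      by (simp only: trace_def matrix_matrix_mult_def vec_lambda_beta G_def dg_def)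
    then show ?thesis
      by (simp only: chart_div_trace[OF c p] dY Y sum.distrib sum_subtractf)
  qed
  also have "(\<Sum>i\<in>UNIV. \<Sum>j\<in>UNIV. G i j * (\<Sum>k\<in>UNIV. t j k * dx i k + dt i j k * x k)) = A1 + A2"
    unfolding A1_def A2_def sum.distrib[symmetric] sum_distrib_left by (intro sum.cong refl) (simp add: algebra_simps)
  finally have lhs: "chart_div g c (contraction T X) p = A1 + A2 - ?W + ?R" .
  have "(\<Sum>j\<in>UNIV. div_tensor g T c p $ j * X c p $ j)
      = (\<Sum>j\<in>UNIV. \<Sum>i\<in>UNIV. \<Sum>k\<in>UNIV. G i k * dt k i j * x j)
        - (\<Sum>j\<in>UNIV. \<Sum>i\<in>UNIV. \<Sum>k\<in>UNIV. \<Sum>l\<in>UNIV. G i k * (\<Gamma> l k i * t l j) * x j) - ?D3"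
    unfolding div_tensor_def nabla_tensor_def vec_lambda_beta G_def[symmetric] t_def[symmetric] x_def[symmetric]
      dt_def[symmetric] \<Gamma>_def[symmetric] sum_subtractf[symmetric]
      sum_distrib_right
    by (intro sum.cong refl) (simp add: right_diff_distrib left_diff_distrib sum_distrib_left sum_distrib_right)
  also have "(\<Sum>j\<in>UNIV. \<Sum>i\<in>UNIV. \<Sum>k\<in>UNIV. G i k * dt k i j * x j) = A2"
  proof -
    have "(\<Sum>j\<in>UNIV. \<Sum>i\<in>UNIV. \<Sum>k\<in>UNIV. G i k * dt k i j * x j) = (\<Sum>i\<in>UNIV. \<Sum>k\<in>UNIV. \<Sum>j\<in>UNIV. G i k * dt k i j * x j)"
      by (rule sum_swap3)
    also have "\<dots> = (\<Sum>k\<in>UNIV. \<Sum>i\<in>UNIV. \<Sum>j\<in>UNIV. G i k * dt k i j * x j)" by (rule sum.swap)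
    also have "\<dots> = A2" unfolding A2_def by (intro sum.cong refl) (simp only: symG)
    finally show ?thesis .
  qed
  also have "(\<Sum>j\<in>UNIV. \<Sum>i\<in>UNIV. \<Sum>k\<in>UNIV. \<Sum>l\<in>UNIV. G i k * (\<Gamma> l k i * t l j) * x j) = ?W - ?R"
    by (rule christoffel_contraction_trace[OF contr])
  finally have div_t: "(\<Sum>j\<in>UNIV. div_tensor g T c p $ j * X c p $ j) = A2 - (?W - ?R) - ?D3" .
  let ?G = "metric_inv g c p" and ?DX = "(\<chi> k m. dx k m) :: real^'n^'n"
  let ?L1 = "(\<chi> k l. \<Sum>m\<in>UNIV. x m * dg m k l) :: real^'n^'n"
  have L: "lie_derivative X g c p = ?L1 + (?DX ** g c p + g c p ** transpose ?DX)"
    by (simp add: vec_eq_iff lie_derivative_def matrix_matrix_mult_def transpose_def x_def dg_def dx_def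
        metric_partial_def sum.distrib mult.commute)
  have L1: "1/2 * tensor_inner ?G (T c p) ?L1 = ?D3"
    unfolding tensor_inner_def vec_lambda_beta G_def[symmetric] t_def[symmetric]
    by (rule christoffel_contraction_symmetric[OF contr, symmetric])
  note symG' = metric_inv_matrix(3)[OF c p]
  have L2: "tensor_inner ?G (T c p) (?DX ** g c p) = A1"
  proof -
    have "?G ** (?DX ** g c p) ** ?G = ?G ** ?DX ** (g c p ** ?G)" by (simp only: matrix_mul_assoc)
    then have "tensor_inner ?G (T c p) (?DX ** g c p) = (\<Sum>i\<in>UNIV. \<Sum>j\<in>UNIV. T c p $ i $ j * (?G ** ?DX) $ i $ j)"
      by (simp only: tensor_inner_conjugate[OF symG'] metric_inv_matrix[OF c p] matrix_mul_rid)
    also have "\<dots> = (\<Sum>j\<in>UNIV. \<Sum>k\<in>UNIV. \<Sum>i\<in>UNIV. t j k * (G j i * dx i k))"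
      by (simp only: matrix_matrix_mult_def vec_lambda_beta sum_distrib_left t_def G_def)
    also have "\<dots> = (\<Sum>i\<in>UNIV. \<Sum>j\<in>UNIV. \<Sum>k\<in>UNIV. t j k * (G j i * dx i k))"
      by (rule sum_swap3[symmetric])
    also have "\<dots> = A1"
      unfolding A1_def by (intro sum.cong refl) (simp only: symG mult_ac)
    finally show ?thesis .
  qed
  have L3: "tensor_inner ?G (T c p) (g c p ** transpose ?DX) = A1"
  proof -
    have "?G ** (g c p ** transpose ?DX) ** ?G = (?G ** g c p) ** transpose ?DX ** ?G" by (simp only: matrix_mul_assoc)
    then have "tensor_inner ?G (T c p) (g c p ** transpose ?DX) = (\<Sum>i\<in>UNIV. \<Sum>j\<in>UNIV. T c p $ i $ j * (transpose ?DX ** ?G) $ i $ j)"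
      by (simp only: tensor_inner_conjugate[OF symG'] metric_inv_matrix[OF c p] matrix_mul_lid)
    also have "\<dots> = (\<Sum>k\<in>UNIV. \<Sum>j\<in>UNIV. \<Sum>i\<in>UNIV. t k j * (dx i k * G i j))"
      by (simp only: matrix_matrix_mult_def transpose_def vec_lambda_beta sum_distrib_left t_def G_def)
    also have "\<dots> = (\<Sum>j\<in>UNIV. \<Sum>i\<in>UNIV. \<Sum>k\<in>UNIV. t k j * (dx i k * G i j))"
      by (rule sum_swap3)
    also have "\<dots> = (\<Sum>i\<in>UNIV. \<Sum>j\<in>UNIV. \<Sum>k\<in>UNIV. t k j * (dx i k * G i j))"
      by (rule sum.swap)
    also have "\<dots> = A1"
      unfolding A1_def by (intro sum.cong refl) (simp only: symt mult_ac)
    finally show ?thesis .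
  qed
  show ?thesis
    unfolding lhs div_t L tensor_inner_add_right L2 L3 distrib_left L1 by simp
qed

lemma div_vector_contraction:
  assumes "symmetric_tensor_field A T" "vector_field A X"
  shows "div_vector A g (contraction T X) p = div_tensor_app A g T X p
    + 1/2 * tensor_inner (metric_inv g (chart_at A p) p) (T (chart_at A p) p) (lie_derivative X g (chart_at A p) p)"
  unfolding div_tensor_app_def Let_def chart_div_contraction[OF assms chart_at, symmetric]
  by (simp only: div_vector_def chart_div_def)

text \<open>Both sides consist of the derivatives of \<open>X\<close>, taken twice, and of the derivative of the logarithm of
  \<open>det g\<close> along \<open>X\<close>.\<close>

lemma chart_trace_lie_derivative:
  assumes X: "vector_field A X" and c: "c \<in> A" and p: "p \<in> chart_dom c"
  shows "chart_trace c (lie_derivative X g) p = 2 * chart_div g c X p"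
proof -
  let ?G = "metric_inv g c p" and ?DX = "(\<chi> k m. partial c k (\<lambda>y. X c y $ m) p) :: real^'n^'n"
  let ?L1 = "(\<chi> k l. \<Sum>m\<in>UNIV. X c p $ m * metric_partial g c m p $ k $ l) :: real^'n^'n"
  have L: "lie_derivative X g c p = ?L1 + (?DX ** g c p + g c p ** transpose ?DX)"
    by (simp add: vec_eq_iff lie_derivative_def matrix_matrix_mult_def transpose_def
        metric_partial_def sum.distrib mult.commute)
  have "?G ** (?L1 + (?DX ** g c p + g c p ** transpose ?DX)) = ?G ** ?L1 + (?G ** (?DX ** g c p) + (?G ** g c p) ** transpose ?DX)"
    by (simp only: matrix_add_ldistrib matrix_mul_assoc)
  then have "chart_trace c (lie_derivative X g) p = trace (?G ** ?L1) + (trace (?G ** (?DX ** g c p)) + trace (transpose ?DX))"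
    by (simp only: chart_trace_eq_trace[OF c p] L trace_add metric_inv_matrix[OF c p] matrix_mul_lid)
  also have "trace (?G ** (?DX ** g c p)) = trace (?DX ** g c p ** ?G)" by (rule trace_mul_sym)
  also have "\<dots> = trace ?DX" by (simp only: matrix_mul_assoc[symmetric] metric_inv_matrix[OF c p] matrix_mul_rid)
  also have "trace (transpose ?DX) = trace ?DX" by (simp add: trace_def transpose_def)
  also have "trace ?DX = (\<Sum>i\<in>UNIV. partial c i (\<lambda>y. X c y $ i) p)" by (simp only: trace_def vec_lambda_beta)
  also have "trace (?G ** ?L1) = (\<Sum>i\<in>UNIV. trace (?G ** metric_partial g c i p) * X c p $ i)"
  proof -
    have "trace (?G ** ?L1) = (\<Sum>a\<in>UNIV. \<Sum>b\<in>UNIV. \<Sum>i\<in>UNIV. ?G $ a $ b * metric_partial g c i p $ b $ a * X c p $ i)"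
      by (simp add: trace_def matrix_matrix_mult_def sum_distrib_left mult_ac)
    also have "\<dots> = (\<Sum>i\<in>UNIV. \<Sum>a\<in>UNIV. \<Sum>b\<in>UNIV. ?G $ a $ b * metric_partial g c i p $ b $ a * X c p $ i)"
      by (rule sum_swap3[symmetric])
    finally show ?thesis by (simp only: trace_def matrix_matrix_mult_def vec_lambda_beta sum_distrib_right)
  qed
  finally show ?thesis
    by (simp add: chart_div_trace[OF c p] sum.distrib sum_distrib_left algebra_simps)
qed

end

section \<open>Trace-free parts\<close>

context closed_riemannian_manifold
begin

lemma chart_trace_metric:
  assumes "c \<in> A" "p \<in> chart_dom c"
  shows "chart_trace c g p = real CARD('n)"
  unfolding chart_trace_eq_trace[OF assms] metric_inv_matrix[OF assms] by (rule trace_I)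

lemma chart_trace_add_scaled_metric:
  assumes "c \<in> A" "p \<in> chart_dom c"
  shows "chart_trace c (\<lambda>c p. T c p + f p *\<^sub>R g c p) p = chart_trace c T p + f p * real CARD('n)"
  unfolding chart_trace_metric[OF assms, symmetric]
  by (simp add: chart_trace_def algebra_simps sum.distrib sum_distrib_left)

lemma tensor_inner_metric:
  assumes c: "c \<in> A" and p: "p \<in> chart_dom c"
  shows "tensor_inner (metric_inv g c p) (T c p) (g c p) = chart_trace c T p"
  by (simp only: tensor_inner_eq_trace[OF metric_inv_matrix(3)[OF c p] metric_symmetric[OF c p]]
      metric_inv_matrix[OF c p] matrix_mul_rid chart_trace_eq_trace[OF c p])

lemma trace_free_eq: "trace_free A g T = (\<lambda>c p. T c p + (- (tr A g T p / real CARD('n))) *\<^sub>R g c p)"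
  by (intro ext) (simp add: trace_free_def)

lemma smooth_function_cmult_add:
  assumes "smooth_function A f" "smooth_function A h"
  shows "smooth_function A (\<lambda>p. a * f p + b * h p)"
  unfolding smooth_function_def smooth_in_chart_def smooth_on_def o_def
proof (intro ballI allI)
  fix c k assume c: "c \<in> A"
  note o = open_chart_img[OF c]
  show "C_k_on k (chart_img c) (\<lambda>x. a * f (chart_inv c x) + b * h (chart_inv c x))"
    by (rule C_k_on_add[OF o C_k_on_mult[OF o C_k_on_const smooth_function_C_k_on[OF assms(1) c]]
        C_k_on_mult[OF o C_k_on_const smooth_function_C_k_on[OF assms(2) c]]])
qed

lemma trace_free_symmetric_tensor_field:
  assumes T: "symmetric_tensor_field A T"
  shows "symmetric_tensor_field A (trace_free A g T)"
  unfolding trace_free_eq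
proof (rule scaled_metric_symmetric_tensor_field[OF T])
  have tr: "smooth_function A (tr A g T)"
    using T by (intro smooth_tr) (simp add: symmetric_tensor_field_def)
  have "(\<lambda>p. - (tr A g T p / real CARD('n))) = (\<lambda>p. - 1 / real CARD('n) * tr A g T p + 0 * tr A g T p)"
    by (simp add: fun_eq_iff)
  then show "smooth_function A (\<lambda>p. - (tr A g T p / real CARD('n)))"
    using smooth_function_cmult_add[OF tr tr, of "- 1 / real CARD('n)" 0] by (simp only:)
qed

lemma chart_trace_trace_free:
  assumes T: "tensor_field A T" and c: "c \<in> A" and p: "p \<in> chart_dom c"
  shows "chart_trace c (trace_free A g T) p = 0"
  unfolding trace_free_eq chart_trace_add_scaled_metric[OF c p] tr_chart[OF T c p] by simp

text \<open>Pythagoras: \<open>T\<close> is its trace-free part plus a multiple of the metric, and the two are orthogonal.\<close>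

lemma norm_sq_trace_free:
  assumes T: "symmetric_tensor_field A T"
  shows "norm_sq A g (trace_free A g T) p = norm_sq A g T p - (tr A g T p)\<^sup>2 / real CARD('n)"
proof -
  let ?c = "chart_at A p"
  note c = chart_at(1)[of p] and p = chart_at(2)[of p]
  let ?G = "metric_inv g ?c p" and ?T = "T ?c p" and ?S = "trace_free A g T ?c p" and ?f = "- (tr A g T p / real CARD('n))"
  have tf: "tensor_field A T" using T unfolding symmetric_tensor_field_def by blast
  have symT: "transpose ?T = ?T" using T c p unfolding symmetric_tensor_field_def by blast
  have symS: "transpose ?S = ?S"
    using trace_free_symmetric_tensor_field[OF T] c p unfolding symmetric_tensor_field_def by blast
  note symG = metric_inv_matrix(3)[OF c p]
  have S: "?S = ?T + ?f *\<^sub>R g ?c p" by (simp only: trace_free_eq)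
  have "tensor_inner ?G ?S ?S = tensor_inner ?G ?S ?T + ?f * tensor_inner ?G ?S (g ?c p)"
    by (subst (2) S) (simp only: tensor_inner_add_right tensor_inner_scale_right)
  also have "tensor_inner ?G ?S (g ?c p) = 0"
    by (simp only: tensor_inner_metric[OF c p] chart_trace_trace_free[OF tf c p])
  also have "tensor_inner ?G ?S ?T = tensor_inner ?G ?T ?S"
    by (simp only: tensor_inner_eq_trace[OF symG symT] tensor_inner_eq_trace[OF symG symS]) (rule trace_mul_sym)
  also have "\<dots> = tensor_inner ?G ?T ?T + ?f * tensor_inner ?G ?T (g ?c p)"
    unfolding S by (simp only: tensor_inner_add_right tensor_inner_scale_right)
  also have "tensor_inner ?G ?T (g ?c p) = tr A g T p"
    by (simp only: tensor_inner_metric[OF c p] tr_chart[OF tf c p])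
  finally show ?thesis by (simp add: norm_sq_inner power2_eq_square)
qed

text \<open>A continuous nonnegative function with integral 0 vanishes, and the square norm vanishes only at the
  zero tensor.\<close>

lemma integral_norm_sq_eq_0_iff:
  assumes T: "symmetric_tensor_field A T"
  shows "(LINT p|dvol A g. norm_sq A g T p) = 0 \<longleftrightarrow> (\<forall>c\<in>A. \<forall>p\<in>chart_dom c. T c p = 0)"
proof
  assume int: "(LINT p|dvol A g. norm_sq A g T p) = 0"
  have zero: "norm_sq A g T p = 0" for p
    by (rule integral_dvol_eq_0_imp[OF continuous_norm_sq[OF T] norm_sq_nonneg int])
  show "\<forall>c\<in>A. \<forall>p\<in>chart_dom c. T c p = 0"
  proof (intro ballI)
    fix c p assume c: "c \<in> A" and p: "p \<in> chart_dom c"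
    have "T (chart_at A p) p = 0" using zero[of p] norm_sq_eq_0_iff by blast
    moreover have "T c p = transpose (coord_jacobian c (chart_at A p) p) ** T (chart_at A p) p ** coord_jacobian c (chart_at A p) p"
    proof (rule tensor_field_change)
      show "tensor_field A T" using T unfolding symmetric_tensor_field_def by blast
    qed (use c p chart_at in blast)+
    ultimately show "T c p = 0" by simp
  qed
next
  assume "\<forall>c\<in>A. \<forall>p\<in>chart_dom c. T c p = 0"
  then have "norm_sq A g T p = 0" for p
    using chart_at norm_sq_eq_0_iff by blast
  then show "(LINT p|dvol A g. norm_sq A g T p) = 0" by simp
qed

end

section \<open>The integral formulas\<close>

locale almost_conformal_setting = closed_riemannian_manifold A g
  for A :: "('m::t2_space, 'n::finite) chart set" and g :: "('m, 'n) tensor2" +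
  fixes q :: "('m, 'n) tensor2" and X :: "('m, 'n) vfield" and \<phi> :: "'m \<Rightarrow> real"
  assumes q: "symmetric_tensor_field A q" and X: "vector_field A X" and \<phi>: "smooth_function A \<phi>"
    and half_lie_derivative: "tensor_eq A (\<lambda>c p. (1/2) *\<^sub>R lie_derivative X g c p)
                     (\<lambda>c p. (1/2) *\<^sub>R q c p + \<phi> p *\<^sub>R g c p)"
begin

lemma tensor_field_q: "tensor_field A q"
  using q unfolding symmetric_tensor_field_def by blast

lemma lie_derivative_metric:
  assumes "c \<in> A" "p \<in> chart_dom c"
  shows "lie_derivative X g c p = q c p + (2 * \<phi> p) *\<^sub>R g c p"
proof -
  have "(1/2) *\<^sub>R lie_derivative X g c p = (1/2) *\<^sub>R q c p + \<phi> p *\<^sub>R g c p"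
    using half_lie_derivative assms unfolding tensor_eq_def by blast
  then have "2 *\<^sub>R ((1/2) *\<^sub>R lie_derivative X g c p) = 2 *\<^sub>R ((1/2) *\<^sub>R q c p + \<phi> p *\<^sub>R g c p)"
    by (rule arg_cong)
  then show ?thesis by (simp add: scaleR_add_right)
qed

lemma chart_trace_lie_derivative_metric:
  assumes "c \<in> A" "p \<in> chart_dom c"
  shows "chart_trace c (lie_derivative X g) p = tr A g q p + 2 * \<phi> p * real CARD('n)"
proof -
  have "chart_trace c (lie_derivative X g) p = chart_trace c (\<lambda>c p. q c p + (2 * \<phi> p) *\<^sub>R g c p) p"
    unfolding chart_trace_def by (simp only: lie_derivative_metric[OF assms])
  then show ?thesis
    by (simp only: chart_trace_add_scaled_metric[OF assms] tr_chart[OF tensor_field_q assms])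
qed

lemma div_vector_X: "2 * div_vector A g X p = tr A g q p + 2 * \<phi> p * real CARD('n)"
  using chart_trace_lie_derivative[OF X chart_at] chart_trace_lie_derivative_metric[OF chart_at]
  by (simp add: div_vector_chart[OF X chart_at])

text \<open>\<open>L_X g\<close> and \<open>q\<close> differ by a multiple of the metric, so they have the same trace-free part.\<close>

lemma trace_free_lie_derivative: "norm_sq A g (trace_free A g (lie_derivative X g)) p = norm_sq A g (trace_free A g q) p"
proof -
  let ?c = "chart_at A p"
  have "tr A g (lie_derivative X g) p = chart_trace ?c (lie_derivative X g) p"
    by (simp only: tr_def Let_def chart_trace_def)
  then have "trace_free A g (lie_derivative X g) ?c p = trace_free A g q ?c p"
    unfolding trace_free_def lie_derivative_metric[OF chart_at]
    by (simp add: chart_trace_lie_derivative_metric[OF chart_at] add_divide_distrib algebra_simps)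
  then show ?thesis by (simp only: norm_sq_inner)
qed

text \<open>The common end of both formulas: the divergence integrates to 0.\<close>

lemma integral_div_minus_half:
  assumes "symmetric_tensor_field A T"
    and "\<And>p. f p = div_vector A g (contraction T X) p - 1/2 * norm_sq A g (trace_free A g q) p"
  shows "(LINT p|dvol A g. f p) = - (1/2) * (LINT p|dvol A g. norm_sq A g (trace_free A g q) p)"
proof -
  have Y: "vector_field A (contraction T X)"
    using assms(1) by (intro vector_field_contraction X) (simp add: symmetric_tensor_field_def)
  have "(LINT p|dvol A g. f p) = (LINT p|dvol A g. div_vector A g (contraction T X) p - 1/2 * norm_sq A g (trace_free A g q) p)"
    by (simp only: assms(2))
  also have "\<dots> = (LINT p|dvol A g. div_vector A g (contraction T X) p) - (LINT p|dvol A g. 1/2 * norm_sq A g (trace_free A g q) p)"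
    by (intro Bochner_Integration.integral_diff integrable_mult_right integrable_dvol_continuous
        continuous_div_vector[OF Y] continuous_norm_sq trace_free_symmetric_tensor_field q)
  finally show ?thesis by (simp add: divergence_theorem[OF Y])
qed

text \<open>The identity for \<open>div (q X)\<close> with \<open>\<langle>q, L_X g\<rangle> = \<parallel>q\<parallel>\<^sup>2 + 2 \<phi> tr q\<close>.\<close>

lemma integral_div_q:
  "(LINT p|dvol A g. \<phi> p * tr A g q p + (tr A g q p)\<^sup>2 / (2 * real CARD('n)) + div_tensor_app A g q X p)
    = - (1/2) * (LINT p|dvol A g. norm_sq A g (trace_free A g q) p)"
proof (rule integral_div_minus_half[OF q])
  fix p
  let ?c = "chart_at A p"
  have "tensor_inner (metric_inv g ?c p) (q ?c p) (lie_derivative X g ?c p) = norm_sq A g q p + 2 * \<phi> p * tr A g q p"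
    by (simp only: lie_derivative_metric[OF chart_at] tensor_inner_add_right tensor_inner_scale_right
        tensor_inner_metric[OF chart_at] norm_sq_inner tr_chart[OF tensor_field_q chart_at])
  then show "\<phi> p * tr A g q p + (tr A g q p)\<^sup>2 / (2 * real CARD('n)) + div_tensor_app A g q X p
      = div_vector A g (contraction q X) p - 1/2 * norm_sq A g (trace_free A g q) p"
    unfolding div_vector_contraction[OF q X] norm_sq_trace_free[OF q] by (simp add: field_simps)
qed

text \<open>The same identity for the trace-free part of \<open>q\<close>, whose inner product with \<open>L_X g\<close> does not see the
  multiples of \<open>g\<close> contained in \<open>L_X g\<close>.\<close>

lemma integral_div_trace_free_q:
  "(LINT p|dvol A g. div_tensor_app A g (trace_free A g q) X p)
    = - (1/2) * (LINT p|dvol A g. norm_sq A g (trace_free A g q) p)"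
proof (rule integral_div_minus_half[OF trace_free_symmetric_tensor_field[OF q]])
  fix p
  let ?c = "chart_at A p"
  have "lie_derivative X g ?c p = trace_free A g q ?c p + (2 * \<phi> p + tr A g q p / real CARD('n)) *\<^sub>R g ?c p"
    unfolding lie_derivative_metric[OF chart_at] trace_free_def by (simp add: algebra_simps)
  then have "tensor_inner (metric_inv g ?c p) (trace_free A g q ?c p) (lie_derivative X g ?c p) = norm_sq A g (trace_free A g q) p"
    by (simp only: tensor_inner_add_right tensor_inner_scale_right tensor_inner_metric[OF chart_at]
        chart_trace_trace_free[OF tensor_field_q chart_at] norm_sq_inner mult_zero_right add_0_right)
  then show "div_tensor_app A g (trace_free A g q) X p
      = div_vector A g (contraction (trace_free A g q) X) p - 1/2 * norm_sq A g (trace_free A g q) p"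
    unfolding div_vector_contraction[OF trace_free_symmetric_tensor_field[OF q] X] by simp
qed

text \<open>If \<open>q\<close> is pointwise a multiple of the metric, then so is \<open>L_X g = q + 2 \<phi> g\<close>, with a smooth factor; the
  factor of \<open>q\<close> is found by taking traces, since the trace of \<open>L_X g\<close> is twice the divergence of \<open>X\<close>.\<close>

lemma trace_free_eq_0_iff:
  "(\<forall>c\<in>A. \<forall>p\<in>chart_dom c. trace_free A g q c p = 0) \<longleftrightarrow> conformal_field A g X \<and>
    tensor_eq A q (\<lambda>c p. (2 * (div_vector A g X p / real CARD('n) - \<phi> p)) *\<^sub>R g c p)"
proof -
  have tr: "2 * (div_vector A g X p / real CARD('n) - \<phi> p) = tr A g q p / real CARD('n)" for p
  proof -
    have "real CARD('n) \<noteq> 0" by simp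
    then show ?thesis using div_vector_X[of p] by (simp add: field_simps)
  qed
  have iff: "(\<forall>c\<in>A. \<forall>p\<in>chart_dom c. trace_free A g q c p = 0) \<longleftrightarrow>
      tensor_eq A q (\<lambda>c p. (2 * (div_vector A g X p / real CARD('n) - \<phi> p)) *\<^sub>R g c p)"
    unfolding tensor_eq_def tr trace_free_def by simp
  have "conformal_field A g X" if pure: "\<forall>c\<in>A. \<forall>p\<in>chart_dom c. trace_free A g q c p = 0"
    unfolding conformal_field_def
  proof (intro exI conjI)
    show "smooth_function A (\<lambda>p. 1 / (2 * real CARD('n)) * tr A g q p + 1 * \<phi> p)"
      by (rule smooth_function_cmult_add[OF smooth_tr[OF tensor_field_q] \<phi>])
    show "tensor_eq A (lie_derivative X g) (\<lambda>c p. (2 * (1 / (2 * real CARD('n)) * tr A g q p + 1 * \<phi> p)) *\<^sub>R g c p)"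
      unfolding tensor_eq_def
    proof (intro ballI)
      fix c p assume "c \<in> A" "p \<in> chart_dom c"
      moreover from this have "q c p = (tr A g q p / real CARD('n)) *\<^sub>R g c p"
        using pure by (simp add: trace_free_def)
      ultimately show "lie_derivative X g c p = (2 * (1 / (2 * real CARD('n)) * tr A g q p + 1 * \<phi> p)) *\<^sub>R g c p"
        by (simp add: lie_derivative_metric scaleR_add_left[symmetric] distrib_left)
    qed
  qed
  with iff show ?thesis by blast
qed

end

theorem theorem3p1:
  fixes A :: "('m::t2_space, 'n::finite) chart set"
    and g q :: "('m, 'n) tensor2"
    and X :: "('m, 'n) vfield"
    and \<phi> :: "'m \<Rightarrow> real"
  assumes "closed_manifold A"
    and "riemannian_metric A g"
    and "symmetric_tensor_field A q"
    and "vector_field A X"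
    and "smooth_function A \<phi>"
    and "tensor_eq A (\<lambda>c p. (1/2) *\<^sub>R lie_derivative X g c p)
                     (\<lambda>c p. (1/2) *\<^sub>R q c p + \<phi> p *\<^sub>R g c p)"
  shows
    "((LINT p|dvol A g. \<phi> p * tr A g q p + (tr A g q p)\<^sup>2 / (2 * real CARD('n))
                          + div_tensor_app A g q X p)
        = - (1/2) * (LINT p|dvol A g. norm_sq A g (trace_free A g q) p)
      \<and> - (1/2) * (LINT p|dvol A g. norm_sq A g (trace_free A g q) p) \<le> 0)
   \<and> ((LINT p|dvol A g. div_tensor_app A g (trace_free A g q) X p)
        = - (1/2) * (LINT p|dvol A g. norm_sq A g (trace_free A g (lie_derivative X g)) p)
      \<and> - (1/2) * (LINT p|dvol A g. norm_sq A g (trace_free A g (lie_derivative X g)) p) \<le> 0)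
   \<and> ((LINT p|dvol A g. \<phi> p * tr A g q p + (tr A g q p)\<^sup>2 / (2 * real CARD('n))
                          + div_tensor_app A g q X p) = 0
        \<longleftrightarrow> conformal_field A g X \<and>
            tensor_eq A q (\<lambda>c p. (2 * (div_vector A g X p / real CARD('n) - \<phi> p)) *\<^sub>R g c p))
   \<and> ((LINT p|dvol A g. div_tensor_app A g (trace_free A g q) X p) = 0
        \<longleftrightarrow> conformal_field A g X \<and>
            tensor_eq A q (\<lambda>c p. (2 * (div_vector A g X p / real CARD('n) - \<phi> p)) *\<^sub>R g c p))"
proof -
  interpret almost_conformal_setting A g q X \<phi>
    by unfold_locales (fact assms)+
  let ?N = "LINT p|dvol A g. norm_sq A g (trace_free A g q) p"
  have nonpos: "- (1/2) * ?N \<le> 0"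
  proof -
    have "0 \<le> ?N" by (rule Bochner_Integration.integral_nonneg) (rule norm_sq_nonneg)
    then show ?thesis by simp
  qed
  have "- (1/2) * ?N = 0 \<longleftrightarrow> ?N = 0" by simp
  also have "\<dots> \<longleftrightarrow> conformal_field A g X \<and>
      tensor_eq A q (\<lambda>c p. (2 * (div_vector A g X p / real CARD('n) - \<phi> p)) *\<^sub>R g c p)"
    unfolding integral_norm_sq_eq_0_iff[OF trace_free_symmetric_tensor_field[OF q]] by (rule trace_free_eq_0_iff)
  finally have zero: "- (1/2) * ?N = 0 \<longleftrightarrow> conformal_field A g X \<and>
      tensor_eq A q (\<lambda>c p. (2 * (div_vector A g X p / real CARD('n) - \<phi> p)) *\<^sub>R g c p)" .
  show ?thesis
    unfolding trace_free_lie_derivative integral_div_q integral_div_trace_free_q using nonpos zero by blast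
qed

end
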